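(* Let $d\ge 8$, and for a positive integer $m$ and $\beta\in[0,1]$ let $v(m,\beta)$ be the speed of the excited random walk on $\mathbb{Z}^d$ with $m$ identical deterministic cookies of strength $\beta$. Then, for each $m$, $\beta\mapsto v(m,\beta)$ is differentiable on $[0,1)$. Moreover the derivative converges to $\frac1d$ as $m\to\infty$, uniformly in $\beta$ on compact subsets of $[0,1)$: for any $\beta_0\in[0,1)$, $$\lim_{m\to\infty}\ \sup_{\beta\in[0,\beta_0]}\left|\frac{\partial}{\partial\beta}v(m,\beta)-\frac1d\right|=0.$$ Hence, for any $\beta_0\in[0,1)$ there exists $m(\beta_0)$ such that for all $m\ge m(\beta_0)$ the speed $v(m,\beta)$ is increasing in $\beta$ on $[0,\beta_0]$.
   Context: **$m$-ERW.** Given a positive integer $m$ and $\beta\in[0,1]$, the $m$-ERW is the nearest neighbour process $(Y_n)_{n\ge0}$ on $\mathbb{Z}^d$ with law $\mathbb{P}_{m,\beta}$ such that $Y_0=0$; $\mathbb{P}_{m,\beta}[Y_{n+1}-Y_n=\pm e_i\mid Y_0,\dots,Y_n]=\frac1{2d}$ for $2\le i\le d$; and $\mathbb{P}_{m,\beta}[Y_{n+1}-Y_n=\pm e_1\mid Y_0,\dots,Y_n]=\frac{1\pm\beta}{2d}$ if $Y_n$ has been visited fewer than $m$ times before time $n$ (i.e. among times $0,\dots,n-1$), and $=\frac1{2d}$ otherwise. **Speed.** $v(m,\beta)$ is the deterministic almost sure limit of $(Y_n\cdot e_1)/n$ under $\mathbb{P}_{m,\beta}$ (its existence is known). At $\beta=0$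 the derivative is the right derivative. *)

theory Defs
  imports "HOL-Probability.Probability"
begin

text \<open>
  The lattice is \<^typ>\<open>int ^ 'd\<close>, of dimension \<^term>\<open>CARD('d)\<close>, and
  \<open>e1\<close> is the index of the coordinate that carries the drift; the indices of a
  finite type being unordered, it has to be named.  Conditioning on
  \<open>Y\<^sub>0, \<dots>, Y\<^sub>n\<close> means conditioning on each history \<open>y\<close> of positive
  probability.
\<close>

definition is_erw_law :: "'d::finite \<Rightarrow> nat \<Rightarrow> real \<Rightarrow> (nat \<Rightarrow> int ^ 'd) measure \<Rightarrow> bool" where
  "is_erw_law e1 m \<beta> P \<longleftrightarrow>
     prob_space P \<and> sets P = sets (Pi\<^sub>M UNIV (\<lambda>_. count_space UNIV)) \<and>
     (AE Y in P. Y 0 = 0) \<and>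
     (AE Y in P. \<forall>n. \<exists>i. \<exists>s\<in>{1, -1}. Y (Suc n) - Y n = axis i s) \<and>
     (\<forall>n y. \<P>(Y in P. \<forall>k\<le>n. Y k = y k) > 0 \<longrightarrow>
        (\<forall>i. \<forall>s\<in>{1, -1}.
           \<P>(Y in P. Y (Suc n) - Y n = axis i s \<bar> \<forall>k\<le>n. Y k = y k) =
             (if i = e1 \<and> card {k. k < n \<and> y k = y n} < m
              then (1 + of_int s * \<beta>) / (2 * CARD('d)) else 1 / (2 * CARD('d)))))"

definition erw_law :: "'d::finite \<Rightarrow> nat \<Rightarrow> real \<Rightarrow> (nat \<Rightarrow> int ^ 'd) measure" where
  "erw_law e1 m \<beta> = (THE P. is_erw_law e1 m \<beta> P)"

definition erw_speed :: "'d::finite \<Rightarrow> nat \<Rightarrow> real \<Rightarrow> real" where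
  "erw_speed e1 m \<beta> =
     (THE v. AE Y in erw_law e1 m \<beta>. (\<lambda>n. of_int (Y n $ e1) / real n) \<longlonglongrightarrow> v)"

text \<open>
  For \<^prop>\<open>0 \<le> \<beta> \<and> \<beta> \<le> 1\<close> the law exists (Ionescu-Tulcea) and is unique, so the
  description defining \<^const>\<open>erw_law\<close> is proper; the speed is unique whenever the
  almost sure limit exists.
\<close>

lemma count_PiM:
  assumes "finite J"
  shows "Pi\<^sub>M J (\<lambda>_. count_space (UNIV :: (int ^ 'd::finite) set)) = count_space (Pi\<^sub>E J (\<lambda>_. UNIV))"
  using assms by (rule count_space_PiM_finite) simp

lemma measure_eqI_cylinders:
  fixes P Q :: "(nat \<Rightarrow> int ^ 'd::finite) measure"
  assumes P: "prob_space P" "sets P = sets (Pi\<^sub>M UNIV (\<lambda>_. count_space UNIV))"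
    and Q: "prob_space Q" "sets Q = sets (Pi\<^sub>M UNIV (\<lambda>_. count_space UNIV))"
    and eq: "\<And>n y. \<P>(Y in P. \<forall>k\<le>n. Y k = y k) = \<P>(Y in Q. \<forall>k\<le>n. Y k = y k)"
  shows "P = Q"
proof (rule measure_eqI_PiM_infinite[OF P(2) Q(2)])
  interpret P: prob_space P by fact
  interpret Q: prob_space Q by fact
  show "finite_measure P" by unfold_locales
  have spP: "space P = UNIV" and spQ: "space Q = UNIV"
    using sets_eq_imp_space_eq[OF P(2)] sets_eq_imp_space_eq[OF Q(2)] by (auto simp: space_PiM)
  fix A :: "nat \<Rightarrow> (int ^ 'd) set" and J :: "nat set"
  assume J: "finite J"
  define n where "n = Max (insert 0 J)"
  have Jn: "j \<le> n" if "j \<in> J" for j using that J by (simp add: n_def)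
  let ?N = "Pi\<^sub>M {..n} (\<lambda>_. count_space (UNIV :: (int ^ 'd) set))"
  let ?r = "\<lambda>Y. restrict Y {..n}"
  have r: "?r \<in> measurable (Pi\<^sub>M UNIV (\<lambda>_. count_space UNIV)) ?N"
    by (intro measurable_restrict_subset) simp
  have rP: "?r \<in> measurable P ?N" and rQ: "?r \<in> measurable Q ?N"
    using r by (simp_all cong: measurable_cong_sets add: P(2) Q(2))
  have N: "?N = count_space (Pi\<^sub>E {..n} (\<lambda>_. UNIV))" by (rule count_PiM) simp
  have *: "distr P ?N ?r = distr Q ?N ?r"
  proof (rule measure_eqI_countable[where A = "Pi\<^sub>E {..n} (\<lambda>_. UNIV)"])
    show "countable (Pi\<^sub>E {..n} (\<lambda>_. UNIV :: (int ^ 'd) set))"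
      by (intro countable_PiE) auto
    fix z :: "nat \<Rightarrow> int ^ 'd" assume z: "z \<in> Pi\<^sub>E {..n} (\<lambda>_. UNIV)"
    have pre: "?r -` {z} = {Y. \<forall>k\<le>n. Y k = z k}"
      using z by (auto simp: fun_eq_iff restrict_def PiE_iff extensional_def split: if_splits)
    have "{z} \<in> sets ?N" using z by (simp add: N)
    with eq[of n z] show "emeasure (distr P ?N ?r) {z} = emeasure (distr Q ?N ?r) {z}"
      by (simp add: emeasure_distr rP rQ pre spP spQ P.emeasure_eq_measure Q.emeasure_eq_measure)
  qed (simp_all add: N)
  let ?X = "{z \<in> Pi\<^sub>E {..n} (\<lambda>_. UNIV). \<forall>j\<in>J. z j \<in> A j}"
  have X: "?X \<in> sets ?N" by (simp add: N)
  have emb: "prod_emb UNIV (\<lambda>_. count_space UNIV) J (Pi\<^sub>E J A) = ?r -` ?X"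
    using Jn by (auto simp: prod_emb_def PiE_iff extensional_def)
  show "emeasure P (prod_emb UNIV (\<lambda>_. count_space UNIV) J (Pi\<^sub>E J A)) =
      emeasure Q (prod_emb UNIV (\<lambda>_. count_space UNIV) J (Pi\<^sub>E J A))"
    using arg_cong[OF *, of "\<lambda>M. emeasure M ?X"] X
    by (simp add: emb emeasure_distr[OF rP] emeasure_distr[OF rQ] spP spQ)
qed

lemma cyl_event:
  fixes P :: "(nat \<Rightarrow> int ^ 'd::finite) measure"
  assumes "sets P = sets (Pi\<^sub>M UNIV (\<lambda>_. count_space UNIV))"
  shows "{Y \<in> space P. \<forall>k\<le>n. Y k = y k} \<in> sets P"
proof -
  have [measurable_cong]: "sets P = sets (Pi\<^sub>M UNIV (\<lambda>_. count_space UNIV))" by fact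
  show ?thesis by measurable
qed

lemma is_erw_law_unique:
  fixes e1 :: "'d::finite"
  assumes P: "is_erw_law e1 m \<beta> P" and Q: "is_erw_law e1 m \<beta> Q"
  shows "P = Q"
proof (rule measure_eqI_cylinders)
  show "prob_space P" "sets P = sets (Pi\<^sub>M UNIV (\<lambda>_. count_space UNIV))"
    "prob_space Q" "sets Q = sets (Pi\<^sub>M UNIV (\<lambda>_. count_space UNIV))"
    using P Q by (auto simp: is_erw_law_def)
  let ?c = "\<lambda>R n y. \<P>(Y in R. \<forall>k\<le>n. Y k = y k)"
  let ?q = "\<lambda>n (y :: nat \<Rightarrow> int ^ 'd) i (s::int).
    (if i = e1 \<and> card {k. k < n \<and> y k = y n} < m
              then (1 + of_int s * \<beta>) / (2 * CARD('d)) else 1 / (2 * CARD('d)) :: real)"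
  have c0: "?c R 0 y = (if y 0 = 0 then 1 else 0)" if R: "is_erw_law e1 m \<beta> R" for R y
  proof -
    interpret prob_space R using R by (simp add: is_erw_law_def)
    have ae: "AE Y in R. Y 0 = 0" and s: "sets R = sets (Pi\<^sub>M UNIV (\<lambda>_. count_space UNIV))"
      using R by (simp_all add: is_erw_law_def)
    note ev = cyl_event[OF s, of 0 y]
    show ?thesis
    proof (cases "y 0 = 0")
      case True
      have "AE Y in R. Y \<in> {Y \<in> space R. \<forall>k\<le>0. Y k = y k}"
        using ae AE_space[of R] by eventually_elim (simp add: True)
      then show ?thesis using True prob_eq_1[OF ev] by simp
    next
      case False
      then have "AE Y in R. Y \<notin> {Y \<in> space R. \<forall>k\<le>0. Y k = y k}" using ae by auto
      then show ?thesis using False prob_eq_0[OF ev] by simp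
    qed
  qed
  have cS: "?c R (Suc n) y =
      (if \<exists>i. \<exists>s\<in>{1,-1}. y (Suc n) - y n = axis i s
       then ?c R n y * (case (SOME p. snd p \<in> {1,-1} \<and> y (Suc n) - y n = axis (fst p) (snd p)) of (i, s) \<Rightarrow> ?q n y i s)
       else 0)" if R: "is_erw_law e1 m \<beta> R" for R n y
  proof -
    interpret prob_space R using R by (simp add: is_erw_law_def)
    have ae: "AE Y in R. \<forall>n. \<exists>i. \<exists>s\<in>{1, -1}. Y (Suc n) - Y n = axis i s"
      and s: "sets R = sets (Pi\<^sub>M UNIV (\<lambda>_. count_space UNIV))"
      using R by (simp_all add: is_erw_law_def)
    from R have "\<forall>n y. ?c R n y > 0 \<longrightarrow> (\<forall>i. \<forall>s\<in>{1, -1}.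
           \<P>(Y in R. Y (Suc n) - Y n = axis i s \<bar> \<forall>k\<le>n. Y k = y k) = ?q n y i s)"
      unfolding is_erw_law_def by (elim conjE) assumption
    then have cond: "?c R n y > 0 \<Longrightarrow> s \<in> {1,-1} \<Longrightarrow>
           \<P>(Y in R. Y (Suc n) - Y n = axis i s \<bar> \<forall>k\<le>n. Y k = y k) = ?q n y i s" for i s
      by blast
    note ev = cyl_event[OF s]
    show ?thesis
    proof (cases "\<exists>i. \<exists>s\<in>{1,-1}. y (Suc n) - y n = axis i s")
      case True
      define p where "p = (SOME p. snd p \<in> {1,-1} \<and> y (Suc n) - y n = axis (fst p) (snd p :: int))"
      have p: "snd p \<in> {1,-1} \<and> y (Suc n) - y n = axis (fst p) (snd p)"
        unfolding p_def by (rule someI_ex) (use True in auto)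
      have eq: "{Y \<in> space R. \<forall>k\<le>Suc n. Y k = y k} =
          {Y \<in> space R. Y (Suc n) - Y n = axis (fst p) (snd p) \<and> (\<forall>k\<le>n. Y k = y k)}"
        unfolding conjunct2[OF p, symmetric] by (auto simp: le_Suc_eq)
      show ?thesis
      proof (cases "?c R n y > 0")
        case pos: True
        from cond[OF this, of "snd p" "fst p"] p pos
        have "\<P>(Y in R. Y (Suc n) - Y n = axis (fst p) (snd p) \<and> (\<forall>k\<le>n. Y k = y k)) = ?c R n y * ?q n y (fst p) (snd p)"
          unfolding cond_prob_def by (simp add: field_simps)
        then show ?thesis using True unfolding eq p_def[symmetric] by (simp add: case_prod_beta)
      next
        case False
        then have 0: "?c R n y = 0" using measure_nonneg[of R] by (meson linorder_not_less order_antisym)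
        have "?c R (Suc n) y \<le> ?c R n y" by (rule finite_measure_mono[OF _ ev]) auto
        with 0 show ?thesis using measure_nonneg[of R "{Y \<in> space R. \<forall>k\<le>Suc n. Y k = y k}"] by simp
      qed
    next
      case False
      have "AE Y in R. Y \<notin> {Y \<in> space R. \<forall>k\<le>Suc n. Y k = y k}"
        using ae
      proof eventually_elim
        case (elim Y)
        then have st: "\<exists>i. \<exists>s\<in>{1, -1}. Y (Suc n) - Y n = axis i s" by (rule spec)
        show ?case
        proof
          assume "Y \<in> {Y \<in> space R. \<forall>k\<le>Suc n. Y k = y k}"
          then have "Y (Suc n) = y (Suc n)" "Y n = y n" by auto
          with st False show False by simp
        qed
      qed
      then show ?thesis using False prob_eq_0[OF ev] by simp
    qed
  qed
  show "?c P n y = ?c Q n y" for n y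
  proof (induction n)
    case 0 show ?case by (simp only: c0[OF P] c0[OF Q])
  next
    case (Suc n) show ?case by (simp only: cS[OF P] cS[OF Q] Suc.IH)
  qed
qed

lemma erw_step_pmf_exists:
  fixes e1 :: "'d::finite"
  assumes "0 \<le> \<beta>" "\<beta> \<le> 1"
  shows "\<exists>p. (\<forall>i. \<forall>s\<in>{1, -1}. pmf p (axis i s) =
           (if i = e1 \<and> c then (1 + of_int s * \<beta>) / (2 * CARD('d)) else 1 / (2 * CARD('d)))) \<and>
         set_pmf p \<subseteq> {axis i s | i s. s \<in> {1, -1 :: int}}"
proof -
  define sg where "sg b = (if b then 1 else -1 :: int)" for b
  define f :: "'d \<times> bool \<Rightarrow> real" where
    "f = (\<lambda>(i, b). if i = e1 \<and> c then (1 + of_int (sg b) * \<beta>) / (2 * CARD('d)) else 1 / (2 * CARD('d)))"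
  have nn: "0 \<le> f x" for x using assms by (auto simp: f_def sg_def split: prod.splits)
  have "(\<Sum>x\<in>UNIV. f x) = (\<Sum>i\<in>UNIV. \<Sum>b\<in>UNIV. f (i, b))"
    by (simp add: sum.cartesian_product)
  also have "\<dots> = (\<Sum>i\<in>(UNIV::'d set). 1 / CARD('d))"
    by (intro sum.cong) (auto simp: UNIV_bool f_def sg_def field_simps)
  finally have "(\<Sum>x\<in>UNIV. f x) = 1" by simp
  then have one: "(\<integral>\<^sup>+x. f x \<partial>count_space UNIV) = 1"
    by (simp add: nn_integral_count_space_finite sum_ennreal nn)
  define g where "g = (\<lambda>(i :: 'd, b). axis i (sg b))"
  have inj: "inj g"
    by (auto simp: inj_def g_def axis_eq_axis sg_def split: if_splits)
  let ?p = "map_pmf g (embed_pmf f)"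
  have "pmf ?p (axis i (sg b)) = f (i, b)" for i b
    using pmf_map_inj'[OF inj, of "embed_pmf f" "(i, b)"] by (simp add: pmf_embed_pmf[OF nn one] g_def)
  note p = this
  have "pmf ?p (axis i s) =
      (if i = e1 \<and> c then (1 + of_int s * \<beta>) / (2 * CARD('d)) else 1 / (2 * CARD('d)))"
    if "s \<in> {1, -1}" for i s
    using p[of i "s = 1"] that by (auto simp: f_def sg_def)
  moreover have "set_pmf ?p \<subseteq> {axis i s | i s. s \<in> {1, -1}}"
  proof -
    have "g x \<in> {axis i s | i s. s \<in> {1, -1}}" for x
      by (cases x) (auto simp: g_def sg_def)
    then show ?thesis by (auto simp only: set_map_pmf)
  qed
  ultimately show ?thesis by blast
qed

lemma is_erw_law_exists:
  fixes e1 :: "'d::finite"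
  assumes \<beta>: "0 \<le> \<beta>" "\<beta> \<le> 1"
  shows "\<exists>P. is_erw_law e1 m \<beta> P"
proof -
  define r where "r i s c = (if i = e1 \<and> c then (1 + of_int s * \<beta>) / (2 * CARD('d)) else 1 / (2 * CARD('d)))"
    for i and s :: int and c
  define S where "S = {axis (i::'d) s | i s. s \<in> {1, -1 :: int}}"
  have "\<forall>c. \<exists>p. (\<forall>i. \<forall>s\<in>{1, -1}. pmf p (axis i s) = r i s c) \<and> set_pmf p \<subseteq> S"
    unfolding r_def S_def using erw_step_pmf_exists[OF \<beta>] by blast
  then obtain K where K: "\<And>c i s. s \<in> {1, -1} \<Longrightarrow> pmf (K c) (axis i s) = r i s c"
    and KS: "\<And>c. set_pmf (K c) \<subseteq> S" by metis
  define kern where "kern n \<omega> = (if n = 0 then return_pmf 0 else map_pmf ((+) (\<omega> (n - 1)))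
     (K (card {k. k < n - 1 \<and> \<omega> k = \<omega> (n - 1)} < m)))" for n :: nat and \<omega> :: "nat \<Rightarrow> int ^ 'd"
  let ?M = "\<lambda>_ :: nat. count_space (UNIV :: (int ^ 'd) set)"
  have cnt: "Pi\<^sub>M {0..<n} ?M = count_space (Pi\<^sub>E {0..<n} (\<lambda>_. UNIV))" for n
    by (rule count_PiM) simp
  interpret IT: Ionescu_Tulcea "\<lambda>n \<omega>. measure_pmf (kern n \<omega>)" ?M
    by standard (auto simp: cnt measure_pmf_in_subprob_algebra measure_pmf.prob_space_axioms)
  let ?C = "\<lambda>n. IT.C 0 n (\<lambda>_. undefined)"
  let ?L = IT.PF.lim
  have u: "(\<lambda>_. undefined) \<in> space (Pi\<^sub>M {0..<0::nat} ?M)" by simp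
  have kern_restrict: "kern n (restrict y {0..<n}) = kern n y" for n y
  proof -
    have "{k. k < n - 1 \<and> restrict y {0..<n} k = restrict y {0..<n} (n - 1)} = {k. k < n - 1 \<and> y k = y (n - 1)}"
      if "n \<noteq> 0" using that by (auto simp: restrict_def split: if_splits)
    then show ?thesis by (auto simp: kern_def)
  qed
  have step: "emeasure (?C (Suc n)) {restrict y {0..<Suc n}} =
      emeasure (?C n) {restrict y {0..<n}} * pmf (kern n y) (y n)" for n y
  proof -
    have X: "{restrict y {0..<Suc n}} \<in> sets (Pi\<^sub>M {0..<Suc n} ?M)" by (simp add: cnt)
    have spC: "space (?C n) = Pi\<^sub>E {0..<n} (\<lambda>_. UNIV)" using IT.space_C[OF u] by (simp add: cnt)
    have stC: "sets (?C n) = Pow (Pi\<^sub>E {0..<n} (\<lambda>_. UNIV))" using IT.sets_C[OF u] by (simp add: cnt)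
    have "emeasure (?C (Suc n)) {restrict y {0..<Suc n}} =
        (\<integral>\<^sup>+x. emeasure (IT.eP n x) {restrict y {0..<Suc n}} \<partial>?C n)"
      unfolding IT.C.simps using X IT.measurable_eP[of n] IT.sets_C[OF u, of n] spC
      by (subst emeasure_bind[where N="Pi\<^sub>M {0..<Suc n} ?M"])
         (auto simp: PiE_eq_empty_iff cong: measurable_cong_sets)
    also have "\<dots> = (\<integral>\<^sup>+x. ennreal (pmf (kern n y) (y n)) * indicator {restrict y {0..<n}} x \<partial>?C n)"
    proof (intro nn_integral_cong)
      fix x assume x: "x \<in> space (?C n)"
      then have xs: "x \<in> space (Pi\<^sub>M {0..<n} ?M)" by (simp add: spC cnt)
      have "(\<lambda>z. x(n := z)) -` {restrict y {0..<Suc n}} = (if x = restrict y {0..<n} then {y n} else {})"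
      proof (cases "x = restrict y {0..<n}")
        case True
        then have "x(n := y n) = restrict y {0..<Suc n}" by (auto simp: fun_eq_iff restrict_def)
        moreover have "z = y n" if "x(n := z) = restrict y {0..<Suc n}" for z
          using fun_cong[OF that, of n] by simp
        ultimately show ?thesis using True by auto
      next
        case False
        have "x(n := z) \<noteq> restrict y {0..<Suc n}" for z
        proof
          assume eq: "x(n := z) = restrict y {0..<Suc n}"
          have "x = restrict y {0..<n}"
          proof
            fix k show "x k = restrict y {0..<n} k"
              using fun_cong[OF eq, of k] x
              by (cases k n rule: linorder_cases) (auto simp: spC PiE_iff extensional_def)
          qed
          with False show False ..
        qed
        with False show ?thesis by auto
      qed
      then show "emeasure (IT.eP n x) {restrict y {0..<Suc n}} =
          ennreal (pmf (kern n y) (y n)) * indicator {restrict y {0..<n}} x"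
        using IT.emeasure_eP[OF xs X] by (simp add: kern_restrict emeasure_pmf_single)
    qed
    also have "\<dots> = pmf (kern n y) (y n) * emeasure (?C n) {restrict y {0..<n}}"
      by (rule nn_integral_cmult_indicator) (simp add: stC)
    finally show ?thesis by (simp add: mult.commute)
  qed
  have "prob_space (distr ?L (Pi\<^sub>M {} ?M) (\<lambda>Y. restrict Y {}))"
    unfolding IT.distr_lim[OF finite.emptyI] by (rule IT.PF.prob_space_P) simp_all
  then interpret L: prob_space ?L
    by (rule prob_space_distrD[rotated])
       (simp add: measurable_restrict_subset cong: measurable_cong_sets)
  have setsL: "sets ?L = sets (Pi\<^sub>M UNIV ?M)" by simp
  have spL: "space ?L = UNIV" by (simp add: space_PiM)
  have cyl_C: "emeasure ?L {Y. \<forall>k<n. Y k = y k} = emeasure (?C n) {restrict y {0..<n}}" for n y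
  proof -
    have X: "{restrict y {0..<n}} \<in> sets (Pi\<^sub>M {0..<n} ?M)" by (simp add: cnt)
    have emb: "IT.PF.emb UNIV {0..<n} {restrict y {0..<n}} = {Y. \<forall>k<n. Y k = y k}"
      by (auto simp: prod_emb_def fun_eq_iff restrict_def space_PiM) metis
    have "IT.PF.emb {0..<n} {0..<n} {restrict y {0..<n}} = {restrict y {0..<n}}"
      by (rule prod_emb_id) (auto simp: space_PiM)
    then show ?thesis using IT.lim[OF _ X] IT.emeasure_CI[OF _ X, of n] by (simp add: emb)
  qed
  have cyl_step: "L.prob {Y. \<forall>k<Suc n. Y k = y k} = L.prob {Y. \<forall>k<n. Y k = y k} * pmf (kern n y) (y n)" for n y
    using step[of n y] unfolding cyl_C[symmetric] L.emeasure_eq_measure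
    by (simp add: ennreal_mult[symmetric] del: IT.PF.emeasure_lim)
  have [measurable_cong]: "sets ?L = sets (Pi\<^sub>M UNIV ?M)" by simp
  have full: "AE Y in ?L. \<forall>n. Y n \<in> set_pmf (kern n Y)"
  proof (subst AE_all_countable, rule allI)
    fix n
    let ?B = "{z \<in> Pi\<^sub>E {0..<Suc n} (\<lambda>_. UNIV). z n \<notin> set_pmf (kern n z)}"
    have "AE Y in ?L. \<forall>z\<in>?B. \<not> (\<forall>k<Suc n. Y k = z k)"
    proof (subst AE_ball_countable)
      show "countable ?B" by (rule countable_subset[OF _ countable_PiE[of "{0..<Suc n}" "\<lambda>_. UNIV"]]) auto
      show "\<forall>z\<in>?B. AE Y in ?L. \<not> (\<forall>k<Suc n. Y k = z k)"
      proof
        fix z assume z: "z \<in> ?B"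
        then have "L.prob {Y. \<forall>k<Suc n. Y k = z k} = 0"
          unfolding cyl_step by (simp add: set_pmf_iff)
        moreover have "{Y \<in> space ?L. \<forall>k<Suc n. Y k = z k} \<in> sets ?L" by measurable
        ultimately show "AE Y in ?L. \<not> (\<forall>k<Suc n. Y k = z k)"
          using L.prob_eq_0[of "{Y \<in> space ?L. \<forall>k<Suc n. Y k = z k}"] by (simp add: space_PiM)
      qed
    qed
    then show "AE Y in ?L. Y n \<in> set_pmf (kern n Y)"
    proof eventually_elim
      case (elim Y)
      have "kern n (restrict Y {0..<Suc n}) = kern n Y"
      proof -
        have "restrict (restrict Y {0..<Suc n}) {0..<n} = restrict Y {0..<n}" by (auto simp: restrict_def)
        then show ?thesis using kern_restrict by metis
      qed
      with bspec[OF elim, of "restrict Y {0..<Suc n}"] show ?case by auto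
    qed
  qed
  have cyl_le: "{Y \<in> space ?L. \<forall>k\<le>n. Y k = y k} = {Y. \<forall>k<Suc n. Y k = y k}" for n y
    by (auto simp: space_PiM less_Suc_eq_le)
  have "is_erw_law e1 m \<beta> ?L"
    unfolding is_erw_law_def
  proof (intro conjI allI impI ballI)
    show "prob_space ?L" by (rule L.prob_space_axioms)
    show "sets ?L = sets (Pi\<^sub>M UNIV ?M)" by simp
    show "AE Y in ?L. Y 0 = 0"
      using full by eventually_elim (drule spec[of _ 0], simp add: kern_def)
    show "AE Y in ?L. \<forall>n. \<exists>i. \<exists>s\<in>{1, -1}. Y (Suc n) - Y n = axis i s"
      using full
    proof eventually_elim
      case (elim Y)
      show ?case
      proof
        fix n
        from elim[rule_format, of "Suc n"] obtain z where "Y (Suc n) = Y n + z" "z \<in> S"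
          using KS by (auto simp: kern_def)
        then show "\<exists>i. \<exists>s\<in>{1, -1}. Y (Suc n) - Y n = axis i s" unfolding S_def by auto
      qed
    qed
    fix n y i and s :: int
    assume pos: "\<P>(Y in ?L. \<forall>k\<le>n. Y k = y k) > 0" and s: "s \<in> {1, -1}"
    define y' where "y' = y(Suc n := y n + axis i s)"
    have pm: "pmf (kern (Suc n) y') (y' (Suc n)) = r i s (card {k. k < n \<and> y k = y n} < m)"
    proof -
      have "{k. k < n \<and> y' k = y' n} = {k. k < n \<and> y k = y n}" by (auto simp: y'_def)
      moreover have "inj ((+) (y n))" by (simp add: inj_def)
      ultimately show ?thesis
        using K[OF s, of _ i] pmf_map_inj'[of "(+) (y n)"] by (simp add: kern_def y'_def)
    qed
    have "{Y \<in> space ?L. Y (Suc n) - Y n = axis i s \<and> (\<forall>k\<le>n. Y k = y k)} = {Y. \<forall>k<Suc (Suc n). Y k = y' k}"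
      by (auto simp: space_PiM y'_def less_Suc_eq_le le_Suc_eq diff_eq_eq add.commute)
    moreover have "{Y. \<forall>k<Suc n. Y k = y' k} = {Y. \<forall>k<Suc n. Y k = y k}" by (auto simp: y'_def)
    ultimately have "\<P>(Y in ?L. Y (Suc n) - Y n = axis i s \<and> (\<forall>k\<le>n. Y k = y k)) =
        \<P>(Y in ?L. \<forall>k\<le>n. Y k = y k) * r i s (card {k. k < n \<and> y k = y n} < m)"
      using cyl_step[of "Suc n" y'] by (simp only: cyl_le pm)
    then show "\<P>(Y in ?L. Y (Suc n) - Y n = axis i s \<bar> \<forall>k\<le>n. Y k = y k) =
         (if i = e1 \<and> card {k. k < n \<and> y k = y n} < m
          then (1 + of_int s * \<beta>) / (2 * CARD('d)) else 1 / (2 * CARD('d)))"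
      using pos unfolding cond_prob_def r_def by simp
  qed
  then show ?thesis ..
qed

lemma is_erw_law_erw_law:
  fixes e1 :: "'d::finite"
  assumes "0 \<le> \<beta>" "\<beta> \<le> 1"
  shows "is_erw_law e1 m \<beta> (erw_law e1 m \<beta>)"
proof -
  obtain P where P: "is_erw_law e1 m \<beta> P" using is_erw_law_exists[OF assms] by blast
  then show ?thesis unfolding erw_law_def
    by (rule theI) (rule is_erw_law_unique[OF _ P])
qed

lemma erw_speed_eqI:
  fixes e1 :: "'d::finite"
  assumes "0 \<le> \<beta>" "\<beta> \<le> 1"
    and v: "AE Y in erw_law e1 m \<beta>. (\<lambda>n. of_int (Y n $ e1) / real n) \<longlonglongrightarrow> v"
  shows "erw_speed e1 m \<beta> = v"
  unfolding erw_speed_def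
proof (rule the_equality[where P = "\<lambda>v. AE Y in erw_law e1 m \<beta>. (\<lambda>n. of_int (Y n $ e1) / real n) \<longlonglongrightarrow> v", OF v])
  fix w :: real
  assume w: "AE Y in erw_law e1 m \<beta>. (\<lambda>n. of_int (Y n $ e1) / real n) \<longlonglongrightarrow> w"
  interpret prob_space "erw_law e1 m \<beta>"
    using is_erw_law_erw_law[OF assms(1,2), of e1 m] by (simp add: is_erw_law_def)
  have "AE Y in erw_law e1 m \<beta>. w = v"
    using v w by eventually_elim (rule LIMSEQ_unique)
  then show "w = v" by simp
qed

end

theory Submission
  imports Defs
begin

text \<open>
  Given the history, the mean of the next step along \<open>e1\<close> is \<open>\<beta> / d\<close> as long as fewer than
  \<open>m\<close> cookies of the current site are eaten and \<open>0\<close> otherwise, so the speed is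
  \<open>\<beta> / d * (1 - q)\<close>, where \<open>q\<close> is the limit of the probability
  \<open>q\<^sub>n\<close> that the position at time \<open>n\<close> has been visited at least \<open>m\<close> times before.

  Each \<open>q\<^sub>n\<close> is a polynomial in \<open>\<beta>\<close>.  The remaining coordinates perform a lazy simple
  random walk that does not depend on \<open>\<beta>\<close>.  If that walk has a cut time during the last \<open>l\<close>
  steps, i.e. a time that separates its past range from its future range, then the event
  defining \<open>q\<^sub>n\<close> depends only on what happens after the cut.  Hence
  \<open>q\<^sub>n - q\<^sub>l\<close> is a sum over paths without such a cut time, and both it and its
  derivative are at most \<open>2 n / (1 - \<beta>)\<close> times the probability that there is none.  In at least
  seven transversal dimensions the heat kernel bound \<open>C t powr (-7/2)\<close> makes this summable along
  a geometric sequence of \<open>n\<close>, uniformly in \<open>m\<close>.  Since \<open>q\<^sub>n = 0\<close> for \<open>n < m\<close>, the limit and its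
  derivative tend to \<open>0\<close> as \<open>m\<close> grows.  The same decorrelation bounds the variance of the
  displacement, which gives the law of large numbers along \<open>n = r ^ 36\<close> and, as the steps are
  bounded, for all \<open>n\<close>.
\<close>

section \<open>Path weights and cut times\<close>

text \<open>All estimates are finite sums over step words; the measure enters only through cylinder
  probabilities. A cut has to detach the cookies of the future from the past, and its probability
  must not feel the cookies. Both hold because it refers only to the coordinates other than
  \<open>e1\<close>: disjoint transversal ranges force disjoint ranges, and the two steps along
  \<open>e1\<close> together have probability \<open>1 / d\<close> whatever has been eaten. The
  weights of paths without a cut depend on \<beta>, but their total mass is that of a simple random
  walk. The obstacle is the derivative: by the product rule it multiplies a bound by the number of
  steps and by \<open>1 / (1 - \<beta>)\<close>. For \<open>T\<close> steps and returns after at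
  least \<open>L\<close> steps there are about \<open>T ^ 2\<close> pairs of times, the derivative
  adds another factor \<open>T\<close>, and each pair costs \<open>L powr (-7/2)\<close>. With
  \<open>L\<close> a power of \<open>T\<close> slightly below the first, the product still decays
  because \<open>3 < 7/2\<close>. Six transversal dimensions would only give \<open>3 = 6/2\<close>;
  this is where \<open>d \<ge> 8\<close> comes from.\<close>

definition Ls :: "nat \<Rightarrow> 'a list set" where
  "Ls n = {w. length w = n}"

lemma in_Ls [simp]: "w \<in> Ls n \<longleftrightarrow> length w = n"
  by (simp add: Ls_def)

lemma finite_Ls [simp]: "finite (Ls n :: 'a::finite list set)"
  using finite_lists_length_eq[of "UNIV :: 'a set" n] by (simp add: Ls_def)

lemma card_Ls: "card (Ls n :: 'a::finite list set) = CARD('a) ^ n"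
  using card_lists_length_eq[of "UNIV :: 'a set" n] by (simp add: Ls_def)

lemma Ls_0 [simp]: "Ls 0 = {[]}"
  by (auto simp: Ls_def)

lemma sum_Ls_add:
  fixes f :: "'a::finite list \<Rightarrow> 'b::comm_monoid_add"
  shows "(\<Sum>w\<in>Ls (a + b). f w) = (\<Sum>u\<in>Ls a. \<Sum>x\<in>Ls b. f (u @ x))"
proof -
  have "(\<Sum>u\<in>Ls a. \<Sum>x\<in>Ls b. f (u @ x)) = (\<Sum>(u, x)\<in>Ls a \<times> Ls b. f (u @ x))"
    by (simp add: sum.cartesian_product)
  also have "\<dots> = (\<Sum>w\<in>Ls (a + b). f w)"
    by (rule sum.reindex_bij_witness[of _ "\<lambda>w. (take a w, drop a w)" "\<lambda>(u, x). u @ x"])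
       (auto simp: Ls_def)
  finally show ?thesis by simp
qed

lemma sum_Ls_1:
  fixes f :: "'a::finite list \<Rightarrow> 'b::comm_monoid_add"
  shows "(\<Sum>w\<in>Ls (Suc 0). f w) = (\<Sum>s\<in>UNIV. f [s])"
  by (rule sum.reindex_bij_witness[of _ "\<lambda>s. [s]" hd]) (auto simp: Ls_def length_Suc_conv)

lemma sum_Ls_snoc:
  fixes f :: "'a::finite list \<Rightarrow> 'b::comm_monoid_add"
  shows "(\<Sum>w\<in>Ls (Suc n). f w) = (\<Sum>w\<in>Ls n. \<Sum>s\<in>UNIV. f (w @ [s]))"
  using sum_Ls_add[of f n 1] by (simp add: sum_Ls_1)

lemma sum_Ls_Cons:
  fixes f :: "'a::finite list \<Rightarrow> 'b::comm_monoid_add"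
  shows "(\<Sum>w\<in>Ls (Suc n). f w) = (\<Sum>s\<in>UNIV. \<Sum>w\<in>Ls n. f (s # w))"
  using sum_Ls_add[of f 1 n] by (simp add: sum_Ls_1)

lemma sum_direction_sign:
  fixes f :: "'d::finite \<times> bool \<Rightarrow> real"
  shows "(\<Sum>s\<in>UNIV. f s) = (\<Sum>i\<in>UNIV. f (i, True) + f (i, False))"
proof -
  have "(\<Sum>s\<in>UNIV. f s) = (\<Sum>i\<in>UNIV. \<Sum>b\<in>UNIV. f (i, b))"
    by (simp add: sum.cartesian_product)
  then show ?thesis by (simp add: UNIV_bool add.commute)
qed

locale excited_walk =
  fixes e1 :: "'d::finite"
begin

definition dir :: "'d \<times> bool \<Rightarrow> int ^ 'd" where
  "dir s = axis (fst s) (if snd s then 1 else -1)"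

definition pos :: "('d \<times> bool) list \<Rightarrow> int ^ 'd" where
  "pos w = sum_list (map dir w)"

definition visits :: "('d \<times> bool) list \<Rightarrow> nat" where
  "visits w = card {k. k < length w \<and> pos (take k w) = pos w}"

definition rate :: "nat \<Rightarrow> real \<Rightarrow> ('d \<times> bool) list \<Rightarrow> 'd \<times> bool \<Rightarrow> real" where
  "rate m \<beta> w s =
     (if fst s = e1 \<and> visits w < m then 1 + (if snd s then \<beta> else - \<beta>) else 1) / (2 * CARD('d))"

definition weight :: "nat \<Rightarrow> real \<Rightarrow> ('d \<times> bool) list \<Rightarrow> real" where
  "weight m \<beta> w = (\<Prod>k<length w. rate m \<beta> (take k w) (w ! k))"

definition eaten :: "nat \<Rightarrow> ('d \<times> bool) list \<Rightarrow> real" where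
  "eaten m w = (if m \<le> visits w then 1 else 0)"

text \<open>Erases the sign of a step along \<open>e1\<close> and nothing else.
  \<open>map hid w\<close> thus retains exactly the transversal walk, including the times at which
  it stands still; functions of \<open>map hid w\<close> have expectations free of \<open>m\<close>
  and \<beta>.\<close>

definition hid :: "'d \<times> bool \<Rightarrow> 'd \<times> bool" where
  "hid s = (if fst s = e1 then (e1, True) else s)"

definition tdir :: "'d \<times> bool \<Rightarrow> int ^ 'd" where
  "tdir s = (if fst s = e1 then 0 else dir s)"

definition tpos :: "('d \<times> bool) list \<Rightarrow> int ^ 'd" where
  "tpos w = sum_list (map tdir w)"

text \<open>Time \<open>c\<close> itself belongs to the future, so the site occupied at the cut is
  also new to the walk.\<close>

definition cut :: "nat \<Rightarrow> ('d \<times> bool) list \<Rightarrow> bool" where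
  "cut c w \<longleftrightarrow> c \<le> length w \<and> (\<forall>i<c. \<forall>j\<in>{c..length w}. tpos (take i w) \<noteq> tpos (take j w))"

lemma pos_append [simp]: "pos (u @ x) = pos u + pos x"
  by (simp add: pos_def)

lemma tpos_append [simp]: "tpos (u @ x) = tpos u + tpos x"
  by (simp add: tpos_def)

lemma tpos_Nil [simp]: "tpos [] = 0"
  by (simp add: tpos_def)

lemma pos_Nil [simp]: "pos [] = 0"
  by (simp add: pos_def)

lemma tpos_Cons [simp]: "tpos (s # w) = tdir s + tpos w"
  by (simp add: tpos_def)

lemma tpos_nth: "tpos w $ i = (if i = e1 then 0 else pos w $ i)"
  by (induction w) (auto simp: tpos_def pos_def tdir_def dir_def axis_def)

lemma tpos_eq_if_pos_eq: "pos u = pos w \<Longrightarrow> tpos u = tpos w"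
  by (simp add: vec_eq_iff tpos_nth)

lemma tdir_hid [simp]: "tdir (hid s) = tdir s"
  by (simp add: tdir_def hid_def)

lemma tpos_map_hid [simp]: "tpos (map hid w) = tpos w"
  by (induction w) auto

lemma weight_Nil [simp]: "weight m \<beta> [] = 1"
  by (simp add: weight_def)

lemma weight_snoc: "weight m \<beta> (w @ [s]) = weight m \<beta> w * rate m \<beta> w s"
  by (simp add: weight_def nth_append)

lemma cutD: "cut c w \<Longrightarrow> i < c \<Longrightarrow> c \<le> j \<Longrightarrow> j \<le> length w \<Longrightarrow> tpos (take i w) \<noteq> tpos (take j w)"
  by (simp add: cut_def)

lemma cut_map_hid: "cut c (u @ map hid y @ x) = cut c (u @ y @ x)"
proof -
  have "tpos (take j (u @ map hid y @ x)) = tpos (take j (u @ y @ x))" for j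
    by (simp add: take_map)
  then show ?thesis by (simp add: cut_def)
qed

lemma cut_drop:
  assumes "cut (length u + c) (u @ y)" shows "cut c y"
  unfolding cut_def
proof (intro conjI allI impI ballI)
  show "c \<le> length y" using assms by (simp add: cut_def)
  fix i j assume ij: "i < c" "j \<in> {c..length y}"
  then have "tpos (take (length u + i) (u @ y)) \<noteq> tpos (take (length u + j) (u @ y))"
    by (intro cutD[OF assms]) auto
  then show "tpos (take i y) \<noteq> tpos (take j y)" by simp
qed

text \<open>A visit before the cut to the present site would make two transversal positions on
  different sides of the cut equal. Hence all earlier visits happen during \<open>x\<close>, and
  shifting time by \<open>length u\<close> matches them with those of the walk \<open>x\<close>
  started afresh.\<close>

lemma visits_append_cut:
  assumes "cut (length u) (u @ x)" "k \<le> length x"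
  shows "visits (u @ take k x) = visits (take k x)"
proof -
  have "{i. i < length (u @ take k x) \<and> pos (take i (u @ take k x)) = pos (u @ take k x)} =
     (\<lambda>i. length u + i) ` {i. i < length (take k x) \<and> pos (take i (take k x)) = pos (take k x)}"
    (is "?A = _ ` ?B")
  proof (intro equalityI subsetI)
    fix i assume i: "i \<in> ?A"
    have "length u \<le> i"
    proof (rule ccontr)
      assume "\<not> length u \<le> i"
      then have "tpos (take i (u @ x)) \<noteq> tpos (take (length u + k) (u @ x))"
        using assms(2) by (intro cutD[OF assms(1)]) auto
      moreover have "pos (take i (u @ x)) = pos (take (length u + k) (u @ x))"
        using i \<open>\<not> length u \<le> i\<close> assms(2) by simp
      ultimately show False using tpos_eq_if_pos_eq by blast
    qed
    then show "i \<in> (\<lambda>i. length u + i) ` ?B"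
      using i by (intro image_eqI[of _ _ "i - length u"]) auto
  qed auto
  then show ?thesis
    unfolding visits_def by (simp add: card_image)
qed

lemma eaten_append_cut:
  assumes "cut (length u) (u @ x)"
  shows "eaten m (u @ x) = eaten m x"
  using visits_append_cut[OF assms, of "length x"] by (simp add: eaten_def)

text \<open>After a cut no visited site has lost cookies to \<open>u\<close>, so each step of
  \<open>x\<close> has the rate that it would have with empty past.\<close>

lemma weight_append_cut:
  assumes "cut (length u) (u @ x)"
  shows "weight m \<beta> (u @ x) = weight m \<beta> u * weight m \<beta> x"
proof -
  have "k \<le> length x \<Longrightarrow> weight m \<beta> (u @ take k x) = weight m \<beta> u * weight m \<beta> (take k x)" for k
  proof (induction k)
    case (Suc k)
    have "weight m \<beta> (u @ take (Suc k) x) = weight m \<beta> (u @ take k x) * rate m \<beta> (u @ take k x) (x ! k)"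
      using Suc.prems by (simp add: take_Suc_conv_app_nth weight_snoc flip: append_assoc)
    also have "\<dots> = weight m \<beta> u * weight m \<beta> (take k x) * rate m \<beta> (take k x) (x ! k)"
      using Suc visits_append_cut[OF assms, of k] by (simp add: rate_def)
    also have "\<dots> = weight m \<beta> u * weight m \<beta> (take (Suc k) x)"
      using Suc.prems by (simp add: take_Suc_conv_app_nth weight_snoc)
    finally show ?case .
  qed simp
  from this[of "length x"] show ?thesis by simp
qed

text \<open>The rates of the two steps along \<open>e1\<close> are \<open>1 + \<beta>\<close> and
  \<open>1 - \<beta>\<close> or both 1, up to normalisation; their sum is the same in both cases,
  and \<open>g (hid s)\<close> does not tell them apart.\<close>

lemma sum_rate_hid:
  "(\<Sum>s\<in>UNIV. g (hid s) * rate m \<beta> w s) = (\<Sum>s\<in>UNIV. g (hid s)) / (2 * CARD('d))"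
proof -
  have "(\<Sum>s\<in>UNIV. g (hid s) * rate m \<beta> w s) = (\<Sum>s\<in>UNIV. g (hid s) / (2 * CARD('d)))"
    unfolding sum_direction_sign by (intro sum.cong) (auto simp: hid_def rate_def field_simps)
  then show ?thesis by (simp add: sum_divide_distrib)
qed

text \<open>The walk without its first coordinate is a simple random walk, whatever the past.\<close>

lemma sum_weight_hid:
  "(\<Sum>y\<in>Ls n. g (map hid y) * weight m \<beta> (u @ y)) =
     weight m \<beta> u * (\<Sum>y\<in>Ls n. g (map hid y)) / (2 * CARD('d)) ^ n"
proof (induction n arbitrary: g)
  case 0 show ?case by simp
next
  case (Suc n)
  let ?h = "\<lambda>z. \<Sum>s\<in>UNIV. g (z @ [hid s])"
  have "(\<Sum>y\<in>Ls (Suc n). g (map hid y) * weight m \<beta> (u @ y)) =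
     (\<Sum>y\<in>Ls n. weight m \<beta> (u @ y) * (\<Sum>s\<in>UNIV. g (map hid y @ [hid s]) * rate m \<beta> (u @ y) s))"
    by (simp add: sum_Ls_snoc weight_snoc sum_distrib_left mult_ac flip: append_assoc)
  also have "\<dots> = (\<Sum>y\<in>Ls n. ?h (map hid y) * weight m \<beta> (u @ y)) / (2 * CARD('d))"
    by (subst sum_rate_hid[of "\<lambda>s. g (_ @ [s])"]) (simp add: sum_divide_distrib sum_distrib_left mult_ac)
  also have "\<dots> = weight m \<beta> u * (\<Sum>y\<in>Ls n. ?h (map hid y)) / (2 * CARD('d)) ^ n / (2 * CARD('d))"
    by (subst Suc.IH) simp
  also have "\<dots> = weight m \<beta> u * (\<Sum>y\<in>Ls (Suc n). g (map hid y)) / (2 * CARD('d)) ^ Suc n"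
    by (simp add: sum_Ls_snoc mult_ac)
  finally show ?case .
qed

lemma sum_weight: "(\<Sum>y\<in>Ls n. weight m \<beta> (u @ y)) = weight m \<beta> u"
  using sum_weight_hid[of "\<lambda>_. 1" m \<beta> u n]
  by (simp add: card_Ls UNIV_Times_UNIV[symmetric] card_cartesian_product mult.commute del: UNIV_Times_UNIV)

section \<open>Decoupling at a cut time\<close>

definition has_cut :: "('d \<times> bool) list \<Rightarrow> ('d \<times> bool) list \<Rightarrow> bool" where
  "has_cut u y \<longleftrightarrow> (\<exists>c\<le>length y. cut (length u + c) (u @ y))"

definition last_cut :: "nat \<Rightarrow> ('d \<times> bool) list \<Rightarrow> ('d \<times> bool) list \<Rightarrow> bool" where
  "last_cut c u y \<longleftrightarrow> cut (length u + c) (u @ y) \<and>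
     (\<forall>c'\<in>{c<..length y}. \<not> cut (length u + c') (u @ y))"

text \<open>Decomposing at the last cut time keeps the events of different cut times disjoint.\<close>

lemma of_bool_has_cut:
  "of_bool (has_cut u y) = (\<Sum>c\<le>length y. of_bool (last_cut c u y) :: real)"
proof (cases "has_cut u y")
  case True
  define S where "S = {c. c \<le> length y \<and> cut (length u + c) (u @ y)}"
  have S: "finite S" "S \<noteq> {}" using True by (auto simp: S_def has_cut_def)
  have "last_cut c u y \<longleftrightarrow> c = Max S" if "c \<le> length y" for c
  proof
    assume "last_cut c u y"
    then show "c = Max S" using that S
      by (intro Max_eqI[symmetric]) (auto simp: S_def last_cut_def not_less[symmetric])
  next
    assume c: "c = Max S"
    then have "c \<in> S" using Max_in[OF S] by simp
    moreover have "c' \<le> c" if "c' \<in> S" for c' using Max_ge[OF S(1) that] c by simp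
    ultimately show "last_cut c u y" by (force simp: S_def last_cut_def)
  qed
  moreover have "Max S \<le> length y" using Max_in[OF S] by (simp add: S_def)
  ultimately have "(\<Sum>c\<le>length y. of_bool (last_cut c u y) :: real) = (\<Sum>c\<le>length y. if c = Max S then 1 else 0)"
    by (intro sum.cong) auto
  then show ?thesis using True \<open>Max S \<le> length y\<close> by simp
qed (auto simp: has_cut_def last_cut_def)

text \<open>Divide the last \<open>l\<close> steps at the last cut into a part \<open>y\<close>
  before and a part \<open>x\<close> after it. The cut of \<open>u @ y @ x\<close> is also one of
  \<open>y @ x\<close>, so in both walks \<open>x\<close> contributes the factor
  \<open>eaten m x * weight m \<beta> x\<close>. What remains compares the weight of
  \<open>u @ y\<close> with the product of the weights of \<open>u\<close> and \<open>y\<close>, on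
  an event that sees \<open>y\<close> only through \<open>map hid y\<close>; summed over
  \<open>y\<close> the two agree by \<open>sum_weight_hid\<close>.\<close>

lemma decouple:
  "(\<Sum>y\<in>Ls l. of_bool (has_cut u y) *
      (eaten m (u @ y) * weight m \<beta> (u @ y) - weight m \<beta> u * eaten m y * weight m \<beta> y)) = 0"
proof -
  let ?d = "\<lambda>y. eaten m (u @ y) * weight m \<beta> (u @ y) - weight m \<beta> u * eaten m y * weight m \<beta> y"
  have "(\<Sum>y\<in>Ls l. of_bool (last_cut c u y) * ?d y) = 0" if "c \<le> l" for c
  proof -
    \<comment> \<open>The form \<open>[] @ y\<close> lets the fact \<open>z\<close> below serve
      twice, with \<open>v = u\<close> and with \<open>v = []\<close>.\<close>
    have d: "of_bool (last_cut c u (y @ x)) * ?d (y @ x) =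
       eaten m x * weight m \<beta> x * (of_bool (last_cut c u (y @ x)) * weight m \<beta> (u @ y) -
         weight m \<beta> u * (of_bool (last_cut c u (y @ x)) * weight m \<beta> ([] @ y)))"
      if "y \<in> Ls c" for x y
    proof (cases "last_cut c u (y @ x)")
      case True
      then have c1: "cut (length (u @ y)) ((u @ y) @ x)" using that by (simp add: last_cut_def)
      then have c2: "cut (length y) (y @ x)" using cut_drop[of u "length y" "y @ x"] by simp
      show ?thesis
        using eaten_append_cut[OF c1] weight_append_cut[OF c1] eaten_append_cut[OF c2] weight_append_cut[OF c2]
        by (simp add: algebra_simps)
    qed simp
    have h: "last_cut c u (map hid y @ x) = last_cut c u (y @ x)" for y x
      by (simp add: last_cut_def cut_map_hid)
    have z: "(\<Sum>y\<in>Ls c. of_bool (last_cut c u (y @ x)) * weight m \<beta> (v @ y)) =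
       weight m \<beta> v * (\<Sum>y\<in>Ls c. of_bool (last_cut c u (y @ x))) / (2 * CARD('d)) ^ c" for x v
      using sum_weight_hid[of "\<lambda>z. of_bool (last_cut c u (z @ x))" m \<beta> v c] by (simp only: h)
    have "(\<Sum>y\<in>Ls l. of_bool (last_cut c u y) * ?d y) =
        (\<Sum>y\<in>Ls c. \<Sum>x\<in>Ls (l - c). of_bool (last_cut c u (y @ x)) * ?d (y @ x))"
      using sum_Ls_add[of "\<lambda>y. of_bool (last_cut c u y) * ?d y" c "l - c"] that by simp
    also have "\<dots> = (\<Sum>x\<in>Ls (l - c). \<Sum>y\<in>Ls c. eaten m x * weight m \<beta> x *
       (of_bool (last_cut c u (y @ x)) * weight m \<beta> (u @ y) -
         weight m \<beta> u * (of_bool (last_cut c u (y @ x)) * weight m \<beta> ([] @ y))))"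
      by (subst sum.swap) (intro sum.cong d refl)
    also have "\<dots> = (\<Sum>x\<in>Ls (l - c). eaten m x * weight m \<beta> x *
       ((\<Sum>y\<in>Ls c. of_bool (last_cut c u (y @ x)) * weight m \<beta> (u @ y)) -
         weight m \<beta> u * (\<Sum>y\<in>Ls c. of_bool (last_cut c u (y @ x)) * weight m \<beta> ([] @ y))))"
      by (simp only: sum_subtractf flip: sum_distrib_left)
    also have "\<dots> = 0"
      unfolding z by simp
    finally show ?thesis .
  qed
  then have "(\<Sum>c\<le>l. \<Sum>y\<in>Ls l. of_bool (last_cut c u y) * ?d y) = 0" by simp
  moreover have "(\<Sum>c\<le>l. \<Sum>y\<in>Ls l. of_bool (last_cut c u y) * ?d y) =
    (\<Sum>y\<in>Ls l. of_bool (has_cut u y) * ?d y)"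
    by (subst sum.swap) (simp add: of_bool_has_cut sum_distrib_right)
  ultimately show ?thesis by simp
qed

end

section \<open>Heat kernel bound\<close>

text \<open>Expectation over \<open>n\<close> independent uniform letters. For step words this is
  the simple random walk on the lattice; for words of directions it gives the multinomial law of the
  numbers of steps per axis.\<close>

definition avg :: "nat \<Rightarrow> ('a::finite list \<Rightarrow> real) \<Rightarrow> real" where
  "avg n g = (\<Sum>w\<in>Ls n. g w) / real CARD('a) ^ n"

lemma avg_0 [simp]: "avg 0 g = g []"
  by (simp add: avg_def)

lemma avg_add: "avg (a + b) g = avg a (\<lambda>u. avg b (\<lambda>x. g (u @ x)))"
  by (simp add: avg_def sum_Ls_add power_add sum_divide_distrib mult.commute)

lemma avg_Cons:
  fixes g :: "'a::finite list \<Rightarrow> real"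
  shows "avg (Suc n) g = (\<Sum>s\<in>UNIV. avg n (\<lambda>w. g (s # w))) / real CARD('a)"
  by (simp add: avg_def sum_Ls_Cons sum_divide_distrib mult.commute)

lemma avg_const [simp]: "avg n (\<lambda>_ :: 'a::finite list. c) = c"
  by (simp add: avg_def card_Ls)

lemma avg_mono: "(\<And>w. length w = n \<Longrightarrow> g w \<le> h w) \<Longrightarrow> avg n g \<le> avg n h"
  by (auto simp: avg_def intro!: divide_right_mono sum_mono)

lemma avg_cong: "(\<And>w. length w = n \<Longrightarrow> g w = h w) \<Longrightarrow> avg n g = avg n h"
  by (auto simp: avg_def intro!: sum.cong)

lemma avg_nonneg: "(\<And>w. length w = n \<Longrightarrow> 0 \<le> g w) \<Longrightarrow> 0 \<le> avg n g"
  using avg_mono[of n "\<lambda>_. 0" g] by simp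

lemma avg_plus: "avg n (\<lambda>w. g w + h w) = avg n g + avg n h"
  by (simp add: avg_def sum.distrib add_divide_distrib)

lemma avg_diff: "avg n (\<lambda>w. g w - h w) = avg n g - avg n h"
  by (simp add: avg_def sum_subtractf diff_divide_distrib)

lemma avg_cmult: "avg n (\<lambda>w. c * g w) = c * avg n g"
  by (simp add: avg_def sum_distrib_left)

lemma avg_sum: "avg n (\<lambda>w. \<Sum>i\<in>I. g i w) = (\<Sum>i\<in>I. avg n (g i))"
  unfolding avg_def by (subst sum.swap) (simp add: sum_divide_distrib)

lemma avg_le_sqrt_avg_square:
  fixes g :: "'a::finite list \<Rightarrow> real"
  shows "avg n g \<le> sqrt (avg n (\<lambda>w. (g w)\<^sup>2))"
proof (rule real_le_rsqrt)
  have "(\<Sum>w\<in>Ls n. g w)\<^sup>2 \<le> (\<Sum>w\<in>Ls n. (g w)\<^sup>2) * real (card (Ls n :: 'a list set))"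
    by (rule sum_squared_le_sum_of_squares)
  then have "(\<Sum>w\<in>Ls n. g w)\<^sup>2 / (real CARD('a) ^ n)\<^sup>2 \<le>
      (\<Sum>w\<in>Ls n. (g w)\<^sup>2) * real CARD('a) ^ n / (real CARD('a) ^ n)\<^sup>2"
    by (intro divide_right_mono) (simp_all add: card_Ls)
  then show "(avg n g)\<^sup>2 \<le> avg n (\<lambda>w. (g w)\<^sup>2)"
    by (simp add: avg_def power_divide power2_eq_square[of "real CARD('a) ^ n"])
qed

section \<open>Inverse moments of multinomial counts\<close>

definition inc :: "'a \<Rightarrow> ('a \<Rightarrow> nat) \<Rightarrow> 'a \<Rightarrow> nat" where
  "inc i f = f(i := Suc (f i))"

lemma count_list_Cons: "count_list (a # s) = inc a (count_list s)"
  by (auto simp: inc_def)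

lemma inc_commute: "inc i (inc j f) = inc j (inc i f)"
  by (auto simp: inc_def fun_eq_iff)

text \<open>\<open>count_list s i\<close> is the sum over positions of the indicator that the letter
  there is \<open>i\<close>. Each of the \<open>Suc n\<close> positions carries \<open>i\<close>
  with probability \<open>1 / CARD('a)\<close>, and then the other letters form a uniform word of
  length \<open>n\<close>, whose counts \<open>inc i\<close> completes.\<close>

lemma size_bias:
  fixes G :: "('a::finite \<Rightarrow> nat) \<Rightarrow> real"
  shows "real (Suc n) * avg n (\<lambda>s. G (inc i (count_list s))) =
     real CARD('a) * avg (Suc n) (\<lambda>s. real (count_list s i) * G (count_list s))"
proof (induction n arbitrary: G)
  case 0
  have "(\<Sum>a\<in>UNIV. real (inc a (count_list []) i) * G (inc a (count_list []))) =
      (\<Sum>a\<in>UNIV. if a = i then G (inc i (count_list [])) else 0)"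
    by (intro sum.cong) (auto simp: inc_def)
  then show ?case by (simp add: avg_Cons count_list_Cons del: count_list.simps(2))
next
  case (Suc n)
  let ?D = "real CARD('a)"
  have D: "?D \<noteq> 0" by simp
  have inc_i: "real (inc a f i) = real (f i) + of_bool (a = i)" for a and f :: "'a \<Rightarrow> nat"
    by (simp add: inc_def)
  have IH: "avg (Suc n) (\<lambda>s. real (count_list s i) * G (inc a (count_list s))) =
     real (Suc n) / ?D * avg n (\<lambda>s. G (inc a (inc i (count_list s))))" for a
    using Suc.IH[of "\<lambda>f. G (inc a f)"] D by (simp add: field_simps del: of_nat_Suc)
  have "?D * avg (Suc (Suc n)) (\<lambda>s. real (count_list s i) * G (count_list s)) =
     (\<Sum>a\<in>UNIV. avg (Suc n) (\<lambda>s. real (count_list s i) * G (inc a (count_list s)) +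
        of_bool (a = i) * G (inc a (count_list s))))"
    by (simp add: avg_Cons[of "Suc n"] count_list_Cons inc_i distrib_right del: count_list.simps(2))
  also have "\<dots> = (\<Sum>a\<in>UNIV. real (Suc n) / ?D * avg n (\<lambda>s. G (inc a (inc i (count_list s))))) +
     (\<Sum>a\<in>UNIV. of_bool (a = i) * avg (Suc n) (\<lambda>s. G (inc a (count_list s))))"
    unfolding avg_plus IH avg_cmult sum.distrib ..
  also have "(\<Sum>a\<in>UNIV. real (Suc n) / ?D * avg n (\<lambda>s. G (inc a (inc i (count_list s))))) =
     real (Suc n) * avg (Suc n) (\<lambda>s. G (inc i (count_list s)))"
    by (simp add: avg_Cons count_list_Cons inc_commute[of i] sum_distrib_left del: count_list.simps(2) of_nat_Suc
        flip: sum_divide_distrib)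
  also have "(\<Sum>a\<in>UNIV. of_bool (a = i) * avg (Suc n) (\<lambda>s. G (inc a (count_list s)))) =
     avg (Suc n) (\<lambda>s. G (inc i (count_list s)))"
    by simp
  finally show ?case by (simp add: algebra_simps)
qed

text \<open>Size biasing trades the factor \<open>1 / (count + 1)\<close> of one letter for the
  constant \<open>CARD('a) / (n + 1)\<close> and one more letter in the word; induction over the
  letters of \<open>R\<close> removes all factors.\<close>

lemma avg_prod_inverse_count:
  fixes R :: "'a::finite set"
  shows "avg n (\<lambda>s. \<Prod>i\<in>R. 1 / (real (count_list s i) + 1)) \<le> (real CARD('a) / (real n + 1)) ^ card R"
proof (induction R arbitrary: n rule: finite_induct[OF finite])
  case 1 show ?case by simp
next
  case (2 i R)
  let ?D = "real CARD('a)"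
  let ?p = "\<lambda>f. \<Prod>j\<in>R. 1 / (real (f j) + 1)"
  let ?G = "\<lambda>f. ?p f / real (f i)"
  have p: "?p (inc i f) = ?p f" for f using 2 by (intro prod.cong) (auto simp: inc_def)
  have p0: "0 \<le> ?p f" for f by (intro prod_nonneg) auto
  have "avg n (\<lambda>s. \<Prod>j\<in>insert i R. 1 / (real (count_list s j) + 1)) = avg n (\<lambda>s. ?G (inc i (count_list s)))"
    unfolding p using 2 by (simp add: inc_def add.commute)
  also have "\<dots> = ?D / (real n + 1) * avg (Suc n) (\<lambda>s. real (count_list s i) * ?G (count_list s))"
    using size_bias[of n ?G i] by (simp add: field_simps)
  \<comment> \<open>Only an inequality: where the count of \<open>i\<close> is 0, the quotient by it
    is 0 and the left side loses the word; elsewhere the count cancels.\<close>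
  also have "\<dots> \<le> ?D / (real n + 1) * avg (Suc n) (\<lambda>s. ?p (count_list s))"
    using p0 by (intro mult_left_mono avg_mono) auto
  also have "\<dots> \<le> ?D / (real n + 1) * (?D / (real (Suc n) + 1)) ^ card R"
    by (intro mult_left_mono 2) auto
  also have "\<dots> \<le> ?D / (real n + 1) * (?D / (real n + 1)) ^ card R"
    by (intro mult_left_mono power_mono divide_left_mono) auto
  finally show ?case using 2 by simp
qed

section \<open>Local bound for the simple random walk on the integers\<close>

fun sign_walk :: "nat \<Rightarrow> int \<Rightarrow> real" where
  "sign_walk 0 x = of_bool (x = 0)"
| "sign_walk (Suc n) x = (sign_walk n (x - 1) + sign_walk n (x + 1)) / 2"

lemma sign_walk_eq_0: "x < - int n \<or> odd (x + int n) \<Longrightarrow> sign_walk n x = 0"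
  by (induction n arbitrary: x) (auto simp: algebra_simps)

lemma sign_walk_binomial: "sign_walk n (2 * int j - int n) = real (n choose j) / 2 ^ n"
proof (induction n arbitrary: j)
  case 0 show ?case by (cases j) auto
next
  case (Suc n)
  have 1: "sign_walk n (2 * int j - int (Suc n) + 1) = real (n choose j) / 2 ^ n"
    using Suc[of j] by (simp add: algebra_simps)
  have 2: "sign_walk n (2 * int j - int (Suc n) - 1) = real (case j of 0 \<Rightarrow> 0 | Suc i \<Rightarrow> n choose i) / 2 ^ n"
    using Suc[of "j - 1"] sign_walk_eq_0[of "- int n - 2" n] by (cases j) (auto simp: algebra_simps)
  show ?case unfolding sign_walk.simps 1 2 by (cases j) (auto simp: field_simps)
qed

text \<open>The left side decreases in \<open>k\<close>, starting from 1: consecutive terms have the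
  ratio \<open>(2k+1)(2k+3) / (2k+2)^2\<close>, below 1. This replaces Stirling's formula.\<close>

lemma central_binomial_le: "(2 * real k + 1) * (real ((2 * k) choose k) / 4 ^ k)\<^sup>2 \<le> 1"
proof (induction k)
  case (Suc k)
  let ?b = "\<lambda>k. real ((2 * k) choose k) / 4 ^ k"
  have c: "real (Suc k) * real ((2 * Suc k) choose Suc k) = 2 * (2 * real k + 1) * real ((2 * k) choose k)"
  proof -
    have "Suc k * ((2 * Suc k) choose Suc k) = (2 * Suc k) * ((2 * k + 1) choose k)"
      using Suc_times_binomial_eq[of "2 * k + 1" k] by simp
    moreover have "Suc k * ((2 * k + 1) choose k) = (2 * k + 1) * ((2 * k) choose k)"
    proof -
      have "(2 * k + 1) choose k = (2 * k + 1) choose Suc k"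
        using binomial_symmetric[of k "2 * k + 1"] by simp
      then show ?thesis using Suc_times_binomial_eq[of "2 * k" k] by (simp add: mult.commute)
    qed
    ultimately have "Suc k * ((2 * Suc k) choose Suc k) = 2 * ((2 * k + 1) * ((2 * k) choose k))"
      by (metis mult.assoc)
    then show ?thesis
      by (metis (no_types, opaque_lifting) of_nat_mult of_nat_add of_nat_1 of_nat_numeral mult.assoc)
  qed
  have b: "?b (Suc k) = ?b k * (2 * real k + 1) / (2 * real k + 2)"
  proof -
    define p q where "p = real ((2 * Suc k) choose Suc k)" and "q = real ((2 * k) choose k)"
    have "real (Suc k) * p = 2 * (2 * real k + 1) * q" using c unfolding p_def q_def .
    then have "p = 2 * (2 * real k + 1) * q / (real k + 1)" by (simp add: field_simps)
    moreover have "2 * real k + 2 = 2 * (real k + 1)" by simp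
    moreover have "2 * (2 * real k + 1) * q / (real k + 1) / (4 * 4 ^ k) =
        q / 4 ^ k * (2 * real k + 1) / (2 * (real k + 1))"
      by (simp add: divide_simps) (simp add: algebra_simps)
    ultimately show ?thesis unfolding p_def[symmetric] q_def[symmetric] by (simp only: power_Suc)
  qed
  have "(2 * real (Suc k) + 1) * (?b (Suc k))\<^sup>2 =
     ((2 * real k + 3) * (2 * real k + 1) / (2 * real k + 2)\<^sup>2) * ((2 * real k + 1) * (?b k)\<^sup>2)"
    unfolding b by (simp add: power_divide power_mult_distrib power2_eq_square mult_ac add_ac)
  also have "\<dots> \<le> 1 * 1"
  proof (intro mult_mono Suc.IH)
    have "(2 * real k + 3) * (2 * real k + 1) \<le> (2 * real k + 2)\<^sup>2"
      by (simp add: power2_eq_square algebra_simps)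
    then show "(2 * real k + 3) * (2 * real k + 1) / (2 * real k + 2)\<^sup>2 \<le> 1"
      by (simp add: divide_le_eq_1)
  qed auto
  finally show ?case by simp
qed simp

text \<open>For odd \<open>n\<close> the middle coefficient is half of the next central one, so the
  even case covers both parities.\<close>

lemma middle_binomial_le: "real (n choose (n div 2)) / 2 ^ n \<le> 1 / sqrt (real n + 1)"
proof -
  have "(real n + 1) * (real (n choose (n div 2)) / 2 ^ n)\<^sup>2 \<le> 1"
  proof (cases "even n")
    case True
    then obtain k where "n = 2 * k" by blast
    then show ?thesis using central_binomial_le[of k] by (simp add: power_mult)
  next
    case False
    then obtain k where n: "n = 2 * k + 1" using oddE by blast
    have "(2 * Suc k) choose (Suc k) = ((2 * k + 1) choose k) + ((2 * k + 1) choose Suc k)"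
      by simp
    also have "(2 * k + 1) choose Suc k = (2 * k + 1) choose k"
      using binomial_symmetric[of k "2 * k + 1"] by simp
    finally have "real ((2 * Suc k) choose (Suc k)) / 4 ^ Suc k = real (n choose (n div 2)) / 2 ^ n"
      by (simp add: n power_mult)
    then have "(2 * real (Suc k) + 1) * (real (n choose (n div 2)) / 2 ^ n)\<^sup>2 \<le> 1"
      using central_binomial_le[of "Suc k"] by simp
    moreover have "(real n + 1) * (real (n choose (n div 2)) / 2 ^ n)\<^sup>2 \<le>
       (2 * real (Suc k) + 1) * (real (n choose (n div 2)) / 2 ^ n)\<^sup>2"
      by (intro mult_right_mono) (auto simp: n)
    ultimately show ?thesis by linarith
  qed
  then have "(real (n choose (n div 2)) / 2 ^ n)\<^sup>2 \<le> (1 / sqrt (real n + 1))\<^sup>2"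
    by (simp add: power_divide field_simps)
  then show ?thesis by (rule power2_le_imp_le) simp
qed

lemma sign_walk_le: "sign_walk n x \<le> 1 / sqrt (real n + 1)"
proof (cases "x < - int n \<or> odd (x + int n)")
  case True
  then show ?thesis by (simp add: sign_walk_eq_0)
next
  case False
  then obtain j where "x + int n = 2 * j" by blast
  with False have x: "x = 2 * int (nat j) - int n" by simp
  have "sign_walk n x = real (n choose nat j) / 2 ^ n" unfolding x by (rule sign_walk_binomial)
  also have "\<dots> \<le> real (n choose (n div 2)) / 2 ^ n"
    by (intro divide_right_mono) (simp_all add: binomial_maximum)
  also note middle_binomial_le
  finally show ?thesis .
qed

lemma sign_walk_nonneg: "0 \<le> sign_walk n x"
  by (induction n arbitrary: x) auto

context excited_walk begin

text \<open>Given the sequence of directions, the coordinates are independent one-dimensional walks.\<close>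

lemma avg_tpos_eq_prod:
  assumes R: "e1 \<notin> R"
  shows "avg n (\<lambda>w. of_bool (\<forall>i\<in>R. tpos w $ i = x i)) =
     avg n (\<lambda>s. \<Prod>i\<in>R. sign_walk (count_list s i) (x i))"
proof (induction n arbitrary: x)
  case 0
  show ?case
  proof (cases "\<forall>i\<in>R. x i = 0")
    case False
    then have "(\<Prod>i\<in>R. sign_walk 0 (x i)) = 0" by (intro prod_zero) auto
    moreover have "\<not> (\<forall>i\<in>R. tpos [] $ i = x i)" using False by auto
    ultimately show ?thesis by (simp only: avg_0 count_list.simps of_bool_eq)
  qed auto
next
  case (Suc n)
  let ?E = "\<lambda>x. avg n (\<lambda>w. of_bool (\<forall>i\<in>R. tpos w $ i = x i))"
  let ?P = "\<lambda>f x. \<Prod>j\<in>R. sign_walk (f j) (x j)"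
  have step: "avg n (\<lambda>w. of_bool (\<forall>i\<in>R. tpos (s # w) $ i = x i)) = ?E (\<lambda>i. x i - tdir s $ i)" for s
  proof -
    have "(tpos (s # w) $ i = x i) = (tpos w $ i = x i - tdir s $ i)" for w i
      unfolding tpos_Cons vector_add_component by linarith
    then show ?thesis by presburger
  qed
  \<comment> \<open>If \<open>i\<close> is in \<open>R\<close>, summing over the two signs is twice
    the recursion of \<open>sign_walk\<close> in coordinate \<open>i\<close>; otherwise, and in
    particular for \<open>e1\<close>, no coordinate of \<open>R\<close> moves.\<close>
  have split: "?P f (\<lambda>j. x j - tdir (i, True) $ j) + ?P f (\<lambda>j. x j - tdir (i, False) $ j) = 2 * ?P (inc i f) x"
    for f i
  proof (cases "i \<in> R")
    case True
    with R have ne: "i \<noteq> e1" by auto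
    have rest: "(\<Prod>j\<in>R - {i}. sign_walk (f j) (x j - tdir (i, b) $ j)) = (\<Prod>j\<in>R - {i}. sign_walk (f j) (x j))"
      "(\<Prod>j\<in>R - {i}. sign_walk (inc i f j) (x j)) = (\<Prod>j\<in>R - {i}. sign_walk (f j) (x j))" for b
      by (intro prod.cong; simp add: tdir_def dir_def axis_def inc_def)+
    show ?thesis
      unfolding prod.remove[OF finite True] rest
      using ne by (simp add: tdir_def dir_def inc_def axis_def algebra_simps)
  next
    case False
    have "?P f (\<lambda>j. x j - tdir (i, b) $ j) = ?P f x" "?P (inc i f) x = ?P f x" for b
      using False by (intro prod.cong; auto simp: tdir_def dir_def axis_def inc_def)+
    then show ?thesis by simp
  qed
  have "avg (Suc n) (\<lambda>w. of_bool (\<forall>i\<in>R. tpos w $ i = x i)) =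
     (\<Sum>i\<in>UNIV. avg n (\<lambda>s. ?P (count_list s) (\<lambda>j. x j - tdir (i, True) $ j) +
        ?P (count_list s) (\<lambda>j. x j - tdir (i, False) $ j))) / (CARD('d) * 2)"
    unfolding avg_Cons step Suc.IH sum_direction_sign avg_plus by simp
  also have "\<dots> = (\<Sum>i\<in>UNIV. avg n (\<lambda>s. ?P (count_list (i # s)) x)) / CARD('d)"
    unfolding split avg_cmult count_list_Cons by (simp flip: sum_distrib_left)
  finally show ?case by (simp add: avg_Cons)
qed

text \<open>Exactly seven of the transversal coordinates are kept, which fixes the exponent for
  every \<open>d\<close>. Given the numbers of steps per axis the local bound is a product of
  inverse square roots; Cauchy-Schwarz squares them, and the inverse moments of the counts finish
  the estimate.\<close>

lemma heat_kernel:
  assumes "CARD('d) \<ge> 8"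
  shows "avg n (\<lambda>w. of_bool (tpos w = x)) \<le> sqrt ((real CARD('d) / (real n + 1)) ^ 7)"
proof -
  have "card (- {e1}) \<ge> 7" using assms by (simp add: Compl_eq_Diff_UNIV card_Diff_subset)
  then obtain R where R: "R \<subseteq> - {e1}" "card R = 7" by (meson obtain_subset_with_card_n)
  have "avg n (\<lambda>w. of_bool (tpos w = x)) \<le> avg n (\<lambda>w. of_bool (\<forall>i\<in>R. tpos w $ i = x $ i))"
    by (intro avg_mono) auto
  also have "\<dots> = avg n (\<lambda>s. \<Prod>i\<in>R. sign_walk (count_list s i) (x $ i))"
    by (rule avg_tpos_eq_prod) (use R in auto)
  also have "\<dots> \<le> avg n (\<lambda>s. \<Prod>i\<in>R. 1 / sqrt (real (count_list s i) + 1))"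
    by (intro avg_mono prod_mono conjI sign_walk_nonneg sign_walk_le)
  also have "\<dots> \<le> sqrt (avg n (\<lambda>s. (\<Prod>i\<in>R. 1 / sqrt (real (count_list s i) + 1))\<^sup>2))"
    by (rule avg_le_sqrt_avg_square)
  also have "(\<lambda>s :: 'd list. (\<Prod>i\<in>R. 1 / sqrt (real (count_list s i) + 1))\<^sup>2) =
      (\<lambda>s. \<Prod>i\<in>R. 1 / (real (count_list s i) + 1))"
    by (simp add: power_divide prod_power_distrib)
  also have "sqrt (avg n \<dots>) \<le> sqrt ((real CARD('d) / (real n + 1)) ^ 7)"
    using avg_prod_inverse_count[of n R] R by simp
  finally show ?thesis .
qed

end

section \<open>Existence of cut times\<close>

context excited_walk begin

text \<open>The bound of \<open>heat_kernel\<close> with a real exponent, so that the exponent can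
  be split later.\<close>

definition kern :: "nat \<Rightarrow> real" where
  "kern l = (real CARD('d) / (real l + 1)) powr (7/2)"

lemma kern_nonneg [simp]: "0 \<le> kern l"
  by (simp add: kern_def)

lemma kern_antimono: "k \<le> l \<Longrightarrow> kern l \<le> kern k"
  unfolding kern_def by (intro powr_mono2 divide_left_mono) auto

lemma avg_tpos_eq:
  assumes "CARD('d) \<ge> 8"
  shows "avg n (\<lambda>w. of_bool (tpos w = x)) \<le> kern n"
proof -
  have "sqrt (y ^ 7) = y powr (7/2)" if "y > 0" for y :: real
  proof -
    have "y ^ 7 = y powr 7" using powr_realpow[of y 7] that by simp
    then have "sqrt (y ^ 7) = (y powr 7) powr (1/2)" by (simp only: powr_half_sqrt powr_ge_zero)
    then show ?thesis by (simp add: powr_powr)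
  qed
  then show ?thesis using heat_kernel[OF assms, of n x] by (simp add: kern_def)
qed

lemma tpos_nth_le: "\<bar>tpos w $ i\<bar> \<le> int (length w)"
proof (induction w)
  case (Cons s w)
  have "\<bar>tdir s $ i\<bar> \<le> 1" by (simp add: tdir_def dir_def axis_def)
  then show ?case using Cons by simp
qed simp

text \<open>
  A cut at time \<open>L\<close> has positive probability uniformly in \<open>L\<close>: force \<open>2 * K\<close> steps in a fixed
  transversal direction around time \<open>L\<close>.  The positions at times \<open>L - p\<close> and \<open>L + q\<close> then differ by
  the sum of a straight stretch of length \<open>min p K + min q K\<close> and two independent walks of
  lengths \<open>p - K\<close> and \<open>q - K\<close> (truncated subtraction), which must be long enough to return.
\<close>

lemma avg_tpos_straight:
  assumes d: "CARD('d) \<ge> 8" and i: "i \<noteq> e1" and p: "1 \<le> p"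
  shows "avg (p - K) (\<lambda>x. avg (q - K) (\<lambda>y.
      of_bool (tpos x + tpos y = - tpos (replicate (min p K + min q K) (i, True)))))
    \<le> (3 * real CARD('d)) powr (7/2) * real (Suc K) powr (-1/2) *
        (real (Suc p) powr (-3/2) * real (Suc q) powr (-3/2))" (is "?A \<le> ?B")
proof -
  define l where "l = (p - K) + (q - K)"
  define r where "r = min p K + min q K"
  have r: "tpos (replicate r (i, True)) $ i = int r"
    by (induction r) (auto simp: tdir_def dir_def i)
  have A: "?A = avg l (\<lambda>w. of_bool (tpos w = - tpos (replicate r (i, True))))"
    by (simp add: l_def r_def avg_add)
  show ?thesis
  proof (cases "l < r")
    case True
    have ne: "tpos w \<noteq> - tpos (replicate r (i, True))" if "length w = l" for w
    proof
      assume "tpos w = - tpos (replicate r (i, True))"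
      then have "tpos w $ i = - int r" using r by simp
      then show False using tpos_nth_le[of w i] that True by simp
    qed
    have "?A = avg l (\<lambda>_ :: ('d \<times> bool) list. 0)" unfolding A by (intro avg_cong) (simp add: ne)
    then show ?thesis by simp
  next
    case False
    \<comment> \<open>Here \<open>l + r = p + q\<close> and \<open>r \<le> l\<close>. If
      \<open>p\<close> and \<open>q\<close> were both below \<open>K\<close>, then
      \<open>l = 0 < r\<close>, because \<open>1 \<le> p\<close>; so one of them reaches
      \<open>K\<close>, whence \<open>K \<le> r \<le> l\<close>.\<close>
    have "l \<ge> K" and *: "p + q \<le> 3 * l" and "l \<noteq> 0"
      using False p by (auto simp: l_def r_def min_def split: if_splits)
    define M where "M = real (p + q + 1)"
    have M: "M > 0" "real (Suc K) \<le> M" "real (Suc p) \<le> M" "real (Suc q) \<le> M"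
      using \<open>l \<ge> K\<close> by (auto simp: M_def l_def)
    have "?A \<le> kern l" unfolding A by (rule avg_tpos_eq[OF d])
    also have "\<dots> \<le> (3 * real CARD('d) / M) powr (7/2)"
      unfolding kern_def
    proof (intro powr_mono2)
      have "M \<le> 3 * (real l + 1)" using * by (simp add: M_def)
      then have "real CARD('d) * M \<le> real CARD('d) * (3 * (real l + 1))" by (intro mult_left_mono) auto
      then show "real CARD('d) / (real l + 1) \<le> 3 * real CARD('d) / M"
        using M(1) by (simp add: field_simps)
    qed auto
    also have "\<dots> = (3 * real CARD('d)) powr (7/2) * M powr (-7/2)"
      using M(1) by (simp add: powr_divide powr_minus field_simps)
    \<comment> \<open>The exponent is spent as 3/2 for \<open>p\<close> and 3/2 for
      \<open>q\<close>, both summable, and 1/2 for \<open>K\<close>, which makes the total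
      small.\<close>
    also have "M powr (-7/2) = M powr (-1/2) * (M powr (-3/2) * M powr (-3/2))"
      by (simp add: powr_add[symmetric])
    also have "(3 * real CARD('d)) powr (7/2) * \<dots> \<le> (3 * real CARD('d)) powr (7/2) *
       (real (Suc K) powr (-1/2) * (real (Suc p) powr (-3/2) * real (Suc q) powr (-3/2)))"
      using M by (intro mult_left_mono mult_mono powr_mono2') auto
    finally show ?thesis by (simp add: mult_ac)
  qed
qed

text \<open>Union bound over the pairs of times that could violate the cut at \<open>L\<close>.
  Since \<open>\<Sum> (n + 1) powr (-3/2)\<close> converges, the bound tends to 0 in
  \<open>K\<close> uniformly in \<open>L\<close>.\<close>

lemma avg_not_cut_straight:
  assumes d: "CARD('d) \<ge> 8" and i: "i \<noteq> e1" and KL: "K \<le> L"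
  shows "avg (L - K) (\<lambda>a. avg (L - K) (\<lambda>b. of_bool (\<not> cut L (a @ replicate (2 * K) (i, True) @ b))))
    \<le> (3 * real CARD('d)) powr (7/2) * real (Suc K) powr (-1/2) * (\<Sum>n\<le>L. real (Suc n) powr (-3/2))\<^sup>2"
proof -
  let ?S = "replicate (2 * K) (i, True)"
  let ?E = "\<lambda>p q x y. of_bool (tpos x + tpos y = - tpos (replicate (min p K + min q K) (i, True))) :: real"
  have bad: "of_bool (\<not> cut L (a @ ?S @ b)) \<le>
      (\<Sum>p\<in>{1..L}. \<Sum>q\<le>L. ?E p q (drop (L - p) a) (take (q - K) b))"
    if a: "length a = L - K" and b: "length b = L - K" for a b
  proof (cases "cut L (a @ ?S @ b)")
    case False
    then obtain i' j where ij: "i' < L" "L \<le> j" "j \<le> 2 * L"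
        "tpos (take i' (a @ ?S @ b)) = tpos (take j (a @ ?S @ b))"
      using a b KL by (auto simp: cut_def)
    \<comment> \<open>Distances of the two times from \<open>L\<close>. The past of a cut excludes
      time \<open>L\<close> itself, so \<open>p \<ge> 1\<close>, while \<open>q = 0\<close> is
      possible.\<close>
    define p q where "p = L - i'" and "q = j - L"
    have i': "i' = L - p" and j: "j = L + q" and pq: "p \<in> {1..L}" "q \<le> L"
      using ij by (auto simp: p_def q_def)
    have tp: "tpos (replicate (r + s) (i, True)) = tpos (replicate r (i, True)) + tpos (replicate s (i, True))" for r s
      by (simp add: replicate_add)
    have 1: "tpos (take i' (a @ ?S @ b)) = tpos (take (L - p) a) + tpos (replicate (K - p) (i, True))"
      using a KL pq unfolding i' by (cases "p \<le> K") (auto simp: take_replicate min_def)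
    have 2: "tpos (take j (a @ ?S @ b)) = tpos a + tpos (replicate (K + min q K) (i, True)) + tpos (take (q - K) b)"
    proof -
      have "L + q - (L - K) = q + K" "min (q + K) (2 * K) = K + min q K" "q + K - 2 * K = q - K"
        using KL by auto
      then show ?thesis using a KL unfolding j by (simp add: take_replicate)
    qed
    have 3: "K + min q K = (K - p) + (min p K + min q K)" by simp
    have 4: "tpos a = tpos (take (L - p) a) + tpos (drop (L - p) a)"
      by (metis append_take_drop_id tpos_append)
    have "tpos (drop (L - p) a) + tpos (take (q - K) b) = - tpos (replicate (min p K + min q K) (i, True))"
      using ij(4) unfolding 1 2 unfolding 3 4 tp[of "K - p"] by (simp add: algebra_simps eq_neg_iff_add_eq_0)
    then have "1 = ?E p q (drop (L - p) a) (take (q - K) b)" by simp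
    also have "\<dots> \<le> (\<Sum>q\<le>L. ?E p q (drop (L - p) a) (take (q - K) b))"
      by (rule member_le_sum) (use pq in auto)
    also have "\<dots> \<le> (\<Sum>p\<in>{1..L}. \<Sum>q\<le>L. ?E p q (drop (L - p) a) (take (q - K) b))"
      by (rule member_le_sum) (use pq in \<open>auto intro!: sum_nonneg\<close>)
    finally show ?thesis using False by simp
  qed (auto intro!: sum_nonneg)
  \<comment> \<open>Only the last \<open>p - K\<close> letters of \<open>a\<close> and the first
    \<open>q - K\<close> letters of \<open>b\<close> matter; the others average out.\<close>
  have one: "avg (L - K) (\<lambda>a. avg (L - K) (\<lambda>b. ?E p q (drop (L - p) a) (take (q - K) b))) =
      avg (p - K) (\<lambda>x. avg (q - K) (\<lambda>y. ?E p q x y))" if "p \<in> {1..L}" "q \<le> L" for p q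
  proof -
    have a: "L - K = (L - K - (p - K)) + (p - K)" and b: "L - K = (q - K) + (L - K - (q - K))"
      using that by auto
    have "avg (L - K) (\<lambda>b. ?E p q x (take (q - K) b)) = avg (q - K) (\<lambda>y. ?E p q x y)" for x
      by (subst b, subst avg_add) (auto intro!: avg_cong)
    moreover have "avg (L - K) (\<lambda>a. f (drop (L - p) a)) = avg (p - K) f" for f :: "('d \<times> bool) list \<Rightarrow> real"
    proof -
      have "avg (L - K) (\<lambda>a. f (drop (L - p) a)) =
          avg (L - K - (p - K)) (\<lambda>z. avg (p - K) (\<lambda>x. f (drop (L - p) (z @ x))))"
        by (subst a, subst avg_add) simp
      also have "\<dots> = avg (L - K - (p - K)) (\<lambda>_ :: ('d \<times> bool) list. avg (p - K) f)"
        using that KL by (intro avg_cong arg_cong[of _ _ f]) (cases "p \<le> K"; simp)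
      finally show ?thesis by simp
    qed
    ultimately show ?thesis by simp
  qed
  have "avg (L - K) (\<lambda>a. avg (L - K) (\<lambda>b. of_bool (\<not> cut L (a @ ?S @ b)))) \<le>
     avg (L - K) (\<lambda>a. avg (L - K) (\<lambda>b. \<Sum>p\<in>{1..L}. \<Sum>q\<le>L. ?E p q (drop (L - p) a) (take (q - K) b)))"
    by (intro avg_mono bad)
  also have "\<dots> = (\<Sum>p\<in>{1..L}. \<Sum>q\<le>L. avg (p - K) (\<lambda>x. avg (q - K) (\<lambda>y. ?E p q x y)))"
    unfolding avg_sum by (intro sum.cong refl one) auto
  also have "\<dots> \<le> (\<Sum>p\<in>{1..L}. \<Sum>q\<le>L. (3 * real CARD('d)) powr (7/2) * real (Suc K) powr (-1/2) *
        (real (Suc p) powr (-3/2) * real (Suc q) powr (-3/2)))"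
    by (intro sum_mono avg_tpos_straight[OF d i]) auto
  also have "\<dots> \<le> (\<Sum>p\<le>L. \<Sum>q\<le>L. (3 * real CARD('d)) powr (7/2) * real (Suc K) powr (-1/2) *
        (real (Suc p) powr (-3/2) * real (Suc q) powr (-3/2)))"
    by (rule sum_mono2) (auto intro!: sum_nonneg)
  also have "\<dots> = (3 * real CARD('d)) powr (7/2) * real (Suc K) powr (-1/2) * (\<Sum>n\<le>L. real (Suc n) powr (-3/2))\<^sup>2"
    unfolding power2_eq_square sum_product by (simp only: sum_distrib_left)
  finally show ?thesis .
qed

text \<open>\<open>K\<close> is chosen such that, given the straight stretch, a cut fails with
  probability below 1/2. Forcing the stretch costs \<open>(2 * d) ^ (2 * K)\<close>, a price that
  does not depend on \<open>L\<close>.\<close>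

lemma avg_cut_lower_bound:
  assumes d: "CARD('d) \<ge> 8"
  shows "\<exists>K \<delta>. 0 < \<delta> \<and> (\<forall>L\<ge>K. \<delta> \<le> avg (2 * L) (\<lambda>w. of_bool (cut L w)))"
proof -
  have "card (UNIV - {e1}) > 0" using d by (simp add: card_Diff_subset)
  then obtain i where i: "i \<noteq> e1" by (metis card_gt_0_iff DiffE ex_in_conv singletonI)
  define S where "S = (\<Sum>n. real (Suc n) powr (-3/2))"
  have "summable (\<lambda>n. real n powr (-3/2))" by (simp add: summable_real_powr_iff)
  then have sm: "summable (\<lambda>n. real (Suc n) powr (-3/2))" by (subst summable_Suc_iff)
  have S: "(\<Sum>n\<le>L. real (Suc n) powr (-3/2)) \<le> S" for L
    unfolding S_def by (intro sum_le_suminf sm) auto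
  have "(\<lambda>K. (3 * real CARD('d)) powr (7/2) * real (Suc K) powr (-1/2) * S\<^sup>2) \<longlonglongrightarrow>
      (3 * real CARD('d)) powr (7/2) * 0 * S\<^sup>2"
    by (intro tendsto_intros LIMSEQ_Suc[OF tendsto_neg_powr] filterlim_real_sequentially) auto
  then have "eventually (\<lambda>K. (3 * real CARD('d)) powr (7/2) * real (Suc K) powr (-1/2) * S\<^sup>2 < 1/2) sequentially"
    by (intro order_tendstoD(2)) auto
  then obtain K where K: "(3 * real CARD('d)) powr (7/2) * real (Suc K) powr (-1/2) * S\<^sup>2 < 1/2"
    by (auto simp: eventually_sequentially)
  let ?S = "replicate (2 * K) (i, True)"
  have "1 / (2 * real CARD('d)) ^ (2 * K) / 2 \<le> avg (2 * L) (\<lambda>w. of_bool (cut L w))" if "L \<ge> K" for L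
  proof -
    have "1 - avg (L - K) (\<lambda>a. avg (L - K) (\<lambda>b. of_bool (\<not> cut L (a @ ?S @ b)))) =
       avg (L - K) (\<lambda>a. avg (L - K) (\<lambda>b. 1 - of_bool (\<not> cut L (a @ ?S @ b))))"
      by (simp add: avg_diff)
    also have "\<dots> = avg (L - K) (\<lambda>a. avg (L - K) (\<lambda>b. of_bool (cut L (a @ ?S @ b))))"
      by (simp add: of_bool_not_iff)
    finally have "avg (L - K) (\<lambda>a. avg (L - K) (\<lambda>b. of_bool (cut L (a @ ?S @ b)))) \<ge>
       1 - (3 * real CARD('d)) powr (7/2) * real (Suc K) powr (-1/2) * (\<Sum>n\<le>L. real (Suc n) powr (-3/2))\<^sup>2"
      using avg_not_cut_straight[OF d i that] by linarith
    moreover have "(3 * real CARD('d)) powr (7/2) * real (Suc K) powr (-1/2) * (\<Sum>n\<le>L. real (Suc n) powr (-3/2))\<^sup>2 \<le>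
        (3 * real CARD('d)) powr (7/2) * real (Suc K) powr (-1/2) * S\<^sup>2"
      using S by (intro mult_left_mono power_mono) (auto intro!: sum_nonneg)
    ultimately have half: "1/2 \<le> avg (L - K) (\<lambda>a. avg (L - K) (\<lambda>b. of_bool (cut L (a @ ?S @ b))))"
      using K by linarith
    have L: "2 * L = (L - K) + (2 * K + (L - K))" using that by simp
    have mid: "avg (L - K) (\<lambda>b. of_bool (cut L (a @ ?S @ b))) / (2 * real CARD('d)) ^ (2 * K) \<le>
        avg (2 * K) (\<lambda>s. avg (L - K) (\<lambda>b. of_bool (cut L (a @ s @ b))))" for a
    proof -
      have "avg (L - K) (\<lambda>b. of_bool (cut L (a @ ?S @ b))) \<le>
          (\<Sum>s\<in>Ls (2 * K). avg (L - K) (\<lambda>b. of_bool (cut L (a @ s @ b))))"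
        by (rule member_le_sum[of _ _ "\<lambda>s. avg (L - K) (\<lambda>b. of_bool (cut L (a @ s @ b)))"])
           (auto intro!: avg_nonneg)
      then have "avg (L - K) (\<lambda>b. of_bool (cut L (a @ ?S @ b))) / (2 * real CARD('d)) ^ (2 * K) \<le>
          (\<Sum>s\<in>Ls (2 * K). avg (L - K) (\<lambda>b. of_bool (cut L (a @ s @ b)))) / (2 * real CARD('d)) ^ (2 * K)"
        by (rule divide_right_mono) simp
      moreover have "real CARD('d \<times> bool) = 2 * real CARD('d)" by simp
      ultimately show ?thesis
        unfolding avg_def[of "2 * K"] by (simp only:)
    qed
    have "1 / (2 * real CARD('d)) ^ (2 * K) / 2 \<le>
        1 / (2 * real CARD('d)) ^ (2 * K) * avg (L - K) (\<lambda>a. avg (L - K) (\<lambda>b. of_bool (cut L (a @ ?S @ b))))"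
      using mult_left_mono[OF half, of "1 / (2 * real CARD('d)) ^ (2 * K)"] by simp
    also have "\<dots> \<le> avg (L - K) (\<lambda>a. avg (2 * K) (\<lambda>s. avg (L - K) (\<lambda>b. of_bool (cut L (a @ s @ b)))))"
      by (subst avg_cmult[symmetric], rule avg_mono) (use mid in simp)
    also have "\<dots> = avg (2 * L) (\<lambda>w. of_bool (cut L w))"
      by (subst L) (simp only: avg_add)
    finally show ?thesis .
  qed
  then show ?thesis
    by (intro exI[of _ K] exI[of _ "1 / (2 * real CARD('d)) ^ (2 * K) / 2"]) auto
qed

lemma avg_tpos_take_eq:
  assumes "CARD('d) \<ge> 8" "i \<le> j" "j \<le> n"
  shows "avg n (\<lambda>w. of_bool (tpos (take i w) = tpos (take j w))) \<le> kern (j - i)"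
proof -
  have n: "n = i + ((j - i) + (n - j))" using assms by simp
  have "avg n (\<lambda>w. of_bool (tpos (take i w) = tpos (take j w))) =
     avg i (\<lambda>a. avg (j - i) (\<lambda>x. avg (n - j) (\<lambda>b. of_bool (tpos (take i (a @ x @ b)) = tpos (take j (a @ x @ b))))))"
    by (subst n) (simp only: avg_add)
  also have "\<dots> = avg i (\<lambda>_ :: ('d \<times> bool) list. avg (j - i) (\<lambda>x. avg (n - j)
      (\<lambda>_ :: ('d \<times> bool) list. of_bool (tpos x = 0))))"
    using assms by (intro avg_cong arg_cong[of _ _ of_bool]) auto
  also have "\<dots> \<le> kern (j - i)"
    using avg_tpos_eq[OF assms(1), of "j - i" 0] by simp
  finally show ?thesis .
qed

text \<open>
  The last \<open>B * (2 * L)\<close> steps are divided into \<open>B\<close> independent blocks.  If the middle of some block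
  is a cut time for that block and the walk never returns to a site after \<open>L\<close> steps or more, then
  it is a cut time for the entire walk.
\<close>

definition no_cut_prob :: "nat \<Rightarrow> nat \<Rightarrow> real" where
  "no_cut_prob n l = avg n (\<lambda>u. avg l (\<lambda>y. of_bool (\<not> has_cut u y)))"

lemma no_cut_prob_bounds: "0 \<le> no_cut_prob n l" "no_cut_prob n l \<le> 1"
proof -
  show "0 \<le> no_cut_prob n l" unfolding no_cut_prob_def by (intro avg_nonneg) auto
  have "no_cut_prob n l \<le> avg n (\<lambda>_ :: ('d \<times> bool) list. avg l (\<lambda>_ :: ('d \<times> bool) list. 1))"
    unfolding no_cut_prob_def by (intro avg_mono) auto
  then show "no_cut_prob n l \<le> 1" by simp
qed

lemma has_cut_from_block:
  assumes y: "length y = B * (2 * L)" and b: "b < B"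
    and block: "cut L (take (2 * L) (drop (b * (2 * L)) y))"
    and long: "\<And>i j. i + L \<le> j \<Longrightarrow> j \<le> length (u @ y) \<Longrightarrow> tpos (take i (u @ y)) \<noteq> tpos (take j (u @ y))"
  shows "has_cut u y"
proof -
  define c where "c = b * (2 * L) + L"
  have "Suc b * (2 * L) \<le> B * (2 * L)" using b by (intro mult_right_mono) auto
  then have bl: "b * (2 * L) + 2 * L \<le> length y" using y by simp
  let ?x = "take (2 * L) (drop (b * (2 * L)) y)"
  have tk: "tpos (take (length u + b * (2 * L) + k) (u @ y)) = tpos (u @ take (b * (2 * L)) y) + tpos (take k ?x)"
    if "k \<le> 2 * L" for k
    using that bl by (simp add: take_add min_def add.assoc)
  have "cut (length u + c) (u @ y)"
    unfolding cut_def
  proof (intro conjI allI impI ballI notI)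
    show "length u + c \<le> length (u @ y)" using bl by (simp add: c_def)
    fix i j assume i: "i < length u + c" and j: "j \<in> {length u + c..length (u @ y)}"
      and eq: "tpos (take i (u @ y)) = tpos (take j (u @ y))"
    \<comment> \<open>As \<open>i\<close> lies before the middle of the block and \<open>j\<close>
      does not, a distance below \<open>L\<close> places both inside the block, where its own cut
      applies.\<close>
    have "\<not> i + L \<le> j" using long[of i j] eq j by auto
    define i' j' where "i' = i - (length u + b * (2 * L))" and "j' = j - (length u + b * (2 * L))"
    have ij: "i = length u + b * (2 * L) + i'" "j = length u + b * (2 * L) + j'"
      "i' < L" "L \<le> j'" "j' \<le> 2 * L"
      using i j \<open>\<not> i + L \<le> j\<close> by (auto simp: i'_def j'_def c_def)
    have "tpos (take i' ?x) = tpos (take j' ?x)"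
      using eq tk[of i'] tk[of j'] ij(3-5) unfolding ij(1,2) by (simp only: add_left_cancel)
    moreover have "tpos (take i' ?x) \<noteq> tpos (take j' ?x)"
      using ij bl by (intro cutD[OF block]) auto
    ultimately show False by simp
  qed
  moreover have "c \<le> length y" using bl by (simp add: c_def)
  ultimately show ?thesis unfolding has_cut_def by blast
qed

lemma avg_no_block_cut:
  assumes "\<delta> \<le> avg (2 * L) (\<lambda>w. of_bool (cut L w))"
  shows "avg (B * (2 * L)) (\<lambda>y. of_bool (\<forall>b<B. \<not> cut L (take (2 * L) (drop (b * (2 * L)) y)))) \<le> (1 - \<delta>) ^ B"
proof (induction B)
  case 0 show ?case by simp
next
  case (Suc B)
  let ?P = "\<lambda>B y. \<forall>b<B. \<not> cut L (take (2 * L) (drop (b * (2 * L)) y))"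
  have one: "avg (2 * L) (\<lambda>w. of_bool (\<not> cut L w)) \<le> 1 - \<delta>"
  proof -
    have "avg (2 * L) (\<lambda>w. of_bool (\<not> cut L w)) = avg (2 * L) (\<lambda>w. 1 - of_bool (cut L w))"
      by (simp add: of_bool_not_iff)
    then show ?thesis using assms by (simp add: avg_diff)
  qed
  then have nn: "0 \<le> 1 - \<delta>" using avg_nonneg[of "2 * L" "\<lambda>w. of_bool (\<not> cut L w)"] by simp
  have "avg (Suc B * (2 * L)) (\<lambda>y. of_bool (?P (Suc B) y)) =
     avg (2 * L) (\<lambda>x. avg (B * (2 * L)) (\<lambda>y. of_bool (?P (Suc B) (x @ y))))"
    by (simp only: mult_Suc avg_add)
  also have "\<dots> = avg (2 * L) (\<lambda>x. avg (B * (2 * L)) (\<lambda>y. of_bool (\<not> cut L x) * of_bool (?P B y)))"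
  proof (intro avg_cong)
    fix x y :: "('d \<times> bool) list" assume x: "length x = 2 * L"
    have "?P (Suc B) (x @ y) \<longleftrightarrow> \<not> cut L x \<and> ?P B y"
      unfolding All_less_Suc2 using x by simp
    then show "of_bool (?P (Suc B) (x @ y)) = (of_bool (\<not> cut L x) * of_bool (?P B y) :: real)"
      by (simp only: of_bool_conj)
  qed
  also have "\<dots> = avg (B * (2 * L)) (\<lambda>y. of_bool (?P B y)) * avg (2 * L) (\<lambda>x. of_bool (\<not> cut L x))"
    by (simp only: avg_cmult mult.commute[of "of_bool _" "avg _ _"])
  also have "\<dots> \<le> (1 - \<delta>) ^ B * (1 - \<delta>)"
    using one nn Suc by (intro mult_mono) (auto intro!: avg_nonneg)
  finally show ?case by (simp add: mult.commute)
qed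

text \<open>Without a cut, either the walk returns to a site after at least \<open>L\<close> steps,
  or no block has a cut in its middle. The first event is bounded by a union over pairs of times,
  the second by independence of the blocks.\<close>

lemma no_cut_prob_le:
  assumes d: "CARD('d) \<ge> 8" and \<delta>: "\<delta> \<le> avg (2 * L) (\<lambda>w. of_bool (cut L w))"
  shows "no_cut_prob n (B * (2 * L)) \<le> (real (n + B * (2 * L)) + 1)\<^sup>2 * kern L + (1 - \<delta>) ^ B"
proof -
  define l where "l = B * (2 * L)"
  define I where "I = {(i, j). i + L \<le> j \<and> j \<le> n + l}"
  have I: "I \<subseteq> {..n + l} \<times> {..n + l}" by (auto simp: I_def)
  then have fI: "finite I" by (rule finite_subset) auto
  have cI: "real (card I) \<le> (real (n + l) + 1)\<^sup>2"
    using card_mono[OF _ I] by (simp add: power2_eq_square algebra_simps flip: of_nat_mult of_nat_add of_nat_Suc)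
  let ?F = "\<lambda>w. \<Sum>(i, j)\<in>I. of_bool (tpos (take i w) = tpos (take j w)) :: real"
  let ?G = "\<lambda>y. of_bool (\<forall>b<B. \<not> cut L (take (2 * L) (drop (b * (2 * L)) y))) :: real"
  have "of_bool (\<not> has_cut u y) \<le> ?F (u @ y) + ?G y" if "length u = n" "length y = l" for u y
  proof (cases "has_cut u y \<or> (\<forall>b<B. \<not> cut L (take (2 * L) (drop (b * (2 * L)) y)))")
    case True
    have "0 \<le> ?F (u @ y)" by (intro sum_nonneg) auto
    then show ?thesis using True by auto
  next
    case False
    then obtain b where b: "b < B" "cut L (take (2 * L) (drop (b * (2 * L)) y))" and nc: "\<not> has_cut u y"
      by blast
    have "length y = B * (2 * L)" using that by (simp add: l_def)
    note * = has_cut_from_block[OF this b, of u]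
    obtain i j where ij: "i + L \<le> j" "j \<le> length (u @ y)" "tpos (take i (u @ y)) = tpos (take j (u @ y))"
    proof (rule ccontr)
      assume "\<not> thesis"
      with that have "has_cut u y" by (intro *) metis
      with nc show False ..
    qed
    then have "(i, j) \<in> I" using that by (simp add: I_def)
    then have "(case (i, j) of (i, j) \<Rightarrow> of_bool (tpos (take i (u @ y)) = tpos (take j (u @ y)))) \<le> ?F (u @ y)"
      by (intro member_le_sum fI) auto
    then show ?thesis using ij(3) by simp
  qed
  then have "no_cut_prob n l \<le> avg n (\<lambda>u. avg l (\<lambda>y. ?F (u @ y) + ?G y))"
    unfolding no_cut_prob_def by (intro avg_mono) auto
  also have "\<dots> = avg (n + l) ?F + avg l ?G"
    by (simp only: avg_plus avg_add avg_const)
  also have "avg (n + l) ?F = (\<Sum>(i, j)\<in>I. avg (n + l) (\<lambda>w. of_bool (tpos (take i w) = tpos (take j w))))"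
    unfolding case_prod_beta by (rule avg_sum)
  also have "\<dots> \<le> (\<Sum>(i, j)\<in>I. kern L)"
  proof (rule sum_mono, clarify)
    fix i j assume "(i, j) \<in> I"
    then have ij: "i \<le> j" "j \<le> n + l" "L \<le> j - i" by (auto simp: I_def)
    show "avg (n + l) (\<lambda>w. of_bool (tpos (take i w) = tpos (take j w))) \<le> kern L"
      by (rule order_trans[OF avg_tpos_take_eq[OF d ij(1,2)] kern_antimono[OF ij(3)]])
  qed
  also have "\<dots> \<le> (real (n + l) + 1)\<^sup>2 * kern L"
    using cI by (simp add: mult_right_mono)
  finally show ?thesis
    using avg_no_block_cut[OF \<delta>, of B] unfolding l_def by linarith
qed

end

section \<open>Convergence of the eaten-cookie probability\<close>

text \<open>The limit of \<open>a\<close> is written as a telescoping series, the form in which it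
  can later be differentiated term by term.\<close>

lemma tail_sum_geometric:
  fixes a :: "nat \<Rightarrow> real"
  assumes "\<And>k. \<bar>a (Suc k) - a k\<bar> \<le> c * (1/2) ^ k"
  shows "summable (\<lambda>k. a (Suc k) - a k)"
    and "\<bar>a 0 + (\<Sum>k. a (Suc k) - a k) - a n\<bar> \<le> 2 * c * (1/2) ^ n"
proof -
  have g: "summable (\<lambda>k. c * (1/2) ^ (k + n))" for n
    by (intro summable_mult summable_ignore_initial_segment summable_geometric) simp
  show sm: "summable (\<lambda>k. a (Suc k) - a k)"
  proof (rule summable_comparison_test')
    show "summable (\<lambda>k. c * (1/2) ^ k)" using g[of 0] by simp
    show "norm (a (Suc k) - a k) \<le> c * (1/2) ^ k" if "k \<ge> 0" for k
      unfolding real_norm_def by (rule assms)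
  qed
  have "(\<Sum>k. a (Suc k) - a k) = (\<Sum>k. a (Suc (k + n)) - a (k + n)) + (\<Sum>k<n. a (Suc k) - a k)"
    using suminf_split_initial_segment[OF sm, of n] by simp
  then have "a 0 + (\<Sum>k. a (Suc k) - a k) - a n = (\<Sum>k. a (Suc (k + n)) - a (k + n))"
    by (simp add: sum_lessThan_telescope)
  moreover have "\<bar>\<Sum>k. a (Suc (k + n)) - a (k + n)\<bar> \<le> (\<Sum>k. c * (1/2) ^ (k + n))"
    using norm_suminf_le[of "\<lambda>k. a (Suc (k + n)) - a (k + n)" "\<lambda>k. c * (1/2) ^ (k + n)"] assms g by simp
  moreover have "(\<Sum>k. c * (1/2) ^ (k + n)) = 2 * c * (1/2) ^ n"
  proof -
    have "(\<lambda>k. (c * (1/2) ^ n) * (1/2) ^ k) sums ((c * (1/2) ^ n) * (1 / (1 - 1/2)))"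
      by (intro sums_mult geometric_sums) simp
    then show ?thesis by (simp add: sums_iff power_add mult_ac)
  qed
  ultimately show "\<bar>a 0 + (\<Sum>k. a (Suc k) - a k) - a n\<bar> \<le> 2 * c * (1/2) ^ n" by simp
qed

text \<open>Termwise differentiation. As \<open>c / (1 - x)\<close> is unbounded, the M-test runs on
  \<open>{0..b}\<close> with \<open>x < b < 1\<close>; near \<open>x\<close> this interval coincides
  with \<open>{0..<1}\<close>, which transfers the derivative. At \<open>x = 0\<close> it is the
  right derivative.\<close>

lemma has_real_derivative_geometric_limit:
  fixes f f' :: "nat \<Rightarrow> real \<Rightarrow> real"
  assumes f: "\<And>n x. (f n has_real_derivative f' n x) (at x)"
    and c: "0 \<le> c"
    and df: "\<And>n x. 0 \<le> x \<Longrightarrow> x < 1 \<Longrightarrow> \<bar>f (Suc n) x - f n x\<bar> \<le> c * (1/2) ^ n"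
    and df': "\<And>n x. 0 \<le> x \<Longrightarrow> x < 1 \<Longrightarrow> \<bar>f' (Suc n) x - f' n x\<bar> \<le> c / (1 - x) * (1/2) ^ n"
    and x: "0 \<le> x" "x < 1"
  shows "((\<lambda>x. f 0 x + (\<Sum>n. f (Suc n) x - f n x)) has_real_derivative
     f' 0 x + (\<Sum>n. f' (Suc n) x - f' n x)) (at x within {0..<1})"
proof -
  define b where "b = (1 + x) / 2"
  have b: "x < b" "b < 1" using x by (auto simp: b_def)
  let ?S = "{0..b}"
  have g: "summable (\<lambda>n. c / (1 - b) * (1/2) ^ n)" by (intro summable_mult summable_geometric) simp
  have ul: "uniform_limit ?S (\<lambda>n x. \<Sum>i<n. f' (Suc i) x - f' i x) (\<lambda>x. \<Sum>i. f' (Suc i) x - f' i x) sequentially"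
  proof (rule Weierstrass_m_test[OF _ g])
    fix n y assume y: "y \<in> ?S"
    have "\<bar>f' (Suc n) y - f' n y\<bar> \<le> c / (1 - y) * (1/2) ^ n" using df'[of y n] y b by auto
    also have "\<dots> \<le> c / (1 - b) * (1/2) ^ n"
      using y b c by (intro mult_right_mono divide_left_mono) auto
    finally show "norm (f' (Suc n) y - f' n y) \<le> c / (1 - b) * (1/2) ^ n" by simp
  qed
  have "\<exists>h. \<forall>y\<in>?S. (\<lambda>n. f (Suc n) y - f n y) sums h y \<and>
      (h has_field_derivative (\<Sum>i. f' (Suc i) y - f' i y)) (at y within ?S)"
  proof (rule has_field_derivative_series[OF _ _ ul, of _ x])
    show "((\<lambda>x. f (Suc n) x - f n x) has_field_derivative f' (Suc n) y - f' n y) (at y within ?S)" for n y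
      by (intro DERIV_diff has_field_derivative_at_within[OF f])
    show "summable (\<lambda>n. f (Suc n) x - f n x)"
      using df[OF x] by (rule tail_sum_geometric(1))
  qed (use x b in auto)
  then obtain h where h: "\<And>y. y \<in> ?S \<Longrightarrow> (\<lambda>n. f (Suc n) y - f n y) sums h y"
    "\<And>y. y \<in> ?S \<Longrightarrow> (h has_field_derivative (\<Sum>i. f' (Suc i) y - f' i y)) (at y within ?S)" by blast
  have "((\<lambda>x. f 0 x + h x) has_real_derivative f' 0 x + (\<Sum>n. f' (Suc n) x - f' n x)) (at x within ?S)"
    using x b by (intro DERIV_add has_field_derivative_at_within[OF f] h(2)) auto
  then have "((\<lambda>x. f 0 x + (\<Sum>n. f (Suc n) x - f n x)) has_real_derivative
      f' 0 x + (\<Sum>n. f' (Suc n) x - f' n x)) (at x within ?S)"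
    unfolding has_field_derivative_def
    by (rule has_derivative_transform[rotated 2]) (use x b h(1) in \<open>auto simp: sums_iff\<close>)
  moreover have "at x within ?S = at x within {0..<1}"
    by (rule at_within_nhd[of _ "{..<b}"]) (use b in auto)
  ultimately show ?thesis by simp
qed

text \<open>With \<open>\<sigma>\<close> the ninth root of \<open>\<rho>\<close> the expression is
  \<open>(n * \<sigma> ^ n) ^ 9\<close>, so the known limit of \<open>n * \<sigma> ^ n\<close>
  suffices.\<close>

lemma polynomial_geometric_bounded:
  fixes \<rho> :: real
  assumes "0 \<le> \<rho>" "\<rho> < 1"
  shows "\<exists>C\<ge>0. \<forall>n. real n ^ 9 * \<rho> ^ n \<le> C"
proof -
  define \<sigma> where "\<sigma> = root 9 \<rho>"
  have \<sigma>: "0 \<le> \<sigma>" "\<sigma> < 1" "\<sigma> ^ 9 = \<rho>" using assms by (auto simp: \<sigma>_def real_root_lt_1_iff)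
  have "(\<lambda>n. (real n * \<sigma> ^ n) ^ 9) \<longlonglongrightarrow> 0 ^ 9"
    using \<sigma> by (intro tendsto_power powser_times_n_limit_0) auto
  then have "Bseq (\<lambda>n. (real n * \<sigma> ^ n) ^ 9)" using convergent_imp_Bseq convergentI by blast
  then obtain C where C: "\<And>n. norm ((real n * \<sigma> ^ n) ^ 9) \<le> C" "C > 0" using BseqE by blast
  have "real n ^ 9 * \<rho> ^ n \<le> C" for n
    using C(1)[of n] \<sigma> by (simp add: power_mult_distrib mult.commute[of n] flip: power_mult \<sigma>(3))
  with C(2) show ?thesis by (intro exI[of _ C]) auto
qed

context excited_walk begin

text \<open>
  Blocks of half-length \<open>L = 2 ^ (14 * k)\<close>, and \<open>B = 2 ^ (2 * k)\<close> of them: with \<open>T\<close> of order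
  \<open>B * L = 2 ^ (16 * k)\<close> the bound \<open>T ^ 3 * L powr (-7/2)\<close> is of order \<open>2 ^ (48 * k - 49 * k)\<close>.
\<close>

definition scale :: "nat \<Rightarrow> nat" where
  "scale k = 2 ^ (2 * k) * (2 * 2 ^ (14 * k))"

lemma scale_eq: "scale k = 2 ^ (16 * k + 1)"
proof -
  have "(2::nat) ^ (16 * k + 1) = 2 * 2 ^ (2 * k + 14 * k)" by simp
  also have "\<dots> = scale k" unfolding scale_def power_add by (simp only: mult_ac)
  finally show ?thesis ..
qed

lemma kern_scale: "kern (2 ^ (14 * k)) \<le> real CARD('d) powr (7/2) / 2 ^ (49 * k)"
proof -
  have "kern (2 ^ (14 * k)) \<le> (real CARD('d) / 2 ^ (14 * k)) powr (7/2)"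
    unfolding kern_def by (intro powr_mono2 divide_left_mono mult_pos_pos) (auto intro: add_pos_pos)
  also have "\<dots> = real CARD('d) powr (7/2) / (2 ^ (14 * k)) powr (7/2)"
    by (simp add: powr_divide)
  also have "((2::real) ^ (14 * k)) powr (7/2) = (2 powr (real (14 * k))) powr (7/2)"
    by (subst powr_realpow) auto
  also have "\<dots> = 2 powr real (49 * k)" by (simp add: powr_powr)
  also have "\<dots> = 2 ^ (49 * k)" by (rule powr_realpow) simp
  finally show ?thesis .
qed

text \<open>Failure of all blocks decays faster than any power of their number; the rate
  \<open>2 ^ (- 17 * k)\<close> retained here beats the number of steps \<open>2 ^ (16 * k)\<close>
  by a factor \<open>2 ^ k\<close>.\<close>

lemma no_cut_prob_rate:
  assumes d: "CARD('d) \<ge> 8"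
  shows "\<exists>C\<ge>0. \<forall>k n. no_cut_prob n (scale k) \<le>
     C * ((real (n + scale k) + 1)\<^sup>2 / 2 ^ (49 * k) + 1 / 2 ^ (17 * k))"
proof -
  obtain K \<delta> where \<delta>: "0 < \<delta>" "\<And>L. L \<ge> K \<Longrightarrow> \<delta> \<le> avg (2 * L) (\<lambda>w. of_bool (cut L w))"
    using avg_cut_lower_bound[OF d] by blast
  have "\<delta> \<le> avg (2 * K) (\<lambda>_ :: ('d \<times> bool) list. 1)"
    by (rule order_trans[OF \<delta>(2)[OF order_refl]], rule avg_mono) auto
  then have "0 \<le> 1 - \<delta>" "1 - \<delta> < 1" using \<delta> by auto
  from polynomial_geometric_bounded[OF this]
  obtain C1 where C1: "C1 \<ge> 0" "\<And>n. real n ^ 9 * (1 - \<delta>) ^ n \<le> C1" by blast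
  define C2 where "C2 = real CARD('d) powr (7/2)"
  have C2: "C2 \<ge> 0" by (simp add: C2_def)
  define C where "C = C1 + C2 + 2 ^ (17 * K)"
  have "no_cut_prob n (scale k) \<le> C * ((real (n + scale k) + 1)\<^sup>2 / 2 ^ (49 * k) + 1 / 2 ^ (17 * k))" for n k
  proof (cases "K \<le> 2 ^ (14 * k)")
    case True
    have "(1 - \<delta>) ^ 2 ^ (2 * k) \<le> C1 / 2 ^ (17 * k)"
    proof -
      \<comment> \<open>Origin of the ninth power: with \<open>B = 2 ^ (2 * k)\<close> blocks,
        \<open>B ^ 9 = 2 ^ (18 * k)\<close> dominates \<open>2 ^ (17 * k)\<close>.\<close>
      have "(2::real) ^ (17 * k) \<le> 2 ^ (2 * k * 9)" by (intro power_increasing) auto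
      then have "2 ^ (17 * k) * (1 - \<delta>) ^ 2 ^ (2 * k) \<le> real (2 ^ (2 * k)) ^ 9 * (1 - \<delta>) ^ 2 ^ (2 * k)"
        using \<open>0 \<le> 1 - \<delta>\<close> by (intro mult_right_mono) (simp_all flip: power_mult)
      also have "\<dots> \<le> C1" by (rule C1)
      finally show ?thesis by (simp add: field_simps)
    qed
    moreover have "no_cut_prob n (scale k) \<le> (real (n + scale k) + 1)\<^sup>2 * kern (2 ^ (14 * k)) + (1 - \<delta>) ^ 2 ^ (2 * k)"
      unfolding scale_def by (rule no_cut_prob_le[OF d \<delta>(2)[OF True]])
    moreover have "(real (n + scale k) + 1)\<^sup>2 * kern (2 ^ (14 * k)) \<le> (real (n + scale k) + 1)\<^sup>2 * (C2 / 2 ^ (49 * k))"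
      unfolding C2_def by (intro mult_left_mono kern_scale) auto
    ultimately have "no_cut_prob n (scale k) \<le> C2 * ((real (n + scale k) + 1)\<^sup>2 / 2 ^ (49 * k)) + C1 * (1 / 2 ^ (17 * k))"
      by (simp add: mult.commute)
    also have "\<dots> \<le> C * ((real (n + scale k) + 1)\<^sup>2 / 2 ^ (49 * k)) + C * (1 / 2 ^ (17 * k))"
      using C1(1) C2 by (intro add_mono mult_right_mono) (auto simp: C_def)
    finally show ?thesis by (simp add: distrib_left)
  next
    case False
    \<comment> \<open>Blocks too short for the lower bound on cuts occur only for finitely many
      \<open>k\<close>; there a probability is at most 1, which the summand
      \<open>2 ^ (17 * K)\<close> of \<open>C\<close> absorbs.\<close>
    have "k \<le> K"
    proof (rule ccontr)
      assume "\<not> k \<le> K"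
      then have "K < k" by simp
      also have "k < 2 ^ k" by (rule less_exp)
      also have "(2::nat) ^ k \<le> 2 ^ (14 * k)" by (intro power_increasing) auto
      finally show False using False by simp
    qed
    then have "(2::real) ^ (17 * k) \<le> 2 ^ (17 * K)" by (intro power_increasing) auto
    then have "1 \<le> 2 ^ (17 * K) * (1 / 2 ^ (17 * k) :: real)" by (simp add: field_simps)
    also have "\<dots> \<le> C * ((real (n + scale k) + 1)\<^sup>2 / 2 ^ (49 * k) + 1 / 2 ^ (17 * k))"
      using C1(1) C2 by (intro mult_mono) (auto simp: C_def)
    finally show ?thesis using no_cut_prob_bounds(2)[of n "scale k"] by linarith
  qed
  then show ?thesis using C1(1) C2 by (intro exI[of _ C]) (auto simp: C_def)
qed

text \<open>The prefactor \<open>scale (Suc k)\<close> is the length of the longer path, the price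
  of one derivative in \<beta>.\<close>

lemma no_cut_prob_scale:
  assumes d: "CARD('d) \<ge> 8"
  shows "\<exists>C\<ge>0. \<forall>k. real (scale (Suc k)) * no_cut_prob (scale (Suc k) - scale k) (scale k) \<le> C * (1/2) ^ k"
proof -
  obtain C where C: "C \<ge> 0" "\<And>k n. no_cut_prob n (scale k) \<le>
     C * ((real (n + scale k) + 1)\<^sup>2 / 2 ^ (49 * k) + 1 / 2 ^ (17 * k))"
    using no_cut_prob_rate[OF d] by blast
  have "real (scale (Suc k)) * no_cut_prob (scale (Suc k) - scale k) (scale k) \<le> (C * (2 ^ 53 + 2 ^ 17)) * (1/2) ^ k" for k
  proof -
    define T where "T = real (scale (Suc k))"
    have "(2::nat) ^ (16 * k + 1) \<le> 2 ^ (16 * Suc k + 1)" by (intro power_increasing) auto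
    then have s: "scale (Suc k) - scale k + scale k = scale (Suc k)" by (simp add: scale_eq)
    have T: "T = 2 ^ 17 * 2 ^ (16 * k)" by (simp add: T_def scale_eq power_add)
    have T1: "1 \<le> T" by (simp add: T mult_ge1_I del: numeral_power_eq_of_nat_cancel_iff)
    have e: "(2::real) ^ (49 * k) = (2 ^ (16 * k)) ^ 3 * 2 ^ k" "(2::real) ^ (17 * k) = 2 ^ (16 * k) * 2 ^ k"
      by (simp_all flip: power_mult power_add)
    have "T * no_cut_prob (scale (Suc k) - scale k) (scale k) \<le> T * (C * ((T + 1)\<^sup>2 / 2 ^ (49 * k) + 1 / 2 ^ (17 * k)))"
      using C(2)[of "scale (Suc k) - scale k" k] T1 unfolding s T_def[symmetric] by (intro mult_left_mono) auto
    also have "\<dots> \<le> T * (C * ((2 * T)\<^sup>2 / 2 ^ (49 * k) + 1 / 2 ^ (17 * k)))"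
      using T1 C(1) by (intro mult_left_mono add_mono divide_right_mono power_mono) auto
    \<comment> \<open>With \<open>T = 2 ^ 17 * 2 ^ (16 * k)\<close>, the constant
      \<open>2 ^ 53\<close> is \<open>4 * (2 ^ 17) ^ 3\<close>.\<close>
    also have "\<dots> = (C * (2 ^ 53 + 2 ^ 17)) * (1/2) ^ k"
      unfolding e T by (simp add: field_simps power2_eq_square power3_eq_cube)
    finally show ?thesis unfolding T_def .
  qed
  then show ?thesis using C(1) by (intro exI[of _ "C * (2 ^ 53 + 2 ^ 17)"]) auto
qed

section \<open>Derivatives of path weights\<close>

definition dweight :: "nat \<Rightarrow> real \<Rightarrow> ('d \<times> bool) list \<Rightarrow> real" where
  "dweight m \<beta> w = deriv (\<lambda>\<beta>. weight m \<beta> w) \<beta>"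

lemma rate_nonneg: "\<bar>\<beta>\<bar> \<le> 1 \<Longrightarrow> 0 \<le> rate m \<beta> w s"
  by (auto simp: rate_def)

lemma weight_nonneg: "\<bar>\<beta>\<bar> \<le> 1 \<Longrightarrow> 0 \<le> weight m \<beta> w"
  unfolding weight_def by (intro prod_nonneg ballI rate_nonneg)

definition drate :: "nat \<Rightarrow> ('d \<times> bool) list \<Rightarrow> 'd \<times> bool \<Rightarrow> real" where
  "drate m w s = (if fst s = e1 \<and> visits w < m then (if snd s then 1 else -1) else 0) / (2 * CARD('d))"

lemma DERIV_rate: "((\<lambda>\<beta>. rate m \<beta> w s) has_real_derivative drate m w s) (at \<beta>)"
  unfolding rate_def drate_def by (auto intro!: derivative_eq_intros)

lemma DERIV_weight: "((\<lambda>\<beta>. weight m \<beta> w) has_real_derivative dweight m \<beta> w) (at \<beta>)"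
proof -
  have "\<exists>D. ((\<lambda>\<beta>. weight m \<beta> w) has_real_derivative D) (at \<beta>)"
  proof (induction w rule: rev_induct)
    case Nil
    show ?case by (auto intro!: exI derivative_eq_intros)
  next
    case (snoc s w)
    then show ?case unfolding weight_snoc using DERIV_mult DERIV_rate by blast
  qed
  then show ?thesis unfolding dweight_def using DERIV_imp_deriv by fastforce
qed

lemma dweight_snoc: "dweight m \<beta> (w @ [s]) = dweight m \<beta> w * rate m \<beta> w s + drate m w s * weight m \<beta> w"
  using DERIV_mult[OF DERIV_weight[of m w \<beta>] DERIV_rate[of m w s \<beta>]]
  unfolding dweight_def[of m \<beta> "w @ [s]"] weight_snoc by (rule DERIV_imp_deriv)

text \<open>The extreme case is a cookie step against the drift, with rate proportional to
  \<open>1 - \<beta>\<close>. This is the origin of all factors \<open>1 / (1 - \<beta>)\<close>,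
  and hence of the restriction to compact subsets of \<open>[0,1)\<close>.\<close>

lemma abs_drate_le:
  assumes "0 \<le> \<beta>" "\<beta> < 1"
  shows "\<bar>drate m w s\<bar> \<le> rate m \<beta> w s / (1 - \<beta>)"
proof -
  have "1 \<le> (1 + \<beta>) / (1 - \<beta>)" using assms by (simp add: field_simps)
  then show ?thesis
    using assms by (auto simp: rate_def drate_def divide_simps)
qed

text \<open>The product rule yields one term per step. The bound is a multiple of the weight itself,
  so derivatives of sums over an event are controlled by its probability.\<close>

lemma abs_dweight_le:
  assumes "0 \<le> \<beta>" "\<beta> < 1"
  shows "\<bar>dweight m \<beta> w\<bar> \<le> real (length w) / (1 - \<beta>) * weight m \<beta> w"
proof (induction w rule: rev_induct)
  case Nil
  show ?case by (simp add: dweight_def)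
next
  case (snoc s w)
  have r: "0 \<le> rate m \<beta> w s" "0 \<le> weight m \<beta> w"
    using assms by (auto intro: rate_nonneg weight_nonneg)
  have "\<bar>dweight m \<beta> (w @ [s])\<bar> \<le> \<bar>dweight m \<beta> w\<bar> * rate m \<beta> w s + \<bar>drate m w s\<bar> * weight m \<beta> w"
    unfolding dweight_snoc using r by (intro order_trans[OF abs_triangle_ineq]) (simp add: abs_mult)
  also have "\<dots> \<le> (real (length w) / (1 - \<beta>) * weight m \<beta> w) * rate m \<beta> w s +
      (rate m \<beta> w s / (1 - \<beta>)) * weight m \<beta> w"
    by (intro add_mono mult_right_mono snoc abs_drate_le assms r)
  also have "\<dots> = real (length (w @ [s])) / (1 - \<beta>) * weight m \<beta> (w @ [s])"
    by (simp add: weight_snoc add_divide_distrib algebra_simps)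
  finally show ?case .
qed

section \<open>Decorrelation of the eaten-cookie event\<close>

definition eaten_prob :: "nat \<Rightarrow> nat \<Rightarrow> real \<Rightarrow> real" where
  "eaten_prob m n \<beta> = (\<Sum>w\<in>Ls n. eaten m w * weight m \<beta> w)"

definition deaten_prob :: "nat \<Rightarrow> nat \<Rightarrow> real \<Rightarrow> real" where
  "deaten_prob m n \<beta> = (\<Sum>w\<in>Ls n. eaten m w * dweight m \<beta> w)"

lemma DERIV_eaten_prob: "(eaten_prob m n has_real_derivative deaten_prob m n \<beta>) (at \<beta>)"
  unfolding eaten_prob_def[abs_def] deaten_prob_def
  by (intro DERIV_sum DERIV_cmult DERIV_weight)

lemma eaten_bounds: "0 \<le> eaten m w" "eaten m w \<le> 1"
  by (auto simp: eaten_def)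

lemma has_cut_map_hid: "has_cut u (map hid y) = has_cut u y" "has_cut (map hid u) y = has_cut u y"
  using cut_map_hid[of _ u y "[]"] cut_map_hid[of _ "[]" u y] by (simp_all add: has_cut_def)

text \<open>The second sum describes \<open>u\<close> followed by an independent fresh walk. Absence
  of a cut is a transversal event, so both laws give it the probability that it has for the simple
  random walk.\<close>

lemma sum_no_cut_weight:
  "(\<Sum>u\<in>Ls n. \<Sum>y\<in>Ls l. of_bool (\<not> has_cut u y) * weight m \<beta> (u @ y)) = no_cut_prob n l"
  "(\<Sum>u\<in>Ls n. \<Sum>y\<in>Ls l. of_bool (\<not> has_cut u y) * (weight m \<beta> u * weight m \<beta> y)) = no_cut_prob n l"
proof -
  let ?A = "\<lambda>u. avg l (\<lambda>y. of_bool (\<not> has_cut u y))"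
  have 1: "(\<Sum>y\<in>Ls l. of_bool (\<not> has_cut u y) * weight m \<beta> (v @ y)) = weight m \<beta> v * ?A u" for u v
    using sum_weight_hid[of "\<lambda>y. of_bool (\<not> has_cut u y)" m \<beta> v l] by (simp add: has_cut_map_hid avg_def mult.commute)
  have 2: "(\<Sum>u\<in>Ls n. weight m \<beta> u * ?A u) = no_cut_prob n l"
    using sum_weight_hid[of ?A m \<beta> "[]" n] by (simp add: has_cut_map_hid avg_def[of n] no_cut_prob_def mult.commute)
  show "(\<Sum>u\<in>Ls n. \<Sum>y\<in>Ls l. of_bool (\<not> has_cut u y) * weight m \<beta> (u @ y)) = no_cut_prob n l"
    unfolding 1 2 ..
  have "(\<Sum>y\<in>Ls l. of_bool (\<not> has_cut u y) * (weight m \<beta> u * weight m \<beta> y)) = weight m \<beta> u * ?A u" for u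
    using 1[of u "[]"] by (simp add: mult.left_commute flip: sum_distrib_left)
  then show "(\<Sum>u\<in>Ls n. \<Sum>y\<in>Ls l. of_bool (\<not> has_cut u y) * (weight m \<beta> u * weight m \<beta> y)) = no_cut_prob n l"
    using 2 by simp
qed

lemma sum_eaten_diff:
  "(\<Sum>y\<in>Ls l. eaten m (u @ y) * weight m \<beta> (u @ y)) - weight m \<beta> u * eaten_prob m l \<beta> =
   (\<Sum>y\<in>Ls l. of_bool (\<not> has_cut u y) *
      (eaten m (u @ y) * weight m \<beta> (u @ y) - weight m \<beta> u * eaten m y * weight m \<beta> y))"
proof -
  let ?d = "\<lambda>y. eaten m (u @ y) * weight m \<beta> (u @ y) - weight m \<beta> u * eaten m y * weight m \<beta> y"
  have "(\<Sum>y\<in>Ls l. ?d y) = (\<Sum>y\<in>Ls l. of_bool (has_cut u y) * ?d y + of_bool (\<not> has_cut u y) * ?d y)"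
    by (intro sum.cong) auto
  then have "(\<Sum>y\<in>Ls l. ?d y) = (\<Sum>y\<in>Ls l. of_bool (\<not> has_cut u y) * ?d y)"
    by (simp only: sum.distrib decouple add_0)
  then show ?thesis
    by (simp add: sum_subtractf eaten_prob_def sum_distrib_left mult.assoc)
qed

text \<open>Decoupling holds for each fixed past \<open>u\<close>, so any bounded function
  \<open>G\<close> of the past may be inserted: \<open>G = 1\<close> compares
  \<open>eaten_prob\<close> at two times, a centred step gives the correlations for the law of large
  numbers.\<close>

lemma eaten_decorrelation:
  assumes b: "\<bar>\<beta>\<bar> \<le> 1" and G: "\<And>u. length u = n \<Longrightarrow> \<bar>G u\<bar> \<le> c"
  shows "\<bar>(\<Sum>u\<in>Ls n. G u * ((\<Sum>y\<in>Ls l. eaten m (u @ y) * weight m \<beta> (u @ y)) - weight m \<beta> u * eaten_prob m l \<beta>))\<bar>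
     \<le> 2 * c * no_cut_prob n l"
proof -
  note w = weight_nonneg[OF b]
  let ?b = "\<lambda>u y. of_bool (\<not> has_cut u y) * weight m \<beta> (u @ y) + of_bool (\<not> has_cut u y) * (weight m \<beta> u * weight m \<beta> y)"
  have "\<bar>(\<Sum>u\<in>Ls n. G u * ((\<Sum>y\<in>Ls l. eaten m (u @ y) * weight m \<beta> (u @ y)) - weight m \<beta> u * eaten_prob m l \<beta>))\<bar> \<le>
     (\<Sum>u\<in>Ls n. c * (\<Sum>y\<in>Ls l. ?b u y))"
    unfolding sum_eaten_diff
  proof (intro order_trans[OF sum_abs] sum_mono)
    fix u :: "('d \<times> bool) list" assume "u \<in> Ls n"
    then have Gu: "\<bar>G u\<bar> \<le> c" using G by simp
    have "\<bar>\<Sum>y\<in>Ls l. of_bool (\<not> has_cut u y) *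
      (eaten m (u @ y) * weight m \<beta> (u @ y) - weight m \<beta> u * eaten m y * weight m \<beta> y)\<bar> \<le> (\<Sum>y\<in>Ls l. ?b u y)"
    proof (intro order_trans[OF sum_abs] sum_mono)
      fix y
      have "eaten m (u @ y) * weight m \<beta> (u @ y) \<le> weight m \<beta> (u @ y)"
        "0 \<le> eaten m (u @ y) * weight m \<beta> (u @ y)"
        "weight m \<beta> u * eaten m y * weight m \<beta> y \<le> weight m \<beta> u * weight m \<beta> y"
        "0 \<le> weight m \<beta> u * eaten m y * weight m \<beta> y"
        using w by (auto simp: eaten_def)
      then show "\<bar>of_bool (\<not> has_cut u y) * (eaten m (u @ y) * weight m \<beta> (u @ y) -
          weight m \<beta> u * eaten m y * weight m \<beta> y)\<bar> \<le> ?b u y"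
        by (cases "has_cut u y") auto
    qed
    then show "\<bar>G u * (\<Sum>y\<in>Ls l. of_bool (\<not> has_cut u y) *
      (eaten m (u @ y) * weight m \<beta> (u @ y) - weight m \<beta> u * eaten m y * weight m \<beta> y))\<bar> \<le> c * (\<Sum>y\<in>Ls l. ?b u y)"
      unfolding abs_mult using Gu by (intro mult_mono) auto
  qed
  also have "\<dots> = c * (no_cut_prob n l + no_cut_prob n l)"
    by (simp only: sum.distrib sum_no_cut_weight flip: sum_distrib_left)
  finally show ?thesis by simp
qed

lemma eaten_prob_add:
  "eaten_prob m (n + l) \<beta> - eaten_prob m l \<beta> =
     (\<Sum>u\<in>Ls n. (\<Sum>y\<in>Ls l. eaten m (u @ y) * weight m \<beta> (u @ y)) - weight m \<beta> u * eaten_prob m l \<beta>)"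
  using sum_weight[of m \<beta> "[]" n]
  by (simp add: eaten_prob_def[of m "n + l"] sum_Ls_add sum_subtractf flip: sum_distrib_right)

lemma eaten_prob_diff_le:
  assumes "\<bar>\<beta>\<bar> \<le> 1"
  shows "\<bar>eaten_prob m (n + l) \<beta> - eaten_prob m l \<beta>\<bar> \<le> 2 * no_cut_prob n l"
  using eaten_decorrelation[OF assms, of n "\<lambda>_. 1" 1 m l] by (simp add: eaten_prob_add)

text \<open>The difference of the two probabilities equals a sum over words without a cut, and the
  cut condition does not involve \<beta>. So this identity can be differentiated first and estimated
  term by term afterwards.\<close>

lemma deaten_prob_diff_le:
  assumes b: "0 \<le> \<beta>" "\<beta> < 1"
  shows "\<bar>deaten_prob m (n + l) \<beta> - deaten_prob m l \<beta>\<bar> \<le> 2 * (real (n + l) / (1 - \<beta>)) * no_cut_prob n l"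
proof -
  have w: "0 \<le> weight m \<beta> w" for w using b by (intro weight_nonneg) simp
  let ?R = "\<lambda>\<beta>. \<Sum>u\<in>Ls n. \<Sum>y\<in>Ls l. of_bool (\<not> has_cut u y) *
      (eaten m (u @ y) * weight m \<beta> (u @ y) - weight m \<beta> u * eaten m y * weight m \<beta> y)"
  let ?d = "\<lambda>u y. eaten m (u @ y) * dweight m \<beta> (u @ y) -
     eaten m y * (dweight m \<beta> u * weight m \<beta> y + dweight m \<beta> y * weight m \<beta> u)"
  let ?D = "\<Sum>u\<in>Ls n. \<Sum>y\<in>Ls l. of_bool (\<not> has_cut u y) * ?d u y"
  have "((\<lambda>\<beta>. eaten m y * (weight m \<beta> u * weight m \<beta> y)) has_real_derivative
      eaten m y * (dweight m \<beta> u * weight m \<beta> y + dweight m \<beta> y * weight m \<beta> u)) (at \<beta>)" for u y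
    by (intro DERIV_cmult DERIV_mult DERIV_weight)
  then have "((\<lambda>\<beta>. weight m \<beta> u * eaten m y * weight m \<beta> y) has_real_derivative
      eaten m y * (dweight m \<beta> u * weight m \<beta> y + dweight m \<beta> y * weight m \<beta> u)) (at \<beta>)" for u y
    by (simp only: mult.assoc mult.left_commute[of "weight m _ u" "eaten m y"])
  then have R: "(?R has_real_derivative ?D) (at \<beta>)"
    by (intro DERIV_sum DERIV_cmult DERIV_diff DERIV_weight) auto
  have "?R = (\<lambda>\<beta>. eaten_prob m (n + l) \<beta> - eaten_prob m l \<beta>)"
    unfolding eaten_prob_add sum_eaten_diff ..
  with R have "((\<lambda>\<beta>. eaten_prob m (n + l) \<beta> - eaten_prob m l \<beta>) has_real_derivative ?D) (at \<beta>)"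
    by (simp only:)
  note DERIV_unique[OF DERIV_diff[OF DERIV_eaten_prob DERIV_eaten_prob] this]
  moreover define c where "c = real (n + l) / (1 - \<beta>)"
  have "\<bar>?D\<bar> \<le> (\<Sum>u\<in>Ls n. \<Sum>y\<in>Ls l. c * (of_bool (\<not> has_cut u y) * weight m \<beta> (u @ y)) +
      c * (of_bool (\<not> has_cut u y) * (weight m \<beta> u * weight m \<beta> y)))"
  proof (intro order_trans[OF sum_abs] sum_mono)
    fix u y :: "('d \<times> bool) list" assume u: "u \<in> Ls n" and y: "y \<in> Ls l"
    have e: "\<bar>eaten m x * z\<bar> \<le> \<bar>z\<bar>" for x z by (auto simp: eaten_def)
    have 1: "\<bar>dweight m \<beta> (u @ y)\<bar> \<le> c * weight m \<beta> (u @ y)"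
      using abs_dweight_le[OF b, of m "u @ y"] u y by (simp add: c_def)
    have "\<bar>dweight m \<beta> u * weight m \<beta> y + dweight m \<beta> y * weight m \<beta> u\<bar> \<le>
       \<bar>dweight m \<beta> u\<bar> * weight m \<beta> y + \<bar>dweight m \<beta> y\<bar> * weight m \<beta> u"
      using w by (intro order_trans[OF abs_triangle_ineq]) (simp add: abs_mult)
    also have "\<dots> \<le> real n / (1 - \<beta>) * weight m \<beta> u * weight m \<beta> y + real l / (1 - \<beta>) * weight m \<beta> y * weight m \<beta> u"
      using abs_dweight_le[OF b, of m u] abs_dweight_le[OF b, of m y] u y w by (intro add_mono mult_right_mono) auto
    also have "\<dots> = c * (weight m \<beta> u * weight m \<beta> y)"
      by (simp add: c_def add_divide_distrib algebra_simps)
    finally have 2: "\<bar>dweight m \<beta> u * weight m \<beta> y + dweight m \<beta> y * weight m \<beta> u\<bar> \<le> c * (weight m \<beta> u * weight m \<beta> y)" .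
    have "\<bar>?d u y\<bar> \<le> \<bar>dweight m \<beta> (u @ y)\<bar> + \<bar>dweight m \<beta> u * weight m \<beta> y + dweight m \<beta> y * weight m \<beta> u\<bar>"
      by (intro order_trans[OF abs_triangle_ineq4] add_mono e)
    then have "\<bar>?d u y\<bar> \<le> c * weight m \<beta> (u @ y) + c * (weight m \<beta> u * weight m \<beta> y)"
      using 1 2 by linarith
    then show "\<bar>of_bool (\<not> has_cut u y) * ?d u y\<bar> \<le> c * (of_bool (\<not> has_cut u y) * weight m \<beta> (u @ y)) +
      c * (of_bool (\<not> has_cut u y) * (weight m \<beta> u * weight m \<beta> y))"
      by (cases "has_cut u y") auto
  qed
  moreover have "\<dots> = 2 * c * no_cut_prob n l"
    by (simp only: sum.distrib sum_no_cut_weight flip: sum_distrib_left)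
  ultimately show ?thesis unfolding c_def by simp
qed

text \<open>This is where \<open>m\<close> enters the asymptotics: for \<open>m > scale k\<close>,
  \<open>eaten_lim\<close> and \<open>deaten_lim\<close> reduce to their approximation errors at
  scale \<open>k\<close>.\<close>

lemma eaten_prob_eq_0:
  assumes "n < m" shows "eaten_prob m n \<beta> = 0" "deaten_prob m n \<beta> = 0"
proof -
  have "eaten m w = 0" if "length w = n" for w
  proof -
    have "visits w \<le> card {..<length w}" unfolding visits_def by (intro card_mono) auto
    then show ?thesis using that assms by (simp add: eaten_def)
  qed
  then show "eaten_prob m n \<beta> = 0" "deaten_prob m n \<beta> = 0"
    by (auto simp: eaten_prob_def deaten_prob_def intro!: sum.neutral)
qed

definition eaten_lim :: "nat \<Rightarrow> real \<Rightarrow> real" where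
  "eaten_lim m \<beta> = eaten_prob m (scale 0) \<beta> +
     (\<Sum>k. eaten_prob m (scale (Suc k)) \<beta> - eaten_prob m (scale k) \<beta>)"

definition deaten_lim :: "nat \<Rightarrow> real \<Rightarrow> real" where
  "deaten_lim m \<beta> = deaten_prob m (scale 0) \<beta> +
     (\<Sum>k. deaten_prob m (scale (Suc k)) \<beta> - deaten_prob m (scale k) \<beta>)"

text \<open>A single \<open>C\<close> serves all \<open>m\<close>, \<open>k\<close> and \<beta>,
  because \<open>no_cut_prob\<close> depends on neither \<open>m\<close> nor \<beta>. One factor 2
  comes from the decorrelation, another from the geometric tail.\<close>

lemma eaten_lim:
  assumes d: "CARD('d) \<ge> 8"
  obtains C where "C \<ge> 0"
    "\<And>m \<beta>. 0 \<le> \<beta> \<Longrightarrow> \<beta> < 1 \<Longrightarrow> (eaten_lim m has_real_derivative deaten_lim m \<beta>) (at \<beta> within {0..<1})"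
    "\<And>m k \<beta>. 0 \<le> \<beta> \<Longrightarrow> \<beta> < 1 \<Longrightarrow> \<bar>eaten_lim m \<beta> - eaten_prob m (scale k) \<beta>\<bar> \<le> C * (1/2) ^ k"
    "\<And>m k \<beta>. 0 \<le> \<beta> \<Longrightarrow> \<beta> < 1 \<Longrightarrow> \<bar>deaten_lim m \<beta> - deaten_prob m (scale k) \<beta>\<bar> \<le> C / (1 - \<beta>) * (1/2) ^ k"
proof -
  obtain C where C: "C \<ge> 0"
    "\<And>k. real (scale (Suc k)) * no_cut_prob (scale (Suc k) - scale k) (scale k) \<le> C * (1/2) ^ k"
    using no_cut_prob_scale[OF d] by blast
  have s: "scale (Suc k) - scale k + scale k = scale (Suc k)" for k
  proof -
    have "(2::nat) ^ (16 * k + 1) \<le> 2 ^ (16 * Suc k + 1)" by (intro power_increasing) auto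
    then show ?thesis by (simp add: scale_eq)
  qed
  have 1: "\<bar>eaten_prob m (scale (Suc k)) \<beta> - eaten_prob m (scale k) \<beta>\<bar> \<le> 2 * C * (1/2) ^ k"
    if "0 \<le> \<beta>" "\<beta> < 1" for m k \<beta>
  proof -
    have "\<bar>eaten_prob m (scale (Suc k)) \<beta> - eaten_prob m (scale k) \<beta>\<bar> \<le> 2 * no_cut_prob (scale (Suc k) - scale k) (scale k)"
      using eaten_prob_diff_le[of \<beta> m "scale (Suc k) - scale k" "scale k"] that s by simp
    also have "\<dots> \<le> 2 * (real (scale (Suc k)) * no_cut_prob (scale (Suc k) - scale k) (scale k))"
    proof -
      have "1 \<le> real (scale (Suc k))" unfolding scale_eq by simp
      from mult_right_mono[OF this no_cut_prob_bounds(1)] show ?thesis by simp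
    qed
    finally show ?thesis using C(2)[of k] by simp
  qed
  have 2: "\<bar>deaten_prob m (scale (Suc k)) \<beta> - deaten_prob m (scale k) \<beta>\<bar> \<le> 2 * C / (1 - \<beta>) * (1/2) ^ k"
    if "0 \<le> \<beta>" "\<beta> < 1" for m k \<beta>
  proof -
    have "\<bar>deaten_prob m (scale (Suc k)) \<beta> - deaten_prob m (scale k) \<beta>\<bar> \<le>
       2 / (1 - \<beta>) * (real (scale (Suc k)) * no_cut_prob (scale (Suc k) - scale k) (scale k))"
      using deaten_prob_diff_le[OF that, of m "scale (Suc k) - scale k" "scale k"] unfolding s
      by (simp add: mult_ac)
    also have "\<dots> \<le> 2 / (1 - \<beta>) * (C * (1/2) ^ k)"
      using that by (intro mult_left_mono C(2)) auto
    finally show ?thesis by (simp add: mult_ac)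
  qed
  show thesis
  proof (rule that[of "4 * C"])
    show "4 * C \<ge> 0" using C(1) by simp
    fix m k and \<beta> :: real assume b: "0 \<le> \<beta>" "\<beta> < 1"
    show "(eaten_lim m has_real_derivative deaten_lim m \<beta>) (at \<beta> within {0..<1})"
      unfolding eaten_lim_def[abs_def] deaten_lim_def
      using has_real_derivative_geometric_limit[of "\<lambda>k. eaten_prob m (scale k)" "\<lambda>k. deaten_prob m (scale k)"
          "2 * C" \<beta>] DERIV_eaten_prob C(1) 1 2 b by simp
    show "\<bar>eaten_lim m \<beta> - eaten_prob m (scale k) \<beta>\<bar> \<le> 4 * C * (1/2) ^ k"
      unfolding eaten_lim_def using tail_sum_geometric(2)[of "\<lambda>k. eaten_prob m (scale k) \<beta>" "2 * C" k, OF 1[OF b]] by simp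
    show "\<bar>deaten_lim m \<beta> - deaten_prob m (scale k) \<beta>\<bar> \<le> 4 * C / (1 - \<beta>) * (1/2) ^ k"
      unfolding deaten_lim_def using tail_sum_geometric(2)[of "\<lambda>k. deaten_prob m (scale k) \<beta>" "2 * C / (1 - \<beta>)" k, OF 2[OF b]]
      by (simp add: mult_ac)
  qed
qed

end

section \<open>Law of large numbers\<close>

text \<open>Between \<open>r ^ p\<close> and \<open>(r + 1) ^ p\<close> the sequence changes by at
  most \<open>b\<close> times the gap, which is negligible against \<open>r ^ p\<close>.\<close>

lemma bounded_increment_interpolation:
  fixes s :: "nat \<Rightarrow> real"
  assumes inc: "\<And>n. \<bar>s (Suc n) - s n\<bar> \<le> b" and p: "p > 0"
    and lim: "(\<lambda>r. s (r ^ p) / real r ^ p) \<longlonglongrightarrow> 0"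
  shows "(\<lambda>n. s n / real n) \<longlonglongrightarrow> 0"
proof -
  define r where "r n = nat \<lfloor>root p (real n)\<rfloor>" for n
  have r1: "real (r n) ^ p \<le> real n" for n
  proof -
    have "real (r n) \<le> root p (real n)" unfolding r_def by (rule of_nat_floor) (use p in simp)
    then have "real (r n) ^ p \<le> root p (real n) ^ p" by (rule power_mono) simp
    then show ?thesis using p by simp
  qed
  have r2: "real n \<le> (real (r n) + 1) ^ p" for n
  proof -
    have "root p (real n) \<le> real (r n) + 1" by (simp add: r_def) linarith
    then have "root p (real n) ^ p \<le> (real (r n) + 1) ^ p" by (rule power_mono) (use p in simp)
    then show ?thesis using p by simp
  qed
  have r_lim: "filterlim r at_top sequentially"
    unfolding filterlim_at_top
  proof
    fix Z
    show "\<forall>\<^sub>F n in sequentially. Z \<le> r n"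
      unfolding eventually_sequentially
    proof (intro exI allI impI)
      fix n assume "Z ^ p \<le> n"
      then have "root p (real (Z ^ p)) \<le> root p (real n)" using p by (intro real_root_le_mono) auto
      then have "real Z \<le> root p (real n)" using p by (simp add: real_root_power_cancel)
      then show "Z \<le> r n" unfolding r_def by (simp add: le_nat_floor)
    qed
  qed
  have b: "0 \<le> b" using inc[of 0] by linarith
  have diff: "\<bar>s (k + n) - s k\<bar> \<le> b * real n" for k n
  proof (induction n)
    case (Suc n)
    have "b * real (Suc n) = b * real n + b" by (simp add: algebra_simps)
    then show ?case using Suc inc[of "k + n"] by simp
  qed simp
  have le: "\<bar>s n / real n\<bar> \<le> \<bar>s (r n ^ p) / real (r n) ^ p\<bar> + b * ((1 + 1 / real (r n)) ^ p - 1)"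
    if "r n > 0" for n
  proof -
    define R where "R = real (r n) ^ p"
    have R: "R > 0" "R \<le> real n" using that r1[of n] by (auto simp: R_def)
    have Rn: "r n ^ p \<le> n" using r1[of n] by (metis of_nat_le_iff of_nat_power)
    have "\<bar>s n - s (r n ^ p)\<bar> \<le> b * (real n - R)"
      using diff[of "r n ^ p" "n - r n ^ p"] Rn by (simp add: of_nat_diff R_def)
    then have "\<bar>s n\<bar> \<le> \<bar>s (r n ^ p)\<bar> + b * (real n - R)" by linarith
    moreover have "(real (r n) + 1) ^ p = R * (1 + 1 / real (r n)) ^ p"
      using that unfolding R_def by (simp add: field_simps flip: power_mult_distrib)
    then have "b * (real n - R) \<le> b * (R * ((1 + 1 / real (r n)) ^ p - 1))"
      using r2[of n] b by (intro mult_left_mono) (auto simp: algebra_simps)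
    ultimately have "\<bar>s n\<bar> \<le> \<bar>s (r n ^ p)\<bar> + b * (R * ((1 + 1 / real (r n)) ^ p - 1))" by linarith
    then have "\<bar>s n\<bar> / R \<le> (\<bar>s (r n ^ p)\<bar> + b * (R * ((1 + 1 / real (r n)) ^ p - 1))) / R"
      using R by (intro divide_right_mono) auto
    moreover have "\<bar>s n\<bar> / real n \<le> \<bar>s n\<bar> / R" using R by (intro divide_left_mono) auto
    moreover have "(a + b * (R * e)) / R = a / R + b * e" for a e using R by (simp add: field_simps)
    ultimately have "\<bar>s n\<bar> / real n \<le> \<bar>s (r n ^ p)\<bar> / R + b * ((1 + 1 / real (r n)) ^ p - 1)"
      by (simp only:)
    then show ?thesis using R by (simp only: abs_divide R_def abs_of_nonneg of_nat_0_le_iff zero_le_power)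
  qed
  have "(\<lambda>n. \<bar>s (n ^ p) / real n ^ p\<bar> + b * ((1 + 1 / real n) ^ p - 1)) \<longlonglongrightarrow> \<bar>0\<bar> + b * ((1 + 0) ^ p - 1)"
    by (intro tendsto_intros lim lim_1_over_n)
  then have *: "(\<lambda>n. \<bar>s (n ^ p) / real n ^ p\<bar> + b * ((1 + 1 / real n) ^ p - 1)) \<longlonglongrightarrow> 0" by simp
  have "(\<lambda>n. \<bar>s (r n ^ p) / real (r n) ^ p\<bar> + b * ((1 + 1 / real (r n)) ^ p - 1)) \<longlonglongrightarrow> 0"
    by (rule filterlim_compose[OF * r_lim])
  moreover have "\<forall>\<^sub>F n in sequentially. r n > 0"
    using r_lim unfolding filterlim_at_top by (auto elim!: allE[of _ 1] elim: eventually_mono)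
  then have "\<forall>\<^sub>F n in sequentially. norm (s n / real n) \<le>
      \<bar>s (r n ^ p) / real (r n) ^ p\<bar> + b * ((1 + 1 / real (r n)) ^ p - 1)"
    by eventually_elim (use le in simp)
  ultimately show ?thesis by (rule Lim_null_comparison[rotated])
qed

text \<open>The sum of all \<open>(Z r x)\<^sup>2\<close> has finite expectation, hence is finite
  almost everywhere, and its terms tend to 0.\<close>

lemma AE_tendsto_0_from_second_moments:
  fixes Z :: "nat \<Rightarrow> 'a \<Rightarrow> real"
  assumes [measurable]: "\<And>r. Z r \<in> borel_measurable M"
    and le: "\<And>r. (\<integral>\<^sup>+x. ennreal ((Z r x)\<^sup>2) \<partial>M) \<le> ennreal (c r)" and c: "summable c" "\<And>r. 0 \<le> c r"
  shows "AE x in M. (\<lambda>r. Z r x) \<longlonglongrightarrow> 0"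
proof -
  have "(\<integral>\<^sup>+x. (\<Sum>r. ennreal ((Z r x)\<^sup>2)) \<partial>M) = (\<Sum>r. \<integral>\<^sup>+x. ennreal ((Z r x)\<^sup>2) \<partial>M)"
    by (rule nn_integral_suminf) simp
  also have "\<dots> \<le> (\<Sum>r. ennreal (c r))"
    by (intro suminf_le le) auto
  also have "\<dots> < \<infinity>" using c by (simp add: suminf_ennreal2)
  finally have "AE x in M. (\<Sum>r. ennreal ((Z r x)\<^sup>2)) \<noteq> \<infinity>"
    by (intro nn_integral_PInf_AE) auto
  then show ?thesis
  proof eventually_elim
    case (elim x)
    then have "summable (\<lambda>r. (Z r x)\<^sup>2)" by (intro summable_suminf_not_top) auto
    then have "(\<lambda>r. (Z r x)\<^sup>2) \<longlonglongrightarrow> 0" by (rule summable_LIMSEQ_zero)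
    then have "(\<lambda>r. sqrt ((Z r x)\<^sup>2)) \<longlonglongrightarrow> sqrt 0" by (rule tendsto_real_sqrt)
    then show ?case by (simp add: tendsto_rabs_zero_iff)
  qed
qed

context excited_walk begin

section \<open>Second moment of the displacement\<close>

definition sgn1 :: "'d \<times> bool \<Rightarrow> real" where
  "sgn1 s = (if fst s = e1 then (if snd s then 1 else -1) else 0)"

lemma dir_nth_e1: "real_of_int (dir s $ e1) = sgn1 s"
  by (simp add: dir_def sgn1_def axis_def)

lemma pos_nth_e1: "real_of_int (pos w $ e1) = (\<Sum>k<length w. sgn1 (w ! k))"
proof (induction w rule: rev_induct)
  case (snoc s w)
  have "(\<Sum>k<length w. sgn1 ((w @ [s]) ! k)) = (\<Sum>k<length w. sgn1 (w ! k))"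
    by (intro sum.cong) (auto simp: nth_append)
  then show ?case using snoc by (simp add: pos_def dir_nth_e1)
qed simp

lemma abs_sgn1_le: "\<bar>sgn1 s\<bar> \<le> 1"
  by (simp add: sgn1_def)

lemma div_card_le_1: "\<beta> \<le> 1 \<Longrightarrow> \<beta> / real CARD('d) \<le> 1"
proof -
  have "1 \<le> real CARD('d)" using zero_less_card_finite[where 'a = 'd] by linarith
  moreover assume "\<beta> \<le> 1"
  ultimately have "\<beta> \<le> 1 * real CARD('d)" by linarith
  then show ?thesis by (subst pos_divide_le_eq) auto
qed

lemma sum_rate: "(\<Sum>s\<in>UNIV. rate m \<beta> w s) = 1"
  using sum_rate_hid[of "\<lambda>_. 1" m \<beta> w] by simp

lemma sum_rate_sgn1: "(\<Sum>s\<in>UNIV. rate m \<beta> w s * sgn1 s) = \<beta> / CARD('d) * (1 - eaten m w)"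
proof -
  have "(\<Sum>s\<in>UNIV. rate m \<beta> w s * sgn1 s) = (\<Sum>i\<in>UNIV. if i = e1 then \<beta> / CARD('d) * (1 - eaten m w) else 0)"
    unfolding sum_direction_sign by (intro sum.cong) (auto simp: rate_def sgn1_def eaten_def field_simps)
  then show ?thesis by simp
qed

definition disp2 :: "nat \<Rightarrow> real \<Rightarrow> real \<Rightarrow> nat \<Rightarrow> real" where
  "disp2 m \<beta> v n = (\<Sum>w\<in>Ls n. weight m \<beta> w * (\<Sum>k<n. sgn1 (w ! k) - v)\<^sup>2)"

text \<open>Up to the factor \<open>\<beta> / d\<close>, \<open>q - eaten m w\<close> is the
  conditional mean of the next step along \<open>e1\<close> minus \<open>v\<close>. So this is the
  correlation of the centred step \<open>j\<close> with the fluctuation of the drift at time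
  \<open>n\<close>.\<close>

definition corr :: "nat \<Rightarrow> real \<Rightarrow> real \<Rightarrow> real \<Rightarrow> nat \<Rightarrow> nat \<Rightarrow> real" where
  "corr m \<beta> v q j n = (\<Sum>w\<in>Ls n. weight m \<beta> w * ((sgn1 (w ! j) - v) * (q - eaten m w)))"

text \<open>In the expanded square, the cross term averages to the fluctuation of the drift times
  the displacement, a sum of correlations; the square of the new centred step is at most 4.\<close>

lemma disp2_Suc_le:
  assumes b: "0 \<le> \<beta>" "\<beta> \<le> 1" and v: "v = \<beta> / CARD('d) * (1 - q)" "\<bar>v\<bar> \<le> 1"
  shows "disp2 m \<beta> v (Suc n) \<le> disp2 m \<beta> v n + 2 * (\<Sum>j<n. \<bar>corr m \<beta> v q j n\<bar>) + 4"
proof -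
  let ?S = "\<lambda>w. \<Sum>k<n. sgn1 (w ! k) - v"
  have w: "0 \<le> weight m \<beta> x" for x using b by (intro weight_nonneg) simp
  have step: "(\<Sum>s\<in>UNIV. rate m \<beta> w s * (?S w + (sgn1 s - v))\<^sup>2) \<le>
     (?S w)\<^sup>2 + 2 * (\<beta> / CARD('d)) * (?S w * (q - eaten m w)) + 4" for w
  proof -
    have "(sgn1 s - v)\<^sup>2 \<le> 2\<^sup>2" for s
      using abs_sgn1_le[of s] v(2) by (intro abs_le_square_iff[THEN iffD1]) simp
    then have "rate m \<beta> w s * (?S w + (sgn1 s - v))\<^sup>2 \<le>
        rate m \<beta> w s * ((?S w)\<^sup>2 - 2 * ?S w * v + 4) + 2 * ?S w * (rate m \<beta> w s * sgn1 s)" for s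
    proof -
      have "(A + (sgn1 s - v))\<^sup>2 \<le> (A\<^sup>2 - 2 * A * v + 4) + 2 * A * sgn1 s" for A
        using \<open>(sgn1 s - v)\<^sup>2 \<le> 2\<^sup>2\<close> power2_sum[of A "sgn1 s - v"]
        by (simp add: right_diff_distrib)
      from mult_left_mono[OF this[of "?S w"] rate_nonneg, of \<beta> m w s] b show ?thesis by (simp add: algebra_simps)
    qed
    then have "(\<Sum>s\<in>UNIV. rate m \<beta> w s * (?S w + (sgn1 s - v))\<^sup>2) \<le>
       (\<Sum>s\<in>UNIV. rate m \<beta> w s * ((?S w)\<^sup>2 - 2 * ?S w * v + 4) + 2 * ?S w * (rate m \<beta> w s * sgn1 s))"
      by (intro sum_mono)
    also have "\<dots> = (?S w)\<^sup>2 - 2 * ?S w * v + 4 + 2 * ?S w * (\<beta> / CARD('d) * (1 - eaten m w))"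
      by (simp only: sum.distrib sum_rate sum_rate_sgn1 mult_1 flip: sum_distrib_right sum_distrib_left)
    also have "\<dots> = (?S w)\<^sup>2 + 2 * (\<beta> / CARD('d)) * (?S w * (q - eaten m w)) + 4"
    proof -
      have "v = b * (1 - q) \<Longrightarrow> A\<^sup>2 - 2 * A * v + 4 + 2 * A * (b * (1 - e)) = A\<^sup>2 + 2 * b * (A * (q - e)) + 4"
        for A b e :: real by (erule ssubst) (simp add: algebra_simps)
      then show ?thesis using v(1) .
    qed
    finally show ?thesis .
  qed
  have "disp2 m \<beta> v (Suc n) = (\<Sum>w\<in>Ls n. weight m \<beta> w * (\<Sum>s\<in>UNIV. rate m \<beta> w s * (?S w + (sgn1 s - v))\<^sup>2))"
    unfolding disp2_def sum_Ls_snoc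
  proof (intro sum.cong refl)
    fix w :: "('d \<times> bool) list" assume "w \<in> Ls n"
    then have len: "length w = n" by simp
    have "(\<Sum>k<Suc n. sgn1 ((w @ [s]) ! k) - v) = ?S w + (sgn1 s - v)" for s
    proof -
      have "(\<Sum>k<n. sgn1 ((w @ [s]) ! k) - v) = ?S w"
        using len by (intro sum.cong) (auto simp: nth_append)
      then show ?thesis using len by (simp add: nth_append)
    qed
    then show "(\<Sum>s\<in>UNIV. weight m \<beta> (w @ [s]) * (\<Sum>k<Suc n. sgn1 ((w @ [s]) ! k) - v)\<^sup>2) =
        weight m \<beta> w * (\<Sum>s\<in>UNIV. rate m \<beta> w s * (?S w + (sgn1 s - v))\<^sup>2)"
      by (simp only: weight_snoc sum_distrib_left mult.assoc)
  qed
  also have "\<dots> \<le> (\<Sum>w\<in>Ls n. weight m \<beta> w * ((?S w)\<^sup>2 + 2 * (\<beta> / CARD('d)) * (?S w * (q - eaten m w)) + 4))"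
    by (intro sum_mono mult_left_mono step w)
  also have "\<dots> = disp2 m \<beta> v n + 2 * (\<beta> / CARD('d)) * (\<Sum>j<n. corr m \<beta> v q j n) + 4"
  proof -
    have "(\<Sum>w\<in>Ls n. weight m \<beta> w * (?S w * (q - eaten m w))) = (\<Sum>j<n. corr m \<beta> v q j n)"
      unfolding corr_def by (subst sum.swap) (simp only: sum_distrib_left sum_distrib_right)
    moreover have "(\<Sum>w\<in>Ls n. weight m \<beta> w * 4) = 4"
      using sum_weight[of m \<beta> "[]" n] by (simp flip: sum_distrib_right)
    ultimately show ?thesis
      by (simp only: distrib_left sum.distrib disp2_def mult.left_commute[of "weight m \<beta> _"]
          flip: sum_distrib_left)
  qed
  finally have "disp2 m \<beta> v (Suc n) \<le> disp2 m \<beta> v n + 2 * ((\<beta> / CARD('d)) * (\<Sum>j<n. corr m \<beta> v q j n)) + 4"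
    by (simp only: mult.assoc)
  moreover have "(\<beta> / CARD('d)) * (\<Sum>j<n. corr m \<beta> v q j n) \<le> 1 * (\<Sum>j<n. \<bar>corr m \<beta> v q j n\<bar>)"
  proof (rule order_trans)
    show "(\<beta> / CARD('d)) * (\<Sum>j<n. corr m \<beta> v q j n) \<le> (\<beta> / CARD('d)) * (\<Sum>j<n. \<bar>corr m \<beta> v q j n\<bar>)"
      using b by (intro mult_left_mono sum_mono) auto
    have "\<beta> / CARD('d) \<le> 1" using b div_card_le_1[of \<beta>] by simp
    then show "(\<beta> / CARD('d)) * (\<Sum>j<n. \<bar>corr m \<beta> v q j n\<bar>) \<le> 1 * (\<Sum>j<n. \<bar>corr m \<beta> v q j n\<bar>)"
      by (intro mult_right_mono sum_nonneg) auto
  qed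
  ultimately show ?thesis by linarith
qed

lemma corr_le:
  assumes b: "\<bar>\<beta>\<bar> \<le> 1" and v: "\<bar>v\<bar> \<le> 1" and q: "0 \<le> q" "q \<le> 1"
  shows "\<bar>corr m \<beta> v q j n\<bar> \<le> 2"
proof -
  have "\<bar>corr m \<beta> v q j n\<bar> \<le> (\<Sum>w\<in>Ls n. weight m \<beta> w * (2 * 1))"
    unfolding corr_def
  proof (intro order_trans[OF sum_abs] sum_mono)
    fix w
    have "\<bar>sgn1 (w ! j) - v\<bar> \<le> 2" using abs_sgn1_le[of "w ! j"] v by linarith
    moreover have "\<bar>q - eaten m w\<bar> \<le> 1" using q by (auto simp: eaten_def)
    ultimately show "\<bar>weight m \<beta> w * ((sgn1 (w ! j) - v) * (q - eaten m w))\<bar> \<le> weight m \<beta> w * (2 * 1)"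
      unfolding abs_mult using weight_nonneg[OF b, of m w] by (intro mult_mono) auto
  qed
  also have "\<dots> = 2"
    using sum_weight[of m \<beta> "[]" n] by (simp flip: sum_distrib_right)
  finally show ?thesis .
qed

text \<open>Step \<open>j\<close> lies in the first \<open>n\<close> steps and the drift is observed
  \<open>l\<close> steps later. Up to the absence of a cut in between, the two decouple, leaving the
  distance of \<open>q\<close> from \<open>eaten_prob m l \<beta>\<close>.\<close>

lemma corr_far_le:
  assumes b: "\<bar>\<beta>\<bar> \<le> 1" and v: "\<bar>v\<bar> \<le> 1" and j: "j < n"
  shows "\<bar>corr m \<beta> v q j (n + l)\<bar> \<le> 2 * \<bar>q - eaten_prob m l \<beta>\<bar> + 4 * no_cut_prob n l"
proof -
  let ?G = "\<lambda>u. sgn1 (u ! j) - v"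
  let ?e = "\<lambda>u. (\<Sum>y\<in>Ls l. eaten m (u @ y) * weight m \<beta> (u @ y)) - weight m \<beta> u * eaten_prob m l \<beta>"
  have G: "\<bar>?G u\<bar> \<le> 2" for u using abs_sgn1_le[of "u ! j"] v by linarith
  have "corr m \<beta> v q j (n + l) = (\<Sum>u\<in>Ls n. ?G u * (weight m \<beta> u * (q - eaten_prob m l \<beta>)) - ?G u * ?e u)"
    unfolding corr_def sum_Ls_add
  proof (intro sum.cong refl)
    fix u :: "('d \<times> bool) list" assume "u \<in> Ls n"
    then have "(u @ y) ! j = u ! j" for y using j by (simp add: nth_append)
    then have "(\<Sum>y\<in>Ls l. weight m \<beta> (u @ y) * ((sgn1 ((u @ y) ! j) - v) * (q - eaten m (u @ y)))) =
       ?G u * (q * (\<Sum>y\<in>Ls l. weight m \<beta> (u @ y)) - (\<Sum>y\<in>Ls l. eaten m (u @ y) * weight m \<beta> (u @ y)))"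
      by (simp add: sum_distrib_left algebra_simps flip: sum_subtractf)
    then show "(\<Sum>y\<in>Ls l. weight m \<beta> (u @ y) * ((sgn1 ((u @ y) ! j) - v) * (q - eaten m (u @ y)))) =
       ?G u * (weight m \<beta> u * (q - eaten_prob m l \<beta>)) - ?G u * ?e u"
      unfolding sum_weight by (simp add: algebra_simps)
  qed
  also have "\<dots> = (\<Sum>u\<in>Ls n. ?G u * (weight m \<beta> u * (q - eaten_prob m l \<beta>))) - (\<Sum>u\<in>Ls n. ?G u * ?e u)"
    by (rule sum_subtractf)
  also have "\<bar>\<dots>\<bar> \<le> 2 * \<bar>q - eaten_prob m l \<beta>\<bar> + 2 * 2 * no_cut_prob n l"
  proof (rule order_trans[OF abs_triangle_ineq4], rule add_mono)
    show "\<bar>\<Sum>u\<in>Ls n. ?G u * ?e u\<bar> \<le> 2 * 2 * no_cut_prob n l"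
      by (intro eaten_decorrelation b G)
    have "\<bar>\<Sum>u\<in>Ls n. ?G u * (weight m \<beta> u * (q - eaten_prob m l \<beta>))\<bar> \<le>
        (\<Sum>u\<in>Ls n. 2 * (weight m \<beta> u * \<bar>q - eaten_prob m l \<beta>\<bar>))"
    proof (intro order_trans[OF sum_abs] sum_mono)
      fix u
      show "\<bar>?G u * (weight m \<beta> u * (q - eaten_prob m l \<beta>))\<bar> \<le> 2 * (weight m \<beta> u * \<bar>q - eaten_prob m l \<beta>\<bar>)"
        unfolding abs_mult using G[of u] weight_nonneg[OF b, of m u] by (intro mult_mono) auto
    qed
    also have "\<dots> = 2 * \<bar>q - eaten_prob m l \<beta>\<bar>"
      using sum_weight[of m \<beta> "[]" n] by (simp flip: sum_distrib_right sum_distrib_left)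
    finally show "\<bar>\<Sum>u\<in>Ls n. ?G u * (weight m \<beta> u * (q - eaten_prob m l \<beta>))\<bar> \<le> 2 * \<bar>q - eaten_prob m l \<beta>\<bar>" .
  qed
  finally show ?thesis by simp
qed

text \<open>Steps among the last \<open>l\<close> get the trivial correlation bound 2, earlier ones
  \<open>\<epsilon>\<close>. Hence each time step adds at most
  \<open>4 + 2 * (2 * l + T * \<epsilon>)\<close>.\<close>

lemma disp2_le:
  assumes b: "0 \<le> \<beta>" "\<beta> \<le> 1" and v: "v = \<beta> / CARD('d) * (1 - q)" "\<bar>v\<bar> \<le> 1" and q: "0 \<le> q" "q \<le> 1"
    and \<epsilon>: "0 \<le> \<epsilon>" "\<And>n. n + l \<le> T \<Longrightarrow> 2 * \<bar>q - eaten_prob m l \<beta>\<bar> + 4 * no_cut_prob n l \<le> \<epsilon>"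
  shows "n \<le> T \<Longrightarrow> disp2 m \<beta> v n \<le> real n * (4 + 4 * real l + 2 * real T * \<epsilon>)"
proof (induction n)
  case 0 show ?case by (simp add: disp2_def)
next
  case (Suc n)
  have b': "\<bar>\<beta>\<bar> \<le> 1" using b by simp
  have "(\<Sum>j<n. \<bar>corr m \<beta> v q j n\<bar>) \<le> (\<Sum>j<n. \<epsilon> + (if n - l \<le> j then 2 else 0))"
  proof (intro sum_mono)
    fix j assume "j \<in> {..<n}"
    show "\<bar>corr m \<beta> v q j n\<bar> \<le> \<epsilon> + (if n - l \<le> j then 2 else 0)"
    proof (cases "n - l \<le> j")
      case True
      then show ?thesis using corr_le[OF b' v(2) q, of m j n] \<epsilon>(1) by simp
    next
      case False
      then have "n = (n - l) + l" "j < n - l" by auto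
      then have "\<bar>corr m \<beta> v q j n\<bar> \<le> 2 * \<bar>q - eaten_prob m l \<beta>\<bar> + 4 * no_cut_prob (n - l) l"
        using corr_far_le[OF b' v(2), of j "n - l" m q l] by simp
      also have "\<dots> \<le> \<epsilon>" using Suc.prems False by (intro \<epsilon>(2)) simp
      finally show ?thesis using False by simp
    qed
  qed
  also have "\<dots> = real n * \<epsilon> + 2 * real (card ({..<n} \<inter> {j. n - l \<le> j}))"
    by (simp add: sum.distrib sum.If_cases)
  also have "\<dots> \<le> real T * \<epsilon> + 2 * real l"
  proof -
    have "{..<n} \<inter> {j. n - l \<le> j} \<subseteq> {n - l..<n}" by auto
    from card_mono[OF _ this] have "card ({..<n} \<inter> {j. n - l \<le> j}) \<le> l" by simp
    then show ?thesis using Suc.prems \<epsilon>(1) by (intro add_mono mult_right_mono) auto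
  qed
  finally have "disp2 m \<beta> v (Suc n) \<le> disp2 m \<beta> v n + (4 + 4 * real l + 2 * real T * \<epsilon>)"
    using disp2_Suc_le[OF b v, of m n] by linarith
  then show ?case using Suc by (simp add: algebra_simps)
qed

lemma eaten_prob_bounds:
  assumes "\<bar>\<beta>\<bar> \<le> 1" shows "0 \<le> eaten_prob m n \<beta>" "eaten_prob m n \<beta> \<le> 1"
proof -
  note w = weight_nonneg[OF assms]
  show "0 \<le> eaten_prob m n \<beta>"
    unfolding eaten_prob_def using w eaten_bounds by (intro sum_nonneg mult_nonneg_nonneg) auto
  have "eaten_prob m n \<beta> \<le> (\<Sum>w\<in>Ls n. 1 * weight m \<beta> w)"
    unfolding eaten_prob_def using w eaten_bounds by (intro sum_mono mult_right_mono) auto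
  then show "eaten_prob m n \<beta> \<le> 1" using sum_weight[of m \<beta> "[]" n] by simp
qed

lemma eaten_lim_bounds:
  assumes d: "CARD('d) \<ge> 8" and b: "0 \<le> \<beta>" "\<beta> < 1"
  shows "0 \<le> eaten_lim m \<beta>" "eaten_lim m \<beta> \<le> 1"
proof -
  obtain C where C: "\<And>k. \<bar>eaten_lim m \<beta> - eaten_prob m (scale k) \<beta>\<bar> \<le> C * (1/2) ^ k"
    using eaten_lim[OF d] b by metis
  have "(\<lambda>k. C * (1/2) ^ k) \<longlonglongrightarrow> C * 0" by (intro tendsto_mult_left LIMSEQ_power_zero) auto
  then have g: "(\<lambda>k. C * (1/2) ^ k) \<longlonglongrightarrow> 0" by simp
  have "(\<lambda>k. eaten_lim m \<beta> - eaten_prob m (scale k) \<beta>) \<longlonglongrightarrow> 0"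
    by (rule Lim_null_comparison[OF _ g], intro always_eventually allI, unfold real_norm_def, rule C)
  then have lim: "(\<lambda>k. eaten_lim m \<beta> - (eaten_lim m \<beta> - eaten_prob m (scale k) \<beta>)) \<longlonglongrightarrow> eaten_lim m \<beta> - 0"
    by (intro tendsto_intros)
  show "0 \<le> eaten_lim m \<beta>" "eaten_lim m \<beta> \<le> 1"
    using LIMSEQ_le_const[OF lim, of 0] LIMSEQ_le_const2[OF lim, of 1] eaten_prob_bounds[of \<beta> m] b by auto
qed

definition speed :: "nat \<Rightarrow> real \<Rightarrow> real" where
  "speed m \<beta> = \<beta> / CARD('d) * (1 - eaten_lim m \<beta>)"

lemma speed_bounds:
  assumes d: "CARD('d) \<ge> 8" and b: "0 \<le> \<beta>" "\<beta> < 1"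
  shows "\<bar>speed m \<beta>\<bar> \<le> 1"
proof -
  have "\<bar>\<beta> / CARD('d)\<bar> \<le> 1" using b div_card_le_1[of \<beta>] by simp
  moreover have "\<bar>1 - eaten_lim m \<beta>\<bar> \<le> 1" using eaten_lim_bounds[OF assms, of m] by simp
  ultimately have "\<bar>\<beta> / CARD('d)\<bar> * \<bar>1 - eaten_lim m \<beta>\<bar> \<le> 1 * 1" by (intro mult_mono) auto
  then show ?thesis by (simp add: speed_def abs_mult)
qed

text \<open>At \<open>T = r ^ 36\<close> the gap \<open>scale k\<close> is used with
  \<open>2 ^ k\<close> of order \<open>r ^ 2\<close>. Then \<open>T\<close> has order
  \<open>2 ^ (18 * k)\<close> and the gap order \<open>2 ^ (16 * k)\<close>, so both the gap
  relative to \<open>T\<close> and the decorrelation error are at most of order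
  \<open>2 ^ (- k)\<close>, that is \<open>1 / r ^ 2\<close>, which is summable.\<close>

lemma disp2_subsequence:
  assumes d: "CARD('d) \<ge> 8" and b: "0 \<le> \<beta>" "\<beta> < 1"
  shows "\<exists>C\<ge>0. \<forall>r\<ge>1. disp2 m \<beta> (speed m \<beta>) (r ^ 36) \<le> C * (real r ^ 36)\<^sup>2 / (real r)\<^sup>2"
proof -
  obtain C where C: "C \<ge> 0" "\<And>k. \<bar>eaten_lim m \<beta> - eaten_prob m (scale k) \<beta>\<bar> \<le> C * (1/2) ^ k"
    using eaten_lim[OF d] b by metis
  obtain C' where C': "C' \<ge> 0" "\<And>k n. no_cut_prob n (scale k) \<le>
     C' * ((real (n + scale k) + 1)\<^sup>2 / 2 ^ (49 * k) + 1 / 2 ^ (17 * k))"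
    using no_cut_prob_rate[OF d] by blast
  \<comment> \<open>\<open>2 * C\<close> accounts for the distance to the limit. In the other term,
    \<open>2 ^ 38\<close> is \<open>(2 * 2 ^ 18) ^ 2\<close>, from the square of the number of
    steps.\<close>
  define c where "c = 2 * C + 4 * (C' * (2 ^ 38 + 1))"
  have c: "c \<ge> 0" using C C' by (simp add: c_def)
  have "disp2 m \<beta> (speed m \<beta>) (r ^ 36) \<le> (2 * (12 + 2 * c)) * (real r ^ 36)\<^sup>2 / (real r)\<^sup>2" if r: "r \<ge> 1" for r :: nat
  proof -
    obtain k where k: "2 ^ k \<le> r\<^sup>2" "r\<^sup>2 < 2 ^ (k + 1)"
      using ex_power_ivl1[of 2 "r\<^sup>2"] r by auto
    define T where "T = r ^ 36"
    define x where "x = (2::real) ^ k"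
    have x: "x \<ge> 1" by (simp add: x_def)
    have "(2 ^ k) ^ 18 \<le> (r\<^sup>2) ^ 18" using k(1) by (rule power_mono) simp
    then have "real ((2 ^ k) ^ 18) \<le> real T" unfolding of_nat_le_iff T_def by (simp flip: power_mult)
    then have T1: "x ^ 18 \<le> real T" by (simp add: x_def)
    have "(r\<^sup>2) ^ 18 \<le> (2 ^ (k + 1)) ^ 18" using k(2) by (intro power_mono) auto
    then have "real T \<le> real ((2 ^ (k + 1)) ^ 18)" unfolding of_nat_le_iff T_def by (simp flip: power_mult)
    then have T2: "real T \<le> 2 ^ 18 * x ^ 18" by (simp add: x_def power_mult_distrib)
    have l: "real (scale k) = 2 * x ^ 16" by (simp add: scale_eq x_def mult.commute flip: power_mult)
    have half: "(1/2::real) ^ k = 1 / x" by (simp add: x_def power_one_over)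
    have e: "(2::real) ^ (49 * k) = x ^ 49" "(2::real) ^ (17 * k) = x ^ 17"
      by (simp_all add: x_def mult.commute flip: power_mult)
    have pi: "no_cut_prob n (scale k) \<le> C' * (2 ^ 38 + 1) / x" if n: "n + scale k \<le> T" for n
    proof -
      have x18: "1 \<le> x ^ 18" using x by simp
      have "real (n + scale k) \<le> real T" using n by (simp only: of_nat_le_iff)
      moreover have "x ^ 18 \<le> 2 ^ 18 * x ^ 18" using x18 by simp
      ultimately have "real (n + scale k) + 1 \<le> 2 * (2 ^ 18 * x ^ 18)"
        using T2 x18 unfolding mult_2 by linarith
      then have "(real (n + scale k) + 1)\<^sup>2 \<le> (2 * (2 ^ 18 * x ^ 18))\<^sup>2" by (rule power_mono) simp
      also have "\<dots> = 2 ^ 38 * x ^ 36" by (simp add: power_mult_distrib flip: power_mult)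
      also have "\<dots> \<le> 2 ^ 38 * x ^ 48" using x by (intro mult_left_mono power_increasing) auto
      finally have "(real (n + scale k) + 1)\<^sup>2 / x ^ 49 \<le> 2 ^ 38 * x ^ 48 / x ^ 49"
        using x by (intro divide_right_mono) auto
      also have "\<dots> = 2 ^ 38 / x" using x by (simp add: field_simps flip: power_Suc)
      finally have 1: "(real (n + scale k) + 1)\<^sup>2 / x ^ 49 \<le> 2 ^ 38 / x" .
      have 2: "1 / x ^ 17 \<le> 1 / x" using x self_le_power[of x 17] by (intro divide_left_mono) auto
      have "no_cut_prob n (scale k) \<le> C' * ((real (n + scale k) + 1)\<^sup>2 / x ^ 49 + 1 / x ^ 17)"
        using C'(2)[of n k] unfolding e .
      also have "\<dots> \<le> C' * (2 ^ 38 / x + 1 / x)" using 1 2 C'(1) by (intro mult_left_mono add_mono)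
      finally show ?thesis by (simp add: add_divide_distrib distrib_left)
    qed
    have "disp2 m \<beta> (speed m \<beta>) T \<le> real T * (4 + 4 * real (scale k) + 2 * real T * (c / x))"
    proof (rule disp2_le)
      fix n assume "n + scale k \<le> T"
      from pi[OF this] C(2)[of k]
      show "2 * \<bar>eaten_lim m \<beta> - eaten_prob m (scale k) \<beta>\<bar> + 4 * no_cut_prob n (scale k) \<le> c / x"
        unfolding half by (simp add: c_def add_divide_distrib)
    qed (use b c x speed_bounds[OF d b] eaten_lim_bounds[OF d b] in \<open>auto simp: speed_def\<close>)
    also have "\<dots> \<le> real T * ((12 + 2 * c) * (real T / x))"
    proof (intro mult_left_mono)
      have "x ^ 16 * x \<le> x ^ 18" using x power_increasing[of 17 18 x] by (simp flip: power_Suc2)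
      also note T1
      finally have "x ^ 16 \<le> real T / x" using x by (simp add: field_simps)
      moreover have "1 \<le> x ^ 16" using x by simp
      ultimately have "4 + 4 * real (scale k) \<le> 12 * (real T / x)" unfolding l by linarith
      then show "4 + 4 * real (scale k) + 2 * real T * (c / x) \<le> (12 + 2 * c) * (real T / x)"
      proof -
        have "(12 + 2 * c) * (real T / x) = 12 * (real T / x) + 2 * real T * (c / x)"
          by (simp add: distrib_right add_divide_distrib)
        then show ?thesis using \<open>4 + 4 * real (scale k) \<le> 12 * (real T / x)\<close> by linarith
      qed
    qed simp
    also have "\<dots> = (12 + 2 * c) * (real r ^ 36)\<^sup>2 * (1 / x)"
      by (simp add: T_def power2_eq_square)
    also have "\<dots> \<le> (12 + 2 * c) * (real r ^ 36)\<^sup>2 * (2 / (real r)\<^sup>2)"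
    proof (intro mult_left_mono)
      have "real (r\<^sup>2) < real (2 ^ (k + 1))" using k(2) by (simp only: of_nat_less_iff)
      then have "(real r)\<^sup>2 < 2 * x" by (simp add: x_def)
      then show "1 / x \<le> 2 / (real r)\<^sup>2" using x r by (simp add: field_simps)
    qed (use c in auto)
    finally show ?thesis by (simp add: T_def algebra_simps add_divide_distrib)
  qed
  then show ?thesis using c by (intro exI[of _ "2 * (12 + 2 * c)"]) auto
qed

end

section \<open>From step words to the law of the walk\<close>

context excited_walk begin

definition path :: "('d \<times> bool) list \<Rightarrow> nat \<Rightarrow> int ^ 'd" where
  "path w k = pos (take k w)"

lemma dir_inj: "dir s = dir t \<Longrightarrow> s = t"
  by (cases s; cases t) (auto simp: dir_def axis_eq_axis split: if_splits)

lemma dir_cases: "s \<in> {1, -1} \<Longrightarrow> \<exists>t. axis i s = dir t"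
  by (auto simp: dir_def intro: exI[of _ "(i, True)"] exI[of _ "(i, False)"])

lemma path_inj:
  assumes "length w = n" "length w' = n" "\<And>k. k \<le> n \<Longrightarrow> path w k = path w' k"
  shows "w = w'"
proof (rule nth_equalityI)
  fix k assume k: "k < length w"
  have "path x (Suc k) = path x k + dir (x ! k)" if "length x = n" for x
    using k assms(1) that by (simp add: path_def take_Suc_conv_app_nth pos_def)
  then show "w ! k = w' ! k"
    using assms k by (metis Suc_leI add_left_cancel dir_inj less_imp_le_nat)
qed (use assms in simp)

lemma path_exists:
  assumes "y 0 = 0" "\<And>n. \<exists>i. \<exists>s\<in>{1, -1}. y (Suc n) - y n = axis i s"
  shows "\<exists>w. length w = n \<and> (\<forall>k\<le>n. y k = path w k)"
proof (induction n)
  case 0 then show ?case using assms(1) by (simp add: path_def)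
next
  case (Suc n)
  then obtain w where w: "length w = n" "\<And>k. k \<le> n \<Longrightarrow> y k = path w k" by blast
  obtain i s where "s \<in> {1, -1}" "y (Suc n) - y n = axis i s" using assms(2) by blast
  then obtain t where t: "y (Suc n) - y n = dir t" using dir_cases by metis
  have "y k = path (w @ [t]) k" if "k \<le> Suc n" for k
  proof (cases "k = Suc n")
    case True
    have "y (Suc n) = y n + dir t" using t by (simp add: algebra_simps)
    then show ?thesis using True w by (simp add: path_def pos_def)
  qed (use w that in \<open>simp add: path_def\<close>)
  then show ?case using w(1) by (intro exI[of _ "w @ [t]"]) auto
qed

lemma weight_pos:
  assumes "0 \<le> \<beta>" "\<beta> < 1" shows "0 < weight m \<beta> w"
  unfolding weight_def using assms by (intro prod_pos) (auto simp: rate_def)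

text \<open>For \<open>\<beta> < 1\<close> all weights are positive, so every history along the word
  has positive probability and the conditional probabilities that define the law apply at each step
  of the induction.\<close>

lemma prob_path:
  assumes b: "0 \<le> \<beta>" "\<beta> < 1" and P: "is_erw_law e1 m \<beta> P"
  shows "measure P {Y \<in> space P. \<forall>k\<le>length w. Y k = path w k} = weight m \<beta> w"
proof (induction w rule: rev_induct)
  interpret prob_space P using P by (simp add: is_erw_law_def)
  have s: "sets P = sets (Pi\<^sub>M UNIV (\<lambda>_. count_space UNIV))" and ae: "AE Y in P. Y 0 = 0"
    using P by (simp_all add: is_erw_law_def)
  note ev = cyl_event[OF s]
  {
    case Nil
    have "AE Y in P. Y \<in> {Y \<in> space P. \<forall>k\<le>0. Y k = path [] k}"
      using ae AE_space[of P] by eventually_elim (simp add: path_def)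
    then show ?case using prob_eq_1[OF ev[of 0 "path []"]] by simp
  next
    case (snoc t w)
    define n where "n = length w"
    define \<sigma> where "\<sigma> = (if snd t then 1 else -1 :: int)"
    let ?y = "path (w @ [t])"
    have y: "?y k = path w k" if "k \<le> n" for k using that by (simp add: path_def n_def)
    have ySuc: "?y (Suc n) = path w n + axis (fst t) \<sigma>"
      by (simp add: path_def n_def pos_def dir_def \<sigma>_def)
    have pre: "{Y \<in> space P. \<forall>k\<le>n. Y k = ?y k} = {Y \<in> space P. \<forall>k\<le>n. Y k = path w k}"
      using y by auto
    have IH: "\<P>(Y in P. \<forall>k\<le>n. Y k = ?y k) = weight m \<beta> w"
      using snoc unfolding n_def[symmetric] pre by simp
    then have pos: "\<P>(Y in P. \<forall>k\<le>n. Y k = ?y k) > 0" using weight_pos[OF b] by simp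
    have "\<P>(Y in P. Y (Suc n) - Y n = axis (fst t) \<sigma> \<bar> \<forall>k\<le>n. Y k = ?y k) =
        (if fst t = e1 \<and> card {k. k < n \<and> ?y k = ?y n} < m
              then (1 + of_int \<sigma> * \<beta>) / (2 * CARD('d)) else 1 / (2 * CARD('d)))"
    proof -
      have "\<forall>n y. \<P>(Y in P. \<forall>k\<le>n. Y k = y k) > 0 \<longrightarrow> (\<forall>i. \<forall>s\<in>{1, -1}.
           \<P>(Y in P. Y (Suc n) - Y n = axis i s \<bar> \<forall>k\<le>n. Y k = y k) =
             (if i = e1 \<and> card {k. k < n \<and> y k = y n} < m
              then (1 + of_int s * \<beta>) / (2 * CARD('d)) else 1 / (2 * CARD('d))))"
        using P unfolding is_erw_law_def by (elim conjE) assumption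
      moreover have "\<sigma> \<in> {1, -1}" by (simp add: \<sigma>_def)
      ultimately show ?thesis using pos by blast
    qed
    also have "{k. k < n \<and> ?y k = ?y n} = {k. k < length w \<and> pos (take k w) = pos w}"
      using y by (auto simp: n_def path_def)
    also have "(if fst t = e1 \<and> card {k. k < length w \<and> pos (take k w) = pos w} < m
              then (1 + of_int \<sigma> * \<beta>) / (2 * CARD('d)) else 1 / (2 * CARD('d))) = rate m \<beta> w t"
      by (simp add: rate_def visits_def \<sigma>_def)
    finally have "\<P>(Y in P. Y (Suc n) - Y n = axis (fst t) \<sigma> \<and> (\<forall>k\<le>n. Y k = ?y k)) = weight m \<beta> w * rate m \<beta> w t"
      using pos unfolding cond_prob_def IH by (simp add: field_simps)
    moreover have "{Y \<in> space P. \<forall>k\<le>length (w @ [t]). Y k = ?y k} =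
        {Y \<in> space P. Y (Suc n) - Y n = axis (fst t) \<sigma> \<and> (\<forall>k\<le>n. Y k = ?y k)}"
      using ySuc y[of n] by (auto simp: n_def[symmetric] le_Suc_eq diff_eq_eq add.commute)
    ultimately show ?case by (simp add: weight_snoc)
  }
qed

text \<open>Almost every trajectory follows exactly one step word up to time \<open>n\<close>, so a
  function of the first positions is a finite combination of cylinder indicators.\<close>

lemma nn_integral_path:
  assumes b: "0 \<le> \<beta>" "\<beta> < 1" and P: "is_erw_law e1 m \<beta> P"
    and g: "\<And>Y. 0 \<le> g Y" "\<And>Y Y'. (\<And>k. k \<le> n \<Longrightarrow> Y k = Y' k) \<Longrightarrow> g Y = g Y'"
  shows "(\<integral>\<^sup>+Y. ennreal (g Y) \<partial>P) = ennreal (\<Sum>w\<in>Ls n. weight m \<beta> w * g (path w))"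
proof -
  interpret prob_space P using P by (simp add: is_erw_law_def)
  have s: "sets P = sets (Pi\<^sub>M UNIV (\<lambda>_. count_space UNIV))"
    and ae: "AE Y in P. Y 0 = 0" "AE Y in P. \<forall>n. \<exists>i. \<exists>s\<in>{1, -1}. Y (Suc n) - Y n = axis i s"
    using P by (simp_all add: is_erw_law_def)
  let ?A = "\<lambda>w. {Y \<in> space P. \<forall>k\<le>n. Y k = path w k}"
  have A: "?A w \<in> sets P" for w by (rule cyl_event[OF s])
  have "(\<integral>\<^sup>+Y. ennreal (g Y) \<partial>P) = (\<integral>\<^sup>+Y. (\<Sum>w\<in>Ls n. ennreal (g (path w)) * indicator (?A w) Y) \<partial>P)"
  proof (rule nn_integral_cong_AE)
    show "AE Y in P. ennreal (g Y) = (\<Sum>w\<in>Ls n. ennreal (g (path w)) * indicator (?A w) Y)"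
      using ae AE_space[of P]
    proof eventually_elim
      case (elim Y)
      have "\<exists>w. length w = n \<and> (\<forall>k\<le>n. Y k = path w k)"
        by (rule path_exists[of Y n, OF elim(1)]) (rule elim(2)[THEN spec])
      then obtain w where w: "length w = n" "\<And>k. k \<le> n \<Longrightarrow> Y k = path w k"
        by (elim exE conjE) simp
      have ind: "indicator (?A w') Y = (if w' = w then 1 else 0 :: ennreal)" if "w' \<in> Ls n" for w'
      proof (cases "w' = w")
        case False
        have "\<not> (\<forall>k\<le>n. Y k = path w' k)"
        proof
          assume "\<forall>k\<le>n. Y k = path w' k"
          then have "w' = w" using w that by (intro path_inj[of w' n w]) simp_all
          with False show False ..
        qed
        then show ?thesis using False by simp
      qed (use w elim in auto)
      have "(\<Sum>w'\<in>Ls n. ennreal (g (path w')) * indicator (?A w') Y) =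
          (\<Sum>w'\<in>Ls n. if w' = w then ennreal (g (path w')) else 0)"
        by (intro sum.cong) (auto simp: ind)
      also have "\<dots> = ennreal (g (path w))" using w(1) by simp
      also have "g (path w) = g Y" using w(2) by (intro g(2)) simp
      finally show ?case by simp
    qed
  qed
  also have "\<dots> = (\<Sum>w\<in>Ls n. \<integral>\<^sup>+Y. ennreal (g (path w)) * indicator (?A w) Y \<partial>P)"
    by (intro nn_integral_sum borel_measurable_times_ennreal borel_measurable_const borel_measurable_indicator A)
  also have "\<dots> = (\<Sum>w\<in>Ls n. ennreal (weight m \<beta> w * g (path w)))"
  proof (rule sum.cong[OF refl])
    fix w :: "('d \<times> bool) list" assume w: "w \<in> Ls n"
    have "(\<integral>\<^sup>+Y. ennreal (g (path w)) * indicator (?A w) Y \<partial>P) = ennreal (g (path w)) * emeasure P (?A w)"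
      by (rule nn_integral_cmult_indicator[OF A])
    also have "emeasure P (?A w) = ennreal (weight m \<beta> w)"
      using prob_path[OF b P, of w] w by (simp add: emeasure_eq_measure)
    finally show "(\<integral>\<^sup>+Y. ennreal (g (path w)) * indicator (?A w) Y \<partial>P) = ennreal (weight m \<beta> w * g (path w))"
      using g(1) by (simp add: ennreal_mult' mult.commute)
  qed
  also have "\<dots> = ennreal (\<Sum>w\<in>Ls n. weight m \<beta> w * g (path w))"
    using weight_pos[OF b] g(1) by (intro sum_ennreal) (simp add: less_imp_le)
  finally show ?thesis .
qed

lemma law_of_large_numbers:
  assumes d: "CARD('d) \<ge> 8" and b: "0 \<le> \<beta>" "\<beta> < 1" and P: "is_erw_law e1 m \<beta> P"
  shows "AE Y in P. (\<lambda>n. of_int (Y n $ e1) / real n) \<longlonglongrightarrow> speed m \<beta>"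
proof -
  let ?v = "speed m \<beta>"
  have s: "sets P = sets (Pi\<^sub>M UNIV (\<lambda>_. count_space UNIV))"
    and ae: "AE Y in P. Y 0 = 0" "AE Y in P. \<forall>n. \<exists>i. \<exists>s\<in>{1, -1}. Y (Suc n) - Y n = axis i s"
    using P by (simp_all add: is_erw_law_def)
  have [measurable_cong]: "sets P = sets (Pi\<^sub>M UNIV (\<lambda>_. count_space UNIV))" by (rule s)
  define S where "S n Y = of_int (Y n $ e1) - real n * ?v" for n and Y :: "nat \<Rightarrow> int ^ 'd"
  have coord: "(\<lambda>Y. real_of_int (Y n $ e1)) \<in> borel_measurable P" for n
  proof (rule measurable_compose[where g = "\<lambda>x. real_of_int (x $ e1)"])
    show "(\<lambda>Y. Y n) \<in> P \<rightarrow>\<^sub>M count_space UNIV" by measurable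
  qed simp
  then have S_meas: "S n \<in> borel_measurable P" for n unfolding S_def[abs_def] by measurable
  define Z where "Z r Y = S (r ^ 36) Y / real r ^ 36" for r Y
  obtain C where C: "C \<ge> 0" "\<And>r. r \<ge> 1 \<Longrightarrow> disp2 m \<beta> ?v (r ^ 36) \<le> C * (real r ^ 36)\<^sup>2 / (real r)\<^sup>2"
    using disp2_subsequence[OF d b] by blast
  have "AE Y in P. (\<lambda>r. Z r Y) \<longlonglongrightarrow> 0"
  proof (rule AE_tendsto_0_from_second_moments)
    show "Z r \<in> borel_measurable P" for r
      unfolding Z_def[abs_def] by (intro borel_measurable_divide S_meas) simp
    show "summable (\<lambda>r. C * (1 / (real r)\<^sup>2))"
      by (intro summable_mult) (use inverse_power_summable[of 2, where 'a = real] in \<open>simp add: inverse_eq_divide\<close>)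
    show "0 \<le> C * (1 / (real r)\<^sup>2)" for r using C(1) by simp
    show "(\<integral>\<^sup>+Y. ennreal ((Z r Y)\<^sup>2) \<partial>P) \<le> ennreal (C * (1 / (real r)\<^sup>2))" for r
    \<comment> \<open>At \<open>r = 0\<close> both sides are 0, since division by 0 yields
      0.\<close>
    proof (cases "r = 0")
      case True
      then show ?thesis by (simp add: Z_def)
    next
      case False
      have SP: "S n (path w) = (\<Sum>k<n. sgn1 (w ! k) - ?v)" if "length w = n" for n w
        using pos_nth_e1[of w] that by (simp add: S_def path_def sum_subtractf)
      have "(\<integral>\<^sup>+Y. ennreal ((Z r Y)\<^sup>2) \<partial>P) = ennreal (\<Sum>w\<in>Ls (r ^ 36). weight m \<beta> w * (Z r (path w))\<^sup>2)"
        by (rule nn_integral_path[OF b P]) (auto simp: Z_def S_def)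
      also have "(\<Sum>w\<in>Ls (r ^ 36). weight m \<beta> w * (Z r (path w))\<^sup>2) = disp2 m \<beta> ?v (r ^ 36) / (real r ^ 36)\<^sup>2"
        unfolding disp2_def sum_divide_distrib Z_def by (intro sum.cong refl) (simp add: SP power_divide)
      also have "\<dots> \<le> C * (real r ^ 36)\<^sup>2 / (real r)\<^sup>2 / (real r ^ 36)\<^sup>2"
        using False by (intro divide_right_mono C(2)) auto
      also have "\<dots> = C * (1 / (real r)\<^sup>2)"
      proof -
        have "x \<noteq> 0 \<Longrightarrow> C * x / y / x = C * (1 / y)" for x y :: real by simp
        then show ?thesis by this (use False in simp)
      qed
      finally show ?thesis by (simp add: ennreal_leI)
    qed
  qed
  then show ?thesis using ae
  proof eventually_elim
    case (elim Y)
    have "(\<lambda>n. S n Y / real n) \<longlonglongrightarrow> 0"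
    proof (rule bounded_increment_interpolation[of _ 2 36])
      show "(\<lambda>r. S (r ^ 36) Y / real r ^ 36) \<longlonglongrightarrow> 0" using elim(1) by (simp add: Z_def)
      fix n
      obtain i s where "s \<in> {1, -1}" "Y (Suc n) - Y n = axis i s" using elim(3) by blast
      then obtain t where "Y (Suc n) - Y n = dir t" using dir_cases by metis
      then have "real_of_int ((Y (Suc n) - Y n) $ e1) = sgn1 t" by (simp only: dir_nth_e1)
      then have "S (Suc n) Y - S n Y = sgn1 t - ?v" by (simp add: S_def algebra_simps)
      then show "\<bar>S (Suc n) Y - S n Y\<bar> \<le> 2"
        using abs_sgn1_le[of t] speed_bounds[OF d b, of m] by linarith
    qed simp
    then have "(\<lambda>n. S n Y / real n + ?v) \<longlonglongrightarrow> 0 + ?v" by (intro tendsto_intros)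
    moreover have "\<forall>\<^sub>F n in sequentially. S n Y / real n + ?v = of_int (Y n $ e1) / real n"
      using eventually_gt_at_top[of 0] by eventually_elim (simp add: S_def diff_divide_distrib)
    ultimately have "(\<lambda>n. of_int (Y n $ e1) / real n) \<longlonglongrightarrow> 0 + ?v"
      by (rule Lim_transform_eventually)
    then show ?case by simp
  qed
qed

lemma erw_speed_eq:
  assumes d: "CARD('d) \<ge> 8" and b: "0 \<le> \<beta>" "\<beta> < 1"
  shows "erw_speed e1 m \<beta> = speed m \<beta>"
proof -
  have P: "is_erw_law e1 m \<beta> (erw_law e1 m \<beta>)" using b by (intro is_erw_law_erw_law) auto
  then interpret prob_space "erw_law e1 m \<beta>" by (simp add: is_erw_law_def)
  note lln = law_of_large_numbers[OF d b P]
  show ?thesis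
    unfolding erw_speed_def
  proof (rule the_equality)
    show "AE Y in erw_law e1 m \<beta>. (\<lambda>n. of_int (Y n $ e1) / real n) \<longlonglongrightarrow> speed m \<beta>"
      by (rule lln)
    fix v assume "AE Y in erw_law e1 m \<beta>. (\<lambda>n. of_int (Y n $ e1) / real n) \<longlonglongrightarrow> v"
    with lln have "AE Y in erw_law e1 m \<beta>. v = speed m \<beta>"
      by eventually_elim (rule LIMSEQ_unique)
    then show "v = speed m \<beta>" by simp
  qed
qed

section \<open>Derivative and monotonicity of the speed\<close>

definition dspeed :: "nat \<Rightarrow> real \<Rightarrow> real" where
  "dspeed m \<beta> = (1 - eaten_lim m \<beta>) / CARD('d) - \<beta> / CARD('d) * deaten_lim m \<beta>"

text \<open>\<open>erw_speed\<close> and \<open>speed\<close> are identified only on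
  \<open>[0,1)\<close>, so the derivative is transferred within that set.\<close>

lemma erw_speed_has_derivative:
  assumes d: "CARD('d) \<ge> 8" and b: "0 \<le> \<beta>" "\<beta> < 1"
  shows "(erw_speed e1 m has_real_derivative dspeed m \<beta>) (at \<beta> within {0..<1})"
proof -
  have "(eaten_lim m has_real_derivative deaten_lim m \<beta>) (at \<beta> within {0..<1})"
    using eaten_lim[OF d] b by metis
  then have "(speed m has_real_derivative dspeed m \<beta>) (at \<beta> within {0..<1})"
    unfolding speed_def[abs_def] dspeed_def
    by (auto intro!: derivative_eq_intros simp: field_simps)
  then show ?thesis
    unfolding has_field_derivative_def
    by (rule has_derivative_transform[rotated 2]) (use b erw_speed_eq[OF d] in auto)
qed

text \<open>The scale \<open>k\<close> is chosen from \<open>\<beta>0\<close> and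
  \<open>\<epsilon>\<close> alone; every \<open>m > scale k\<close> then makes the probabilities at
  that scale vanish, so both limits are bounded by errors that do not depend on
  \<open>m\<close>.\<close>

lemma dspeed_close:
  assumes d: "CARD('d) \<ge> 8" and b0: "0 \<le> \<beta>0" "\<beta>0 < 1" and e: "0 < \<epsilon>"
  shows "\<exists>m0. \<forall>m\<ge>m0. \<forall>\<beta>\<in>{0..\<beta>0}. \<bar>dspeed m \<beta> - 1 / CARD('d)\<bar> \<le> \<epsilon>"
proof -
  obtain C where C: "C \<ge> 0"
    "\<And>m k \<beta>. 0 \<le> \<beta> \<Longrightarrow> \<beta> < 1 \<Longrightarrow> \<bar>eaten_lim m \<beta> - eaten_prob m (scale k) \<beta>\<bar> \<le> C * (1/2) ^ k"
    "\<And>m k \<beta>. 0 \<le> \<beta> \<Longrightarrow> \<beta> < 1 \<Longrightarrow> \<bar>deaten_lim m \<beta> - deaten_prob m (scale k) \<beta>\<bar> \<le> C / (1 - \<beta>) * (1/2) ^ k"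
    using eaten_lim[OF d] by metis
  have "(\<lambda>k. (C + C / (1 - \<beta>0)) * (1/2) ^ k) \<longlonglongrightarrow> (C + C / (1 - \<beta>0)) * 0"
    by (intro tendsto_mult_left LIMSEQ_power_zero) auto
  then have "\<forall>\<^sub>F k in sequentially. (C + C / (1 - \<beta>0)) * (1/2) ^ k < \<epsilon>"
    by (rule order_tendstoD) (use e in simp)
  then obtain k where k: "(C + C / (1 - \<beta>0)) * (1/2) ^ k < \<epsilon>" by (auto simp: eventually_sequentially)
  have "\<bar>dspeed m \<beta> - 1 / CARD('d)\<bar> \<le> \<epsilon>" if m: "Suc (scale k) \<le> m" and \<beta>: "\<beta> \<in> {0..\<beta>0}" for m \<beta>
  proof -
    have b: "0 \<le> \<beta>" "\<beta> < 1" using \<beta> b0 by auto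
    have q: "\<bar>eaten_lim m \<beta>\<bar> \<le> C * (1/2) ^ k"
      using C(2)[OF b, of m k] eaten_prob_eq_0[of "scale k" m] m by simp
    have "\<bar>deaten_lim m \<beta>\<bar> \<le> C / (1 - \<beta>) * (1/2) ^ k"
      using C(3)[OF b, of m k] eaten_prob_eq_0[of "scale k" m] m by simp
    also have "\<dots> \<le> C / (1 - \<beta>0) * (1/2) ^ k"
      using \<beta> b0 C(1) by (intro mult_right_mono divide_left_mono) auto
    finally have q': "\<bar>deaten_lim m \<beta>\<bar> \<le> C / (1 - \<beta>0) * (1/2) ^ k" .
    have "dspeed m \<beta> - 1 / CARD('d) = - ((1 / CARD('d)) * eaten_lim m \<beta> + (\<beta> / CARD('d)) * deaten_lim m \<beta>)"
      by (simp add: dspeed_def diff_divide_distrib)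
    then have "\<bar>dspeed m \<beta> - 1 / CARD('d)\<bar> \<le> \<bar>(1 / CARD('d)) * eaten_lim m \<beta>\<bar> + \<bar>(\<beta> / CARD('d)) * deaten_lim m \<beta>\<bar>"
      by (simp only: abs_minus_cancel abs_triangle_ineq)
    also have "\<dots> \<le> 1 * \<bar>eaten_lim m \<beta>\<bar> + 1 * \<bar>deaten_lim m \<beta>\<bar>"
      unfolding abs_mult using b div_card_le_1[of 1] div_card_le_1[of \<beta>]
      by (intro add_mono mult_right_mono) auto
    also have "\<dots> \<le> \<epsilon>" using q q' k by (simp add: distrib_right)
    finally show ?thesis .
  qed
  then show ?thesis by (intro exI[of _ "Suc (scale k)"]) blast
qed

lemma erw_speed_strict_mono:
  assumes d: "CARD('d) \<ge> 8" and b0: "\<beta>0 < 1"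
    and pos: "\<And>\<beta>. \<beta> \<in> {0..\<beta>0} \<Longrightarrow> 0 < dspeed m \<beta>"
  shows "strict_mono_on {0..\<beta>0} (erw_speed e1 m)"
proof (rule strict_mono_onI)
  fix x y assume x: "x \<in> {0..\<beta>0}" and y: "y \<in> {0..\<beta>0}" and xy: "x < y"
  note D = erw_speed_has_derivative[OF d, of _ m]
  show "erw_speed e1 m x < erw_speed e1 m y"
  \<comment> \<open>At the left end 0 only a one-sided derivative is available; this form needs
    derivatives inside the interval and continuity at its ends.\<close>
  proof (rule DERIV_pos_imp_increasing_open[OF xy])
    fix z assume z: "x < z" "z < y"
    have "at z within {0..<1} = at z" by (rule at_within_interior) (use x y z b0 in auto)
    then have "(erw_speed e1 m has_real_derivative dspeed m z) (at z)"
      using D[of z] x y z b0 by simp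
    moreover have "0 < dspeed m z" using x y z by (intro pos) auto
    ultimately show "\<exists>D. (erw_speed e1 m has_real_derivative D) (at z) \<and> 0 < D" by blast
  next
    have "continuous_on {0..<1} (erw_speed e1 m)"
      by (rule DERIV_continuous_on[OF D]) auto
    then show "continuous_on {x..y} (erw_speed e1 m)"
      by (rule continuous_on_subset) (use x y b0 in auto)
  qed
qed

end

theorem theorem1p2:
  fixes e1 :: "'d::finite"
  assumes "CARD('d) \<ge> 8"
  shows "\<exists>v' :: nat \<Rightarrow> real \<Rightarrow> real.
     (\<forall>m\<ge>1. \<forall>\<beta>\<in>{0..<1}.
        (erw_speed e1 m has_real_derivative v' m \<beta>) (at \<beta> within {0..<1})) \<and>
     (\<forall>\<beta>0\<in>{0..<1}.
        (\<lambda>m. SUP \<beta>\<in>{0..\<beta>0}. ereal \<bar>v' m \<beta> - 1 / CARD('d)\<bar>) \<longlonglongrightarrow> 0) \<and>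
     (\<forall>\<beta>0\<in>{0..<1}. \<exists>m0\<ge>1. \<forall>m\<ge>m0. strict_mono_on {0..\<beta>0} (erw_speed e1 m))"
proof -
  interpret excited_walk e1 .
  have d: "CARD('d) \<ge> 8" by (rule assms)
  show ?thesis
  proof (intro exI[of _ dspeed] conjI ballI allI impI)
    fix m \<beta> assume "\<beta> \<in> {0..<1::real}"
    then show "(erw_speed e1 m has_real_derivative dspeed m \<beta>) (at \<beta> within {0..<1})"
      by (intro erw_speed_has_derivative[OF d]) auto
  next
    fix \<beta>0 :: real assume b0: "\<beta>0 \<in> {0..<1}"
    let ?s = "\<lambda>m. SUP \<beta>\<in>{0..\<beta>0}. ereal \<bar>dspeed m \<beta> - 1 / CARD('d)\<bar>"
    show "?s \<longlonglongrightarrow> 0"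
    proof (rule order_tendstoI)
      fix a :: ereal assume "a < 0"
      have "0 \<le> ?s m" for m
        by (rule SUP_upper2[of 0]) (use b0 in auto)
      with \<open>a < 0\<close> show "\<forall>\<^sub>F m in sequentially. a < ?s m"
        by (intro always_eventually allI) (rule less_le_trans)
    next
      fix a :: ereal assume "0 < a"
      then obtain \<epsilon> where \<epsilon>: "0 < ereal \<epsilon>" "ereal \<epsilon> < a" using ereal_dense2 by blast
      then obtain m0 where "\<forall>m\<ge>m0. \<forall>\<beta>\<in>{0..\<beta>0}. \<bar>dspeed m \<beta> - 1 / CARD('d)\<bar> \<le> \<epsilon>"
        using dspeed_close[OF d, of \<beta>0 \<epsilon>] b0 by auto
      then have "?s m \<le> ereal \<epsilon>" if "m \<ge> m0" for m
        using that by (intro SUP_least) simp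
      with \<epsilon>(2) show "\<forall>\<^sub>F m in sequentially. ?s m < a"
        unfolding eventually_sequentially using le_less_trans by blast
    qed
  next
    fix \<beta>0 :: real assume b0: "\<beta>0 \<in> {0..<1}"
    have D: "0 < 1 / real CARD('d)" by simp
    obtain m0 where m0: "\<forall>m\<ge>m0. \<forall>\<beta>\<in>{0..\<beta>0}. \<bar>dspeed m \<beta> - 1 / CARD('d)\<bar> \<le> 1 / CARD('d) / 2"
      using dspeed_close[OF d, of \<beta>0 "1 / CARD('d) / 2"] b0 by auto
    have "strict_mono_on {0..\<beta>0} (erw_speed e1 m)" if "m \<ge> max 1 m0" for m
    proof (rule erw_speed_strict_mono[OF d])
      fix \<beta> assume "\<beta> \<in> {0..\<beta>0}"
      then have "\<bar>dspeed m \<beta> - 1 / CARD('d)\<bar> \<le> 1 / CARD('d) / 2" using m0 that by simp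
      moreover have "0 < c \<Longrightarrow> \<bar>x - c\<bar> \<le> c / 2 \<Longrightarrow> 0 < x" for x c :: real by arith
      ultimately show "0 < dspeed m \<beta>" using D by blast
    qed (use b0 in auto)
    then show "\<exists>m0\<ge>1. \<forall>m\<ge>m0. strict_mono_on {0..\<beta>0} (erw_speed e1 m)"
      by (intro exI[of _ "max 1 m0"]) auto
  qed
qed

end
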